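(* For every $1<p<2$ and every $d\in[p,2)$, there exists a bounded quasidisk $\Omega\subset\mathbb{C}$ such that $$ \dim_{\mathrm H}(\partial\Omega)=\overline{\dim}_{\mathrm M}(\partial\Omega)=\dim_{\mathrm A}(\partial\Omega)=d \qquad\text{and}\qquad \int_\Omega \delta(z)^{p-2}\,dA(z)=\infty . $$ Consequently, the constant function $g\equiv1$ is a counterexample on $\Omega$ to the following estimate: for any fixed $z_0\in\Omega$, there is no finite constant $C$ for which $$ \int_\Omega |g(z)|^p\delta(z)^{p-2}\,dA(z)\le C\left\{|g(z_0)|^p\delta(z_0)^p+\int_\Omega |g'(z)|^p\delta(z)^{2p-2}\,dA(z)\right\} $$ holds with $g\equiv1$.
   Context: $\delta(z)=\operatorname{dist}(z,\partial\Omega)$ is the Euclidean distance to the boundary and $dA=dx\,dy$ is Euclidean area measure. A quasidisk is the image of a disk under a quasiconformal self-map of the (extended) plane; equivalently, a Jordan domain bounded by a quasicircle. $\dim_{\mathrm H}$ denotes Hausdorff dimension. Upper Minkowski dimension: for $\Gamma=\partial\Omega$ with $\Omega$ a bounded domain, let $U_t(\Gamma)=\{z\in\mathbb{C}:\operatorname{dist}(z,\Gamma)<t\}$ and let $|\cdot|$ denote area; then $\overline{\dim}_{\mathrm M}(\Gamma)=\inf\{s\ge0:\limsup_{t\downarrow0}|U_t(\Gamma)|/t^{2-s}<\infty\}$. Assouad dimension: for $E\subset\mathbb{C}$, $\dim_{\mathrm A}(E)$ is the infimum of all exponents $s\ge0$ for which there is a constant $C>0$ such that $N_r(E\cap B(x,R))\le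 C(R/r)^s$ for all $x\in E$ and all $0<r<R$, where $B(x,R)$ is the open ball and $N_r(A)$ is the smallest number of open balls of radius $r$ needed to cover $A$. *)

theory Defs
  imports "HOL-Complex_Analysis.Complex_Analysis"
begin

section \<open>Quasidisks\<close>

text \<open>
  Metric definition of quasiconformality: the ratio of the largest to the smallest
  displacement on circles of radius r about x, in the limit r to 0, is bounded uniformly in x.
\<close>

definition linear_dilatation :: "(complex \<Rightarrow> complex) \<Rightarrow> complex \<Rightarrow> ereal" where
  "linear_dilatation f x =
     Limsup (at_right 0) (\<lambda>r.
       (SUP y\<in>sphere x r. ereal (dist (f x) (f y))) / (INF y\<in>sphere x r. ereal (dist (f x) (f y))))"

text \<open>
  Orientation-reversing maps are admitted. Precomposing with the reflection in a line through
  the centre of a disk shows that the images of disks are the same as for orientation-preserving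
  maps.
\<close>

definition quasiconformal :: "(complex \<Rightarrow> complex) \<Rightarrow> bool" where
  "quasiconformal f \<longleftrightarrow>
     (\<exists>g. homeomorphism UNIV UNIV f g) \<and> (\<exists>H::real. \<forall>x. linear_dilatation f x \<le> ereal H)"

text \<open>
  The quasiconformal maps are self-maps of the finite plane, so every quasidisk in this sense is
  bounded. For bounded domains, maps of the extended plane yield the same class: if the image of
  a disk is bounded, the preimage of infinity lies off the closed disk and can be moved to
  infinity by a Moebius transformation that sends the disk to a disk.
\<close>

definition quasidisk :: "complex set \<Rightarrow> bool" where
  "quasidisk \<Omega> \<longleftrightarrow> (\<exists>f c r. quasiconformal f \<and> 0 < r \<and> \<Omega> = f ` ball c r)"


section \<open>Dimensions\<close>

text \<open>
  All dimensions are extended reals, so that the infimum of an empty set of exponents is infinite.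
\<close>

text \<open>
  The term diam(U) to the power s, with the convention 0 to the power 0 = 1 for nonempty U;
  note that \<^term>\<open>0 powr 0 = (0::real)\<close> in HOL.
\<close>

definition diam_power :: "real \<Rightarrow> complex set \<Rightarrow> ennreal" where
  "diam_power s U = (if U = {} then 0 else if s = 0 then 1 else ennreal (diameter U powr s))"

text \<open>
  Boundedness of the covering sets is required explicitly because \<^const>\<open>diameter\<close> is
  unspecified on unbounded sets.
\<close>

definition hausdorff_premeasure :: "real \<Rightarrow> real \<Rightarrow> complex set \<Rightarrow> ennreal" where
  "hausdorff_premeasure s \<epsilon> E =
     Inf {(\<Sum>i. diam_power s (U i)) |U :: nat \<Rightarrow> complex set.
            E \<subseteq> (\<Union>i. U i) \<and> (\<forall>i. bounded (U i) \<and> diameter (U i) \<le> \<epsilon>)}"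

definition hausdorff_measure :: "real \<Rightarrow> complex set \<Rightarrow> ennreal" where
  "hausdorff_measure s E = (SUP \<epsilon>\<in>{0<..}. hausdorff_premeasure s \<epsilon> E)"

definition hausdorff_dim :: "complex set \<Rightarrow> ereal" where
  "hausdorff_dim E = (INF s\<in>{s. 0 \<le> s \<and> hausdorff_measure s E = 0}. ereal s)"

definition upper_minkowski_dim :: "complex set \<Rightarrow> ereal" where
  "upper_minkowski_dim \<Gamma> =
     (INF s\<in>{s. 0 \<le> s \<and>
        Limsup (at_right 0)
          (\<lambda>t. emeasure lborel {z. infdist z \<Gamma> < t} / ennreal (t powr (2 - s))) < \<infinity>}. ereal s)"

definition covering_number :: "real \<Rightarrow> complex set \<Rightarrow> enat" where
  "covering_number r A = Inf {enat (card F) |F. finite F \<and> A \<subseteq> (\<Union>c\<in>F. ball c r)}"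

definition assouad_dim :: "complex set \<Rightarrow> ereal" where
  "assouad_dim E =
     (INF s\<in>{s. 0 \<le> s \<and>
        (\<exists>C>0. \<forall>x\<in>E. \<forall>r R. 0 < r \<and> r < R \<longrightarrow>
           ereal_of_enat (covering_number r (E \<inter> ball x R)) \<le> ereal (C * (R / r) powr s))}. ereal s)"


section \<open>The weighted estimate\<close>

definition bdist :: "complex set \<Rightarrow> complex \<Rightarrow> real" where
  "bdist \<Omega> z = infdist z (frontier \<Omega>)"

definition weighted_estimate ::
  "real \<Rightarrow> complex set \<Rightarrow> complex \<Rightarrow> real \<Rightarrow> (complex \<Rightarrow> complex) \<Rightarrow> bool" where
  "weighted_estimate p \<Omega> z0 C g \<longleftrightarrow>
     (\<integral>\<^sup>+z\<in>\<Omega>. ennreal (cmod (g z) powr p * bdist \<Omega> z powr (p - 2)) \<partial>lborel)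
       \<le> ennreal C *
          (ennreal (cmod (g z0) powr p * bdist \<Omega> z0 powr p) +
           (\<integral>\<^sup>+z\<in>\<Omega>. ennreal (cmod (deriv g z) powr p * bdist \<Omega> z powr (2 * p - 2)) \<partial>lborel))"

end

(*
The boundary of the domain is a closed curve that passes through a Cantor set of dimension d.

Let f be the self-map of the plane that carries the four-corner Cantor set with contraction ratio
1/12 to the one with ratio nu = 4^(-1/d): inside each corner square it is conjugate to itself by the
two similarities, and off the corner squares it is a fixed bilipschitz map. By self-similarity every
estimate about f reduces to a bounded range of scales, which gives quasiconformality. The Cantor set
of ratio 1/12 is so sparse that, after rotation, it lies on a Lipschitz graph; hence a bilipschitz
map g of the plane takes a circle to a curve through it, and the domain is f(g(disk)).

The Cantor set gives the lower bound d for the Hausdorff dimension; the remaining part of the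
boundary consists of rectifiable pieces at scale nu^n, whose contribution to covering numbers is a
geometric series dominated by the Cantor set because 4 nu > 1. The domain contains about 4^n disjoint
pieces of diameter nu^n with area comparable to nu^(2n) and boundary distance at most 4 nu^n, so the
integral of the power p - 2 of the boundary distance dominates the sum of (4 nu^p)^n, whose terms
are at least 1 as p <= d.
*)
theory Submission
  imports Defs
begin

section \<open>The square norm and the corner pattern\<close>

text \<open>The ratio 1/12 comes from the graph condition: in the rotated frame the corners have
  abscissae at least 1 apart, and the tails of two expansions change the difference of abscissae by
  at most 6/12.

  The obstacle is that Lipschitz bounds for the limit map deteriorate like (\<nu>/\<mu>)^n along the
  levels. The map is therefore the identity plus a convergent series of displacements, and its
  functional equation carries scale-invariant estimates from level to level with unchanged
  constants. This needs all points concerned in one corner square. The layers after the first vanish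
  farther than \<mu> (1/2 + \<sigma>) from the corners, while the functional equation holds up to
  distance \<mu>; the width \<mu> (1/2 - \<sigma>) of this collar decides how small a cluster of
  points must be to be either rescaled as a whole or moved by the bilipschitz one-level map alone.
  The radius \<sigma>, common to both ratios, makes the construction symmetric: exchanging \<mu> and
  \<nu> inverts the map.\<close>

definition maxn :: "complex \<Rightarrow> real" where
  "maxn z = max \<bar>Re z\<bar> \<bar>Im z\<bar>"

lemma maxn_nonneg [simp]: "0 \<le> maxn z"
  by (simp add: maxn_def)

lemma maxn_0 [simp]: "maxn 0 = 0"
  by (simp add: maxn_def)

lemma maxn_eq_0_iff [simp]: "maxn z = 0 \<longleftrightarrow> z = 0"
  by (auto simp: maxn_def complex_eq_iff max_def split: if_splits)

lemma maxn_triangle: "maxn (u + v) \<le> maxn u + maxn v"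
  by (auto simp: maxn_def)

lemma maxn_minus [simp]: "maxn (- u) = maxn u"
  by (simp add: maxn_def)

lemma maxn_minus_commute: "maxn (u - v) = maxn (v - u)"
  by (metis maxn_minus minus_diff_eq)

lemma maxn_triangle_diff: "maxn (u - v) \<le> maxn u + maxn v"
  using maxn_triangle[of u "- v"] by simp

lemma maxn_diff_ge: "maxn u - maxn v \<le> maxn (u - v)"
  using maxn_triangle[of "u - v" v] by simp

lemma maxn_scaleR [simp]: "maxn (c *\<^sub>R u) = \<bar>c\<bar> * maxn u"
  by (simp add: maxn_def abs_mult max_mult_distrib_left)

lemma maxn_le_norm: "maxn z \<le> norm z"
  by (simp add: maxn_def abs_Re_le_cmod abs_Im_le_cmod)

lemma norm_le_maxn: "norm z \<le> 2 * maxn z"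
  using cmod_le[of z] by (simp add: maxn_def)

lemma maxn_sum_le: "finite S \<Longrightarrow> maxn (\<Sum>i\<in>S. f i) \<le> (\<Sum>i\<in>S. maxn (f i))"
  by (induction S rule: finite_induct) (auto intro: order_trans[OF maxn_triangle])

lemma continuous_on_maxn [continuous_intros]:
  "continuous_on S f \<Longrightarrow> continuous_on S (\<lambda>x. maxn (f x))"
  unfolding maxn_def by (intro continuous_intros)

text \<open>These are the centres of the four quadrants of the square \<open>maxn z \<le> 1\<close>,
  so copies of that square scaled about them by a ratio below 1/2 are disjoint and lie in its
  interior.\<close>

definition corners :: "complex set" where
  "corners = {Complex (-1/2) (-1/2), Complex (-1/2) (1/2), Complex (1/2) (-1/2), Complex (1/2) (1/2)}"

lemma finite_corners [simp]: "finite corners"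
  by (simp add: corners_def)

lemma card_corners: "card corners = 4"
  by (simp add: corners_def)

lemma maxn_corner: "p \<in> corners \<Longrightarrow> maxn p = 1/2"
  by (auto simp: corners_def maxn_def)

lemma maxn_corners_diff: "p \<in> corners \<Longrightarrow> q \<in> corners \<Longrightarrow> p \<noteq> q \<Longrightarrow> maxn (p - q) = 1"
  by (auto simp: corners_def maxn_def)

lemma exists_near_corner:
  assumes "maxn z \<le> 1"
  shows "\<exists>p\<in>corners. maxn (z - p) \<le> 1/2"
proof -
  define p where "p = Complex (if Re z \<le> 0 then -1/2 else 1/2) (if Im z \<le> 0 then -1/2 else 1/2)"
  have "p \<in> corners"
    by (auto simp: p_def corners_def)
  moreover have "maxn (z - p) \<le> 1/2"
    proof -
    have "\<bar>x - (if x \<le> 0 then -1/2 else 1/2)\<bar> \<le> 1/2" if "\<bar>x\<bar> \<le> 1" for x :: real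
      unfolding abs_le_iff using that by (cases "x \<le> 0") auto
    from this[of "Re z"] this[of "Im z"] show ?thesis
      using assms unfolding maxn_def max.bounded_iff p_def minus_complex.sel complex.sel by blast
  qed
  ultimately show ?thesis by blast
qed

section \<open>The self-similar homeomorphism\<close>

text \<open>A piecewise linear homeomorphism of the half-line: [0, \<mu>] onto [0, \<nu>],
  [\<mu>, \<sigma>] onto [\<nu>, \<sigma>], the identity beyond. As a sum of three clipped linear
  functions it can be estimated summand by summand, without cases.\<close>

definition profile :: "real \<Rightarrow> real \<Rightarrow> real \<Rightarrow> real \<Rightarrow> real" where
  "profile \<sigma> \<mu> \<nu> s =
     \<nu> / \<mu> * min s \<mu> + (\<sigma> - \<nu>) / (\<sigma> - \<mu>) * (min (max s \<mu>) \<sigma> - \<mu>) + (max s \<sigma> - \<sigma>)"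

definition radial :: "real \<Rightarrow> real \<Rightarrow> real \<Rightarrow> complex \<Rightarrow> complex" where
  "radial \<sigma> \<mu> \<nu> u = (profile \<sigma> \<mu> \<nu> (maxn u) / maxn u) *\<^sub>R u"

text \<open>Displacement of the one-level map. Each summand vanishes off the square of radius
  \<sigma> about its corner, so the sum replaces a definition by cases and is visibly
  Lipschitz.\<close>

definition bump :: "real \<Rightarrow> real \<Rightarrow> real \<Rightarrow> complex \<Rightarrow> complex" where
  "bump \<sigma> \<mu> \<nu> z = (\<Sum>p\<in>corners. radial \<sigma> \<mu> \<nu> (z - p) - (z - p))"

definition model :: "real \<Rightarrow> real \<Rightarrow> real \<Rightarrow> complex \<Rightarrow> complex" where
  "model \<sigma> \<mu> \<nu> z = z + bump \<sigma> \<mu> \<nu> z"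

text \<open>Unfolded, the sum of \<open>bump\<close> over all words of n corners, evaluated at z
  rescaled by the inverse of the corresponding composition of contractions of ratio \<mu>. Iterating
  the displacement equation produces these terms.\<close>

primrec layer :: "real \<Rightarrow> real \<Rightarrow> real \<Rightarrow> nat \<Rightarrow> complex \<Rightarrow> complex" where
  "layer \<sigma> \<mu> \<nu> 0 z = bump \<sigma> \<mu> \<nu> z"
| "layer \<sigma> \<mu> \<nu> (Suc n) z = (\<Sum>p\<in>corners. layer \<sigma> \<mu> \<nu> n ((1 / \<mu>) *\<^sub>R (z - p)))"

text \<open>
  Solution of the equation that makes the map conjugate to itself on the corner squares: its
  displacement e satisfies e(z) = bump(z) + \<nu> (sum over the corners p of e((z - p) / \<mu>)).
\<close>

definition cmap :: "real \<Rightarrow> real \<Rightarrow> real \<Rightarrow> complex \<Rightarrow> complex" where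
  "cmap \<sigma> \<mu> \<nu> z = z + (\<Sum>n. \<nu> ^ n *\<^sub>R layer \<sigma> \<mu> \<nu> n z)"

text \<open>The hypotheses are symmetric in \<mu> and \<nu>. The exchanged instance describes the
  inverse map, so every estimate proved here also holds for the inverse.\<close>

locale cantor_rescaling =
  fixes \<sigma> \<mu> \<nu> :: real
  assumes mu_pos: "0 < \<mu>" and mu_less: "\<mu> < \<sigma>"
    and lam_pos: "0 < \<nu>" and lam_less: "\<nu> < \<sigma>" and sigma_less: "\<sigma> < 1/2"
begin

lemma swap: "cantor_rescaling \<sigma> \<nu> \<mu>"
  using mu_pos mu_less lam_pos lam_less sigma_less by unfold_locales

lemmas params = mu_pos mu_less lam_pos lam_less sigma_less

section \<open>The radial stretch of a square\<close>

abbreviation "prof \<equiv> profile \<sigma> \<mu> \<nu>"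

lemma profile_inner: "s \<le> \<mu> \<Longrightarrow> prof s = \<nu> / \<mu> * s"
  using params by (simp add: profile_def min_def max_def)

lemma profile_middle: "\<mu> \<le> s \<Longrightarrow> s \<le> \<sigma> \<Longrightarrow> prof s = \<nu> + (\<sigma> - \<nu>) / (\<sigma> - \<mu>) * (s - \<mu>)"
  using params by (simp add: profile_def min_def max_def)

lemma profile_outer: "\<sigma> \<le> s \<Longrightarrow> prof s = s"
  using params by (auto simp: profile_def min_def max_def)

lemma profile_lipschitz:
  "\<bar>prof s - prof t\<bar> \<le> (\<nu> / \<mu> + (\<sigma> - \<nu>) / (\<sigma> - \<mu>) + 1) * \<bar>s - t\<bar>"
proof -
  have 1: "\<bar>\<nu> / \<mu> * (min s \<mu> - min t \<mu>)\<bar> \<le> \<nu> / \<mu> * \<bar>s - t\<bar>"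
    unfolding abs_mult using params by (intro mult_mono) auto
  have 2: "\<bar>(\<sigma> - \<nu>) / (\<sigma> - \<mu>) * (min (max s \<mu>) \<sigma> - min (max t \<mu>) \<sigma>)\<bar>
      \<le> (\<sigma> - \<nu>) / (\<sigma> - \<mu>) * \<bar>s - t\<bar>"
    unfolding abs_mult using params by (intro mult_mono) auto
  have "prof s - prof t = \<nu> / \<mu> * (min s \<mu> - min t \<mu>)
      + (\<sigma> - \<nu>) / (\<sigma> - \<mu>) * (min (max s \<mu>) \<sigma> - min (max t \<mu>) \<sigma>) + (max s \<sigma> - max t \<sigma>)"
    unfolding profile_def right_diff_distrib by linarith
  moreover have "\<bar>max s \<sigma> - max t \<sigma>\<bar> \<le> \<bar>s - t\<bar>"
    by auto
  ultimately show ?thesis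
    using 1 2 unfolding distrib_right abs_le_iff right_diff_distrib mult_1 by linarith
qed

lemma profile_swap:
  assumes "0 \<le> s"
  shows "profile \<sigma> \<nu> \<mu> (prof s) = s"
proof -
  interpret s: cantor_rescaling \<sigma> \<nu> \<mu> by (rule swap)
  consider "s \<le> \<mu>" | "\<mu> \<le> s" "s \<le> \<sigma>" | "\<sigma> \<le> s" by linarith
  then show ?thesis
  proof cases
    case 1
    then have "prof s \<le> \<nu>"
      using params assms by (simp add: profile_inner field_simps)
    then show ?thesis
      using 1 params by (simp add: profile_inner s.profile_inner)
  next
    case 2
    have "0 \<le> (\<sigma> - \<nu>) / (\<sigma> - \<mu>) * (s - \<mu>)"
      using 2 params by simp
    then have a: "\<nu> \<le> prof s"
      using 2 by (simp add: profile_middle)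
    have "(\<sigma> - \<nu>) / (\<sigma> - \<mu>) * (s - \<mu>) \<le> (\<sigma> - \<nu>) / (\<sigma> - \<mu>) * (\<sigma> - \<mu>)"
      using 2 params by (intro mult_left_mono) auto
    then have b: "prof s \<le> \<sigma>"
      using 2 params by (simp add: profile_middle)
    show ?thesis
      unfolding s.profile_middle[OF a b] using 2 params by (simp add: profile_middle)
  next
    case 3
    then show ?thesis
      by (simp add: profile_outer s.profile_outer)
  qed
qed

lemma profile_0 [simp]: "prof 0 = 0"
  using profile_inner[of 0] mu_pos by simp

lemma profile_mono:
  assumes "s \<le> t"
  shows "prof s \<le> prof t"
proof -
  have "\<nu> / \<mu> * min s \<mu> \<le> \<nu> / \<mu> * min t \<mu>"
    using assms params by (intro mult_left_mono) auto
  moreover have "(\<sigma> - \<nu>) / (\<sigma> - \<mu>) * (min (max s \<mu>) \<sigma> - \<mu>) \<le> (\<sigma> - \<nu>) / (\<sigma> - \<mu>) * (min (max t \<mu>) \<sigma> - \<mu>)"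
    using assms params by (intro mult_left_mono) auto
  ultimately show ?thesis
    using assms unfolding profile_def by linarith
qed

lemma profile_nonneg: "0 \<le> s \<Longrightarrow> 0 \<le> prof s"
  using profile_mono[of 0 s] by simp

lemma maxn_radial: "maxn (radial \<sigma> \<mu> \<nu> u) = prof (maxn u)"
  by (cases "u = 0") (simp_all add: radial_def profile_nonneg)

lemma radial_swap: "radial \<sigma> \<nu> \<mu> (radial \<sigma> \<mu> \<nu> u) = u"
proof (cases "u = 0")
  case False
  then have "prof (maxn u) \<noteq> 0"
    using profile_swap[of "maxn u"] cantor_rescaling.profile_0[OF swap] by auto
  then show ?thesis
    using False unfolding radial_def[of \<sigma> \<nu> \<mu>] maxn_radial profile_swap[OF maxn_nonneg]
    by (simp add: radial_def)
qed (simp add: radial_def)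

lemma radial_outer: "\<sigma> \<le> maxn u \<Longrightarrow> radial \<sigma> \<mu> \<nu> u = u"
  using params by (cases "u = 0") (simp_all add: radial_def profile_outer)

lemma radial_inner: "maxn u \<le> \<mu> \<Longrightarrow> radial \<sigma> \<mu> \<nu> u = (\<nu> / \<mu>) *\<^sub>R u"
  by (cases "u = 0") (simp_all add: radial_def profile_inner)

definition K0 :: real where "K0 = \<nu> / \<mu> + (\<sigma> - \<nu>) / (\<sigma> - \<mu>) + 1"

lemma K0_pos: "K0 > 0"
proof -
  have "\<nu> / \<mu> > 0" "(\<sigma> - \<nu>) / (\<sigma> - \<mu>) > 0" using params by auto
  then show ?thesis by (simp add: K0_def)
qed

lemma profile_le: "0 \<le> s \<Longrightarrow> prof s \<le> K0 * s"
  using profile_lipschitz[of s 0] profile_nonneg[of s] by (simp add: K0_def)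

text \<open>The stretch factor \<open>prof s / s\<close> is bounded, but its variation must be
  controlled near 0. With \<open>maxn u \<le> maxn v\<close> that variation is multiplied by the
  larger norm t, and the product is a combination of increments of the norm and of the profile with
  bounded coefficients.\<close>

lemma radial_lipschitz: "maxn (radial \<sigma> \<mu> \<nu> u - radial \<sigma> \<mu> \<nu> v) \<le> 3 * K0 * maxn (u - v)"
proof -
  have main: "maxn (radial \<sigma> \<mu> \<nu> u - radial \<sigma> \<mu> \<nu> v) \<le> 3 * K0 * maxn (u - v)"
    if le: "maxn u \<le> maxn v" for u v
  proof (cases "u = 0")
    case True
    have "prof (maxn v) \<le> K0 * maxn v" by (rule profile_le) simp
    moreover have "0 \<le> K0 * maxn v" using K0_pos by simp
    moreover have "radial \<sigma> \<mu> \<nu> u = 0" using True by (simp add: radial_def)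
    ultimately show ?thesis using True by (simp add: maxn_radial)
  next
    case False
    define s t where "s = maxn u" and "t = maxn v"
    have pos: "0 < s" "0 < t" and st: "s \<le> t"
      using False le maxn_nonneg[of u] maxn_eq_0_iff[of u] by (auto simp: s_def t_def less_le simp del: maxn_nonneg maxn_eq_0_iff)
    have ts: "t - s \<le> maxn (u - v)"
      using maxn_diff_ge[of v u] by (simp add: s_def t_def maxn_minus_commute)
    have rs: "0 \<le> prof s / s" "prof s / s \<le> K0"
      using pos profile_le[of s] profile_nonneg[of s] by (auto simp: field_simps)
    have eq: "radial \<sigma> \<mu> \<nu> u - radial \<sigma> \<mu> \<nu> v
        = (prof s / s) *\<^sub>R (u - v) + (prof s / s - prof t / t) *\<^sub>R v"
      by (simp add: radial_def s_def t_def algebra_simps)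
    have "\<bar>prof s / s - prof t / t\<bar> * t = \<bar>(prof s / s - prof t / t) * t\<bar>"
      using pos by (simp add: abs_mult)
    also have "(prof s / s - prof t / t) * t = (prof s / s) * (t - s) + (prof s - prof t)"
      using pos by (simp add: field_simps)
    also have "\<bar>(prof s / s) * (t - s) + (prof s - prof t)\<bar> \<le> (prof s / s) * (t - s) + \<bar>prof s - prof t\<bar>"
      using rs st by (smt (verit) mult_nonneg_nonneg)
    also have "\<dots> \<le> K0 * (t - s) + K0 * (t - s)"
      using profile_lipschitz[of s t] rs st
      by (intro add_mono mult_right_mono) (simp_all add: K0_def)
    finally have b: "\<bar>prof s / s - prof t / t\<bar> * t \<le> 2 * K0 * (t - s)"
      by (simp add: mult.assoc mult.commute)
    have "maxn (radial \<sigma> \<mu> \<nu> u - radial \<sigma> \<mu> \<nu> v)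
        \<le> (prof s / s) * maxn (u - v) + \<bar>prof s / s - prof t / t\<bar> * t"
      unfolding eq using maxn_triangle[of "(prof s / s) *\<^sub>R (u - v)" "(prof s / s - prof t / t) *\<^sub>R v"] rs(1)
      unfolding maxn_scaleR t_def by (simp only: abs_of_nonneg)
    also have "\<dots> \<le> K0 * maxn (u - v) + 2 * K0 * maxn (u - v)"
    proof (intro add_mono)
      show "(prof s / s) * maxn (u - v) \<le> K0 * maxn (u - v)"
        using rs by (intro mult_right_mono) auto
      have "2 * K0 * (t - s) \<le> 2 * K0 * maxn (u - v)"
        using ts K0_pos by (intro mult_left_mono) auto
      then show "\<bar>prof s / s - prof t / t\<bar> * t \<le> 2 * K0 * maxn (u - v)"
        using b by linarith
    qed
    finally show ?thesis by simp
  qed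
  show ?thesis
  proof (cases "maxn u \<le> maxn v")
    case False
    then have "maxn (radial \<sigma> \<mu> \<nu> v - radial \<sigma> \<mu> \<nu> u) \<le> 3 * K0 * maxn (v - u)"
      by (intro main) auto
    then show ?thesis by (simp add: maxn_minus_commute)
  qed (rule main)
qed

section \<open>The one-level model map\<close>

lemma near_unique:
  assumes "p \<in> corners" "q \<in> corners" "maxn (z - p) + s \<le> 1" "p \<noteq> q"
  shows "s \<le> maxn (z - q)"
  using maxn_corners_diff[OF assms(1,2,4)] maxn_triangle_diff[of "z - q" "z - p"] assms(3)
  by (simp add: algebra_simps)

lemma model_near:
  assumes "p \<in> corners" "maxn (z - p) \<le> 1/2"
  shows "model \<sigma> \<mu> \<nu> z = p + radial \<sigma> \<mu> \<nu> (z - p)"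
proof -
  have "radial \<sigma> \<mu> \<nu> (z - q) - (z - q) = 0" if "q \<in> corners - {p}" for q
  proof -
    have "1/2 \<le> maxn (z - q)"
      using assms that by (intro near_unique[of p q]) auto
    then show ?thesis using sigma_less by (simp add: radial_outer)
  qed
  then have "bump \<sigma> \<mu> \<nu> z = radial \<sigma> \<mu> \<nu> (z - p) - (z - p)"
    unfolding bump_def using assms(1) by (subst sum.remove[of _ p]) (auto simp: sum.neutral)
  then show ?thesis by (simp add: model_def)
qed

lemma model_far:
  assumes "\<And>p. p \<in> corners \<Longrightarrow> \<sigma> \<le> maxn (z - p)"
  shows "model \<sigma> \<mu> \<nu> z = z"
  using assms by (simp add: model_def bump_def radial_outer)

lemma model_outside:
  assumes "1/2 + \<sigma> \<le> maxn z"
  shows "model \<sigma> \<mu> \<nu> z = z"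
proof (rule model_far)
  fix p assume "p \<in> corners"
  then show "\<sigma> \<le> maxn (z - p)"
    using maxn_diff_ge[of z p] assms by (simp add: maxn_corner)
qed

text \<open>The radial maps preserve each quadrant square \<open>maxn (z - p) \<le> 1/2\<close>, so
  both models are computed about the same corner.\<close>

lemma model_swap: "model \<sigma> \<nu> \<mu> (model \<sigma> \<mu> \<nu> z) = z"
proof -
  interpret s: cantor_rescaling \<sigma> \<nu> \<mu> by (rule swap)
  show ?thesis
  proof (cases "\<exists>p\<in>corners. maxn (z - p) \<le> 1/2")
    case True
    then obtain p where p: "p \<in> corners" "maxn (z - p) \<le> 1/2" by blast
    have "maxn (radial \<sigma> \<mu> \<nu> (z - p)) \<le> 1/2"
      unfolding maxn_radial using profile_mono[OF p(2)] profile_outer[of "1/2"] sigma_less by simp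
    then show ?thesis
      using p by (simp add: model_near s.model_near radial_swap)
  next
    case False
    then have "\<And>p. p \<in> corners \<Longrightarrow> \<sigma> \<le> maxn (z - p)"
      using sigma_less by force
    then show ?thesis by (simp add: model_far s.model_far)
  qed
qed

lemma model_corner_dist:
  assumes "p \<in> corners" "maxn (z - p) \<le> 1/2"
  shows "maxn (model \<sigma> \<mu> \<nu> z - p) = prof (maxn (z - p))"
  using assms by (simp add: model_near maxn_radial)

lemma model_bounded:
  assumes "maxn z \<le> 1"
  shows "maxn (model \<sigma> \<mu> \<nu> z) \<le> 1"
proof -
  obtain p where p: "p \<in> corners" "maxn (z - p) \<le> 1/2"
    using exists_near_corner[OF assms] by blast
  have "maxn (model \<sigma> \<mu> \<nu> z - p) \<le> 1/2"
    unfolding model_corner_dist[OF p] using profile_mono[OF p(2)] profile_outer[of "1/2"] sigma_less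
    by simp
  then show ?thesis
    using maxn_triangle[of "model \<sigma> \<mu> \<nu> z - p" p] maxn_corner[OF p(1)] by simp
qed

text \<open>Apply the inverse model: an image within \<nu> of q comes from a point within \<mu> of
  q, because the exchanged profile sends [0, \<nu>] to [0, \<mu>].\<close>

lemma model_avoids_corner:
  assumes "\<And>p. p \<in> corners \<Longrightarrow> \<mu> < maxn (z - p)" and q: "q \<in> corners"
  shows "\<nu> < maxn (model \<sigma> \<mu> \<nu> z - q)"
proof -
  interpret s: cantor_rescaling \<sigma> \<nu> \<mu> by (rule swap)
  show ?thesis
  proof (rule ccontr)
    assume "\<not> ?thesis"
    then have le: "maxn (model \<sigma> \<mu> \<nu> z - q) \<le> \<nu>" by simp
    then have "maxn (z - q) = profile \<sigma> \<nu> \<mu> (maxn (model \<sigma> \<mu> \<nu> z - q))"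
      using s.model_corner_dist[OF q, of "model \<sigma> \<mu> \<nu> z"] params by (simp add: model_swap)
    also have "\<dots> \<le> \<mu>"
      using s.profile_mono[OF le] s.profile_inner[of \<nu>] params by simp
    finally show False using assms(1)[OF q] by simp
  qed
qed

definition K1 :: real where "K1 = 12 * K0 + 5"

lemma K1_pos: "K1 > 0"
  using K0_pos by (simp add: K1_def)

lemma bump_lipschitz: "maxn (bump \<sigma> \<mu> \<nu> z - bump \<sigma> \<mu> \<nu> w) \<le> (12 * K0 + 4) * maxn (z - w)"
proof -
  have "maxn (bump \<sigma> \<mu> \<nu> z - bump \<sigma> \<mu> \<nu> w)
      = maxn (\<Sum>p\<in>corners. (radial \<sigma> \<mu> \<nu> (z - p) - radial \<sigma> \<mu> \<nu> (w - p)) - (z - w))"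
    unfolding bump_def sum_subtractf[symmetric] by (simp add: algebra_simps)
  also have "\<dots> \<le> (\<Sum>p\<in>corners. maxn ((radial \<sigma> \<mu> \<nu> (z - p) - radial \<sigma> \<mu> \<nu> (w - p)) - (z - w)))"
    by (rule maxn_sum_le) simp
  also have "\<dots> \<le> (\<Sum>p\<in>corners. 3 * K0 * maxn (z - w) + maxn (z - w))"
  proof (rule sum_mono)
    fix p assume "p \<in> corners"
    show "maxn ((radial \<sigma> \<mu> \<nu> (z - p) - radial \<sigma> \<mu> \<nu> (w - p)) - (z - w))
        \<le> 3 * K0 * maxn (z - w) + maxn (z - w)"
      using radial_lipschitz[of "z - p" "w - p"]
      by (intro order_trans[OF maxn_triangle_diff]) simp
  qed
  also have "\<dots> = (12 * K0 + 4) * maxn (z - w)"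
    by (simp add: card_corners algebra_simps)
  finally show ?thesis .
qed

lemma model_lipschitz: "maxn (model \<sigma> \<mu> \<nu> z - model \<sigma> \<mu> \<nu> w) \<le> K1 * maxn (z - w)"
proof -
  have "model \<sigma> \<mu> \<nu> z - model \<sigma> \<mu> \<nu> w = (bump \<sigma> \<mu> \<nu> z - bump \<sigma> \<mu> \<nu> w) + (z - w)"
    by (simp add: model_def)
  then have "maxn (model \<sigma> \<mu> \<nu> z - model \<sigma> \<mu> \<nu> w)
      \<le> maxn (bump \<sigma> \<mu> \<nu> z - bump \<sigma> \<mu> \<nu> w) + maxn (z - w)"
    using maxn_triangle by metis
  then show ?thesis
    using bump_lipschitz[of z w] by (simp add: K1_def algebra_simps)
qed

section \<open>Supports and bounds of the layers\<close>

lemma layer_outside: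
  assumes "1/2 + \<sigma> \<le> maxn z"
  shows "layer \<sigma> \<mu> \<nu> n z = 0"
  using assms
proof (induction n arbitrary: z)
  case 0
  then show ?case using model_outside by (simp add: model_def)
next
  case (Suc n)
  \<comment> \<open>The support radius is the norm 1/2 of a corner plus \<sigma>. A point outside it
    is at distance at least \<sigma> > \<mu> from every corner, so all rescaled points have norm at
    least 1 > 1/2 + \<sigma> and are outside it again.\<close>
  have "1/2 + \<sigma> \<le> maxn ((1 / \<mu>) *\<^sub>R (z - p))" if p: "p \<in> corners" for p
  proof -
    have "\<mu> \<le> maxn (z - p)"
      using maxn_diff_ge[of z p] Suc.prems p params by (simp add: maxn_corner)
    then have "1 \<le> maxn (z - p) / \<mu>"
      using mu_pos by simp
    then have "1/2 + \<sigma> \<le> maxn (z - p) / \<mu>"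
      using sigma_less by linarith
    then show ?thesis
      using mu_pos by simp
  qed
  then show ?case
    using Suc.IH by simp
qed

lemma layer_Suc_far:
  assumes "\<And>p. p \<in> corners \<Longrightarrow> \<mu> * (1/2 + \<sigma>) \<le> maxn (z - p)"
  shows "layer \<sigma> \<mu> \<nu> (Suc n) z = 0"
proof -
  have "layer \<sigma> \<mu> \<nu> n ((1 / \<mu>) *\<^sub>R (z - p)) = 0" if "p \<in> corners" for p
    using assms[OF that] mu_pos by (intro layer_outside) (simp only: maxn_scaleR, simp add: field_simps)
  then show ?thesis by simp
qed

lemma maxn_mu_scaleR: "maxn w \<le> 1 \<Longrightarrow> maxn (\<mu> *\<^sub>R w) \<le> \<mu>"
  using mu_pos mult_left_mono[of "maxn w" 1 \<mu>] by (simp del: mult_le_cancel_left2)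

text \<open>Within the square of radius \<mu> about p every other corner is at distance at least
  \<mu>, so its rescaled argument has norm at least 1, off the support. Only the summand of p
  survives.\<close>

lemma layer_Suc_near:
  assumes p: "p \<in> corners" and w: "maxn w \<le> 1"
  shows "layer \<sigma> \<mu> \<nu> (Suc n) (p + \<mu> *\<^sub>R w) = layer \<sigma> \<mu> \<nu> n w"
proof -
  let ?z = "p + \<mu> *\<^sub>R w"
  have "layer \<sigma> \<mu> \<nu> n ((1 / \<mu>) *\<^sub>R (?z - q)) = 0" if q: "q \<in> corners - {p}" for q
  proof (rule layer_outside)
    have "maxn (?z - p) + \<mu> \<le> 1"
      unfolding add_diff_cancel_left' using maxn_mu_scaleR[OF w] params by linarith
    then have "\<mu> * 1 \<le> maxn (?z - q)"
      using q p by (intro near_unique[of p q]) auto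
    then have "1 \<le> maxn (?z - q) / \<mu>"
      using mu_pos by simp
    then have "1/2 + \<sigma> \<le> maxn (?z - q) / \<mu>"
      using sigma_less by linarith
    then show "1/2 + \<sigma> \<le> maxn ((1 / \<mu>) *\<^sub>R (?z - q))"
      unfolding maxn_scaleR using mu_pos by simp
  qed
  then show ?thesis
    using p mu_pos by (simp add: sum.remove[of _ p])
qed

text \<open>The dichotomy behind the inductions along the levels. It is used with s = 1, the range
  of the functional equation, and with s = 1/2 + \<sigma>, the support of the layers.\<close>

lemma rescaled_or_far:
  assumes "0 < s"
  obtains p w where "p \<in> corners" "maxn w \<le> s" "z = p + \<mu> *\<^sub>R w"
    | "\<And>p. p \<in> corners \<Longrightarrow> \<mu> * s < maxn (z - p)"
proof (cases "\<exists>p\<in>corners. maxn (z - p) \<le> \<mu> * s")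
  case True
  then obtain p where p: "p \<in> corners" "maxn (z - p) \<le> \<mu> * s" by blast
  have "maxn ((1 / \<mu>) *\<^sub>R (z - p)) \<le> s"
    using p mu_pos unfolding maxn_scaleR by (simp add: field_simps)
  moreover have "z = p + \<mu> *\<^sub>R ((1 / \<mu>) *\<^sub>R (z - p))"
    using mu_pos by simp
  ultimately show ?thesis using p(1) that(1) by blast
next
  case False
  then show ?thesis using that(2) by force
qed

text \<open>The bound does not grow with n because at most one corner contributes at each level. The
  value 2 comes from level 0: the model preserves the square \<open>maxn z \<le> 1\<close>.\<close>

lemma layer_bound: "maxn (layer \<sigma> \<mu> \<nu> n z) \<le> 2"
proof (induction n arbitrary: z)
  case 0
  show ?case
  proof (cases "maxn z \<le> 1")
    case True
    then show ?thesis
      using model_bounded[OF True] maxn_triangle_diff[of "model \<sigma> \<mu> \<nu> z" z] by (simp add: model_def)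
  next
    case False
    then show ?thesis
      using layer_outside[of z 0] sigma_less by simp
  qed
next
  case (Suc n)
  have s: "0 < 1/2 + \<sigma>" using params by simp
  show ?case
  proof (rule rescaled_or_far[OF s, of z])
    fix p w assume "p \<in> corners" "maxn w \<le> 1/2 + \<sigma>" "z = p + \<mu> *\<^sub>R w"
    then show ?thesis
      using Suc layer_Suc_near[of p w n] sigma_less by simp
  next
    assume "\<And>p. p \<in> corners \<Longrightarrow> \<mu> * (1/2 + \<sigma>) < maxn (z - p)"
    then show ?thesis
      using layer_Suc_far[of z n] by (simp add: less_imp_le del: layer.simps)
  qed
qed

lemma continuous_bump: "continuous_on S (bump \<sigma> \<mu> \<nu>)"
proof -
  have "(2 * (12 * K0 + 4))-lipschitz_on S (bump \<sigma> \<mu> \<nu>)"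
  proof (rule lipschitz_onI)
    fix x y
    have "maxn (bump \<sigma> \<mu> \<nu> x - bump \<sigma> \<mu> \<nu> y) \<le> (12 * K0 + 4) * norm (x - y)"
      using bump_lipschitz[of x y] K0_pos maxn_le_norm[of "x - y"]
      by (meson add_nonneg_nonneg dual_order.trans less_imp_le mult_left_mono mult_nonneg_nonneg zero_le_numeral)
    then show "dist (bump \<sigma> \<mu> \<nu> x) (bump \<sigma> \<mu> \<nu> y) \<le> 2 * (12 * K0 + 4) * dist x y"
      using norm_le_maxn[of "bump \<sigma> \<mu> \<nu> x - bump \<sigma> \<mu> \<nu> y"] unfolding dist_norm mult.assoc
      by linarith
  qed (use K0_pos in simp)
  then show ?thesis by (rule lipschitz_on_continuous_on)
qed

lemma continuous_layer: "continuous_on S (layer \<sigma> \<mu> \<nu> n)"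
proof (induction n arbitrary: S)
  case 0
  then show ?case using continuous_bump by simp
next
  case (Suc n)
  show ?case
    unfolding layer.simps
    by (intro continuous_on_sum continuous_on_compose2[OF Suc.IH[of UNIV]] continuous_intros) auto
qed

lemma norm_layer_term: "norm (\<nu> ^ n *\<^sub>R layer \<sigma> \<mu> \<nu> n z) \<le> 4 * \<nu> ^ n"
  using norm_le_maxn[of "layer \<sigma> \<mu> \<nu> n z"] layer_bound[of n z] lam_pos by (simp add: mult.commute)

lemma summable_bound: "summable (\<lambda>n. 4 * \<nu> ^ n)"
  using params by (intro summable_mult summable_geometric) auto

lemma summable_layers: "summable (\<lambda>n. \<nu> ^ n *\<^sub>R layer \<sigma> \<mu> \<nu> n z)"
  using norm_layer_term by (intro summable_comparison_test'[OF summable_bound]) auto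

section \<open>The limit map and its functional equation\<close>

abbreviation "F \<equiv> cmap \<sigma> \<mu> \<nu>"

lemma continuous_cmap: "continuous_on S F"
proof -
  have "uniform_limit S (\<lambda>n z. \<Sum>i<n. \<nu> ^ i *\<^sub>R layer \<sigma> \<mu> \<nu> i z)
      (\<lambda>z. \<Sum>n. \<nu> ^ n *\<^sub>R layer \<sigma> \<mu> \<nu> n z) sequentially"
    by (rule Weierstrass_m_test[OF norm_layer_term summable_bound])
  moreover have "\<forall>\<^sub>F n in sequentially. continuous_on S (\<lambda>z. \<Sum>i<n. \<nu> ^ i *\<^sub>R layer \<sigma> \<mu> \<nu> i z)"
    by (intro always_eventually allI continuous_intros continuous_layer)
  ultimately have "continuous_on S (\<lambda>z. \<Sum>n. \<nu> ^ n *\<^sub>R layer \<sigma> \<mu> \<nu> n z)"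
    by (intro uniform_limit_theorem[where F = sequentially]) auto
  then show ?thesis
    unfolding cmap_def by (intro continuous_intros)
qed

lemma cmap_outside: "1/2 + \<sigma> \<le> maxn z \<Longrightarrow> F z = z"
  by (simp add: cmap_def layer_outside)

lemma cmap_unfold:
  "F z = model \<sigma> \<mu> \<nu> z + \<nu> *\<^sub>R (\<Sum>n. \<nu> ^ n *\<^sub>R layer \<sigma> \<mu> \<nu> (Suc n) z)"
proof -
  have s: "summable (\<lambda>n. \<nu> ^ n *\<^sub>R layer \<sigma> \<mu> \<nu> (Suc n) z)"
  proof (rule summable_comparison_test'[OF summable_bound, of 0])
    fix n
    have "norm (layer \<sigma> \<mu> \<nu> (Suc n) z) \<le> 4"
      using norm_le_maxn[of "layer \<sigma> \<mu> \<nu> (Suc n) z"] layer_bound[of "Suc n" z] by linarith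
    then show "norm (\<nu> ^ n *\<^sub>R layer \<sigma> \<mu> \<nu> (Suc n) z) \<le> 4 * \<nu> ^ n"
      using lam_pos unfolding norm_scaleR by (simp add: mult.commute del: layer.simps)
  qed
  have "(\<Sum>n. \<nu> ^ n *\<^sub>R layer \<sigma> \<mu> \<nu> n z)
      = bump \<sigma> \<mu> \<nu> z + (\<Sum>n. \<nu> ^ Suc n *\<^sub>R layer \<sigma> \<mu> \<nu> (Suc n) z)"
    using suminf_split_head[OF summable_layers, of z] by simp
  also have "(\<Sum>n. \<nu> ^ Suc n *\<^sub>R layer \<sigma> \<mu> \<nu> (Suc n) z)
      = \<nu> *\<^sub>R (\<Sum>n. \<nu> ^ n *\<^sub>R layer \<sigma> \<mu> \<nu> (Suc n) z)"
    using suminf_scaleR_right[OF s, of \<nu>] by (simp del: layer.simps)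
  finally show ?thesis by (simp add: cmap_def model_def del: layer.simps)
qed

lemma cmap_far:
  assumes "\<And>p. p \<in> corners \<Longrightarrow> \<mu> * (1/2 + \<sigma>) \<le> maxn (z - p)"
  shows "F z = model \<sigma> \<mu> \<nu> z"
  using layer_Suc_far[OF assms] by (simp add: cmap_unfold del: layer.simps)

text \<open>The self-similarity. On the square of radius \<mu> about p the model is the linear map
  with factor \<nu> / \<mu>, and the layers of the point from the second on are the layers of w,
  shifted by one and hence weighted by an extra factor \<nu>.\<close>

lemma cmap_near:
  assumes "p \<in> corners" "maxn w \<le> 1"
  shows "F (p + \<mu> *\<^sub>R w) = p + \<nu> *\<^sub>R F w"
proof -
  have le: "maxn (p + \<mu> *\<^sub>R w - p) \<le> \<mu>"
    unfolding add_diff_cancel_left' by (rule maxn_mu_scaleR[OF assms(2)])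
  then have "maxn (p + \<mu> *\<^sub>R w - p) \<le> 1/2"
    using params by linarith
  then have "model \<sigma> \<mu> \<nu> (p + \<mu> *\<^sub>R w) = p + \<nu> *\<^sub>R w"
    using radial_inner[OF le] mu_pos by (simp add: model_near[OF assms(1)])
  then show ?thesis
    unfolding cmap_unfold[of "p + \<mu> *\<^sub>R w"] layer_Suc_near[OF assms]
    by (simp add: cmap_def scaleR_add_right)
qed

lemma cmap_displacement: "maxn (F z - z) \<le> 8"
proof -
  have "norm (F z - z) \<le> (\<Sum>n. 4 * \<nu> ^ n)"
    unfolding cmap_def using norm_suminf_le[OF norm_layer_term[where z = z] summable_bound] by simp
  also have "\<dots> = 4 / (1 - \<nu>)"
    using params by (subst suminf_mult) (auto simp: suminf_geometric summable_geometric)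
  also have "\<dots> \<le> 8"
    using params by (simp add: field_simps)
  finally show ?thesis using maxn_le_norm order_trans by blast
qed

text \<open>The displacement bound alone gives 9 instead of 1. Each use of the functional equation
  shrinks the excess by the factor \<nu>, so it vanishes in the limit. The same device proves the
  inversion formula and the formula on the Cantor set.\<close>

lemma cmap_bounded:
  assumes "maxn z \<le> 1"
  shows "maxn (F z) \<le> 1"
proof -
  have approx: "maxn (F z) \<le> 1 + 8 * \<nu> ^ n" if "maxn z \<le> 1" for n z
    using that
  proof (induction n arbitrary: z)
    case 0
    then show ?case
      using cmap_displacement[of z] maxn_triangle[of "F z - z" z] by simp
  next
    case (Suc n)
    show ?case
    proof (rule rescaled_or_far[of 1 z])
      fix p w assume h: "p \<in> corners" "maxn w \<le> 1" "z = p + \<mu> *\<^sub>R w"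
      have "maxn (F z) \<le> 1/2 + \<nu> * maxn (F w)"
        using maxn_triangle[of p "\<nu> *\<^sub>R F w"] h lam_pos by (simp add: cmap_near maxn_corner)
      also have "\<dots> \<le> 1/2 + \<nu> * (1 + 8 * \<nu> ^ n)"
        using Suc.IH[OF h(2)] lam_pos by simp
      also have "\<dots> \<le> 1 + 8 * \<nu> ^ Suc n"
        using params by (simp add: algebra_simps)
      finally show ?thesis .
    next
      assume far: "\<And>p. p \<in> corners \<Longrightarrow> \<mu> * 1 < maxn (z - p)"
      have "\<mu> * (1/2 + \<sigma>) \<le> \<mu> * 1"
        using params by (intro mult_left_mono) auto
      then have "F z = model \<sigma> \<mu> \<nu> z"
        using far by (intro cmap_far) force
      moreover have "0 \<le> \<nu> ^ Suc n" using lam_pos by (simp del: power_Suc)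
      ultimately show ?thesis
        using model_bounded[OF Suc.prems] by simp
    qed simp
  qed
  have "(\<lambda>n. 1 + 8 * \<nu> ^ n) \<longlonglongrightarrow> 1 + 8 * 0"
    using params by (intro tendsto_intros LIMSEQ_realpow_zero) auto
  then show ?thesis
    using LIMSEQ_le_const[of "\<lambda>n. 1 + 8 * \<nu> ^ n" 1 "maxn (F z)"] approx[OF assms] by auto
qed

lemma cmap_avoids_corner:
  assumes "\<And>p. p \<in> corners \<Longrightarrow> \<mu> < maxn (z - p)"
  shows "F z = model \<sigma> \<mu> \<nu> z" and "q \<in> corners \<Longrightarrow> \<nu> < maxn (F z - q)"
proof -
  have "\<mu> * (1/2 + \<sigma>) \<le> \<mu> * 1"
    using params by (intro mult_left_mono) auto
  then show "F z = model \<sigma> \<mu> \<nu> z"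
    using assms by (intro cmap_far) force
  then show "q \<in> corners \<Longrightarrow> \<nu> < maxn (F z - q)"
    using model_avoids_corner[OF assms] by simp
qed

text \<open>Away from the corner squares both maps are models, which are inverse to each other;
  inside them the functional equations shrink the discrepancy by \<mu>. It starts at 16, two
  displacements of at most 8, and tends to 0.\<close>

lemma cmap_swap: "cmap \<sigma> \<nu> \<mu> (F z) = z"
proof -
  interpret s: cantor_rescaling \<sigma> \<nu> \<mu> by (rule swap)
  have approx: "maxn (cmap \<sigma> \<nu> \<mu> (F z) - z) \<le> 16 * \<mu> ^ n" for n z
  proof (induction n arbitrary: z)
    case 0
    show ?case
      using cmap_displacement[of z] s.cmap_displacement[of "F z"]
        maxn_triangle[of "cmap \<sigma> \<nu> \<mu> (F z) - F z" "F z - z"] by simp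
  next
    case (Suc n)
    show ?case
    proof (rule rescaled_or_far[of 1 z])
      fix p w assume h: "p \<in> corners" "maxn w \<le> 1" "z = p + \<mu> *\<^sub>R w"
      then have "cmap \<sigma> \<nu> \<mu> (F z) - z = \<mu> *\<^sub>R (cmap \<sigma> \<nu> \<mu> (F w) - w)"
        by (simp add: cmap_near s.cmap_near cmap_bounded scaleR_diff_right)
      then show ?thesis
        using Suc.IH[of w] mu_pos by simp
    next
      assume "\<And>p. p \<in> corners \<Longrightarrow> \<mu> * 1 < maxn (z - p)"
      then have "cmap \<sigma> \<nu> \<mu> (F z) = z"
        using cmap_avoids_corner[of z] s.cmap_avoids_corner(1)[of "F z"] by (simp add: model_swap)
      then show ?thesis using mu_pos by simp
    qed simp
  qed
  have "(\<lambda>n. 16 * \<mu> ^ n) \<longlonglongrightarrow> 16 * 0"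
    using params by (intro tendsto_intros LIMSEQ_realpow_zero) auto
  then have "maxn (cmap \<sigma> \<nu> \<mu> (F z) - z) \<le> 0"
    using LIMSEQ_le_const[of "\<lambda>n. 16 * \<mu> ^ n" 0] approx[of z] by auto
  then show ?thesis
    using maxn_nonneg[of "cmap \<sigma> \<nu> \<mu> (F z) - z"] maxn_eq_0_iff by (metis antisym eq_iff_diff_eq_0)
qed

lemma cmap_swap': "F (cmap \<sigma> \<nu> \<mu> z) = z"
  by (rule cantor_rescaling.cmap_swap[OF swap])

lemma homeomorphism_cmap: "homeomorphism UNIV UNIV F (cmap \<sigma> \<nu> \<mu>)"
  by (intro homeomorphismI continuous_cmap cantor_rescaling.continuous_cmap[OF swap])
     (auto simp: cmap_swap cmap_swap')

text \<open>Points closer than 1 lie either both in the ball of radius 4, which is compact, or both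
  outside that of radius 2, where F is the identity.\<close>

lemma cmap_uniformly_continuous: "uniformly_continuous_on UNIV F"
  unfolding uniformly_continuous_on_def
proof (intro allI impI)
  fix e :: real assume e: "0 < e"
  have "uniformly_continuous_on (cball 0 4) F"
    by (intro compact_uniformly_continuous continuous_cmap compact_cball)
  then obtain d where d: "d > 0" "\<And>x y. x \<in> cball 0 4 \<Longrightarrow> y \<in> cball 0 4 \<Longrightarrow> dist y x < d \<Longrightarrow> dist (F y) (F x) < e"
    unfolding uniformly_continuous_on_def using e by meson
  have out: "F z = z" if "norm z \<ge> 2" for z
    using that norm_le_maxn[of z] sigma_less by (intro cmap_outside) simp
  have "dist (F y) (F x) < e" if "dist y x < Min {d, e, 1}" for x y
  proof (cases "norm x \<le> 3")
    case True
    then have "norm y \<le> 4"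
      using that norm_triangle_ineq2[of y x] by (simp add: dist_norm)
    then show ?thesis using d(2)[of x y] True that by (simp add: dist_norm)
  next
    case False
    then have "norm y \<ge> 2"
      using that norm_triangle_ineq2[of x y] by (simp add: dist_norm norm_minus_commute)
    then show ?thesis using out False that by simp
  qed
  moreover have "Min {d, e, 1} > 0" using d e by simp
  ultimately show "\<exists>d>0. \<forall>x\<in>UNIV. \<forall>x'\<in>UNIV. dist x' x < d \<longrightarrow> dist (F x') (F x) < e"
    by blast
qed

end

section \<open>Quasiconformality\<close>

text \<open>Dividing by c finitely often lifts every positive scale to at least c R. This is the
  induction for statements that the functional equation transports from scale r / c to scale
  r.\<close>

lemma scale_induct:
  fixes P :: "real \<Rightarrow> bool"
  assumes c: "0 < c" "c < 1" and R: "0 < R" and r: "0 < r"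
    and base: "\<And>r. c * R \<le> r \<Longrightarrow> P r"
    and step: "\<And>r. 0 < r \<Longrightarrow> r < c * R \<Longrightarrow> P (r / c) \<Longrightarrow> P r"
  shows "P r"
proof -
  have "P r" if "0 < r" "c ^ n * (c * R) \<le> r" for n r
    using that
  proof (induction n arbitrary: r)
    case 0
    then show ?case using base by simp
  next
    case (Suc n)
    show ?case
    proof (cases "r < c * R")
      case True
      have "P (r / c)"
        using Suc.prems c by (intro Suc.IH) (auto simp: field_simps)
      then show ?thesis using step True Suc.prems by blast
    next
      case False
      then show ?thesis using base by simp
    qed
  qed
  moreover obtain n where "c ^ n < r / (c * R)"
    using real_arch_pow_inv[of "r / (c * R)" c] c R r by auto
  then have "c ^ n * (c * R) \<le> r"
    using c R by (simp add: field_simps)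
  ultimately show ?thesis using r by blast
qed

context cantor_rescaling begin

lemma rescale_corner:
  obtains w where "z = p + \<mu> *\<^sub>R w" "maxn w = maxn (z - p) / \<mu>"
proof
  show "z = p + \<mu> *\<^sub>R ((1 / \<mu>) *\<^sub>R (z - p))"
    using mu_pos by simp
  show "maxn ((1 / \<mu>) *\<^sub>R (z - p)) = maxn (z - p) / \<mu>"
    using mu_pos unfolding maxn_scaleR by simp
qed

lemma norm_model_diff: "norm (model \<sigma> \<mu> \<nu> z - model \<sigma> \<mu> \<nu> w) \<le> 2 * K1 * norm (z - w)"
proof -
  have "norm (model \<sigma> \<mu> \<nu> z - model \<sigma> \<mu> \<nu> w) \<le> 2 * (K1 * maxn (z - w))"
    using norm_le_maxn[of "model \<sigma> \<mu> \<nu> z - model \<sigma> \<mu> \<nu> w"] model_lipschitz[of z w] by linarith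
  also have "\<dots> \<le> 2 * (K1 * norm (z - w))"
    using K1_pos maxn_le_norm by (intro mult_left_mono) auto
  finally show ?thesis by simp
qed

lemma norm_cmap_diff: "norm (F z - F w) \<le> norm (z - w) + 32"
proof -
  have "norm (F u - u) \<le> 16" for u
    using norm_le_maxn[of "F u - u"] cmap_displacement[of u] by linarith
  then have "norm (F z - z) \<le> 16" "norm (F w - w) \<le> 16" by blast+
  moreover have "norm (F z - F w) \<le> norm (F z - z) + norm (F w - w) + norm (z - w)"
    using norm_triangle_ineq[of "(F z - z) - (F w - w)" "z - w"] norm_triangle_ineq4[of "F z - z" "F w - w"]
    by (simp add: algebra_simps)
  ultimately show ?thesis by linarith
qed

text \<open>Uniform continuity of the inverse in contrapositive form. It supplies the lower bound at
  coarse scales, where the induction on scales ends.\<close>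

lemma cmap_separates:
  assumes "0 < s"
  obtains \<delta> where "0 < \<delta>" "\<And>x z. s \<le> norm (z - x) \<Longrightarrow> \<delta> \<le> norm (F z - F x)"
proof -
  have "uniformly_continuous_on UNIV (cmap \<sigma> \<nu> \<mu>)"
    by (rule cantor_rescaling.cmap_uniformly_continuous[OF swap])
  then obtain \<delta> where \<delta>: "\<delta> > 0"
      "\<And>u v. dist v u < \<delta> \<Longrightarrow> dist (cmap \<sigma> \<nu> \<mu> v) (cmap \<sigma> \<nu> \<mu> u) < s"
    unfolding uniformly_continuous_on_def using assms by (metis UNIV_I)
  have "\<delta> \<le> norm (F z - F x)" if "s \<le> norm (z - x)" for x z
    using \<delta>(2)[of "F z" "F x"] that by (fastforce simp: cmap_swap dist_norm norm_minus_commute)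
  then show ?thesis using that \<delta>(1) by blast
qed

text \<open>The factor K leaves room for a bilipschitz map applied first. Near a corner the triple
  is enlarged by 1 / \<mu>; both sides of the claim change by the same factor, so H is kept. The
  descent ends at a coarse scale or where F agrees with the bilipschitz model.\<close>

lemma cmap_quasisymmetric:
  assumes K: "1 \<le> K"
  obtains H R where "1 \<le> H" "0 < R"
    "\<And>r x y z. 0 < r \<Longrightarrow> r < R \<Longrightarrow> norm (y - x) \<le> K * r \<Longrightarrow> r \<le> norm (z - x) \<Longrightarrow>
      norm (z - x) \<le> K * r \<Longrightarrow> norm (F y - F x) \<le> H * norm (F z - F x)"
proof -
  interpret s: cantor_rescaling \<sigma> \<nu> \<mu> by (rule swap)
  \<comment> \<open>For r < \<mu> R the three points are within \<mu> (1/2 - \<sigma>) of each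
    other. If one is within \<mu> (1/2 + \<sigma>) of a corner, all are within \<mu> of it and
    rescale together; otherwise the higher layers vanish at all three.\<close>
  define R where "R = (1/2 - \<sigma>) / (2 * K)"
  have R: "0 < R" "2 * K * R = 1/2 - \<sigma>"
    using K sigma_less by (auto simp: R_def)
  obtain \<delta> where \<delta>: "0 < \<delta>" "\<And>x z. \<mu> * R \<le> norm (z - x) \<Longrightarrow> \<delta> \<le> norm (F z - F x)"
    using cmap_separates[of "\<mu> * R"] mu_pos R by auto
  \<comment> \<open>One summand for each way the descent can end: scales between \<mu> R and R, and
    triples moved by the model, whose distortion is K times the Lipschitz constants
    \<open>2 * K1\<close> and \<open>2 * s.K1\<close> of the model and its inverse.\<close>
  define H where "H = 1 + (K * R + 32) / \<delta> + 4 * K * K1 * s.K1"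
  have H: "1 \<le> H" "(K * R + 32) / \<delta> \<le> H" "4 * K * K1 * s.K1 \<le> H"
    using K R \<delta>(1) K1_pos s.K1_pos by (auto simp: H_def)
  define P where "P r \<longleftrightarrow> (\<forall>x y z :: complex. r < R \<longrightarrow> norm (y - x) \<le> K * r \<longrightarrow> r \<le> norm (z - x) \<longrightarrow>
      norm (z - x) \<le> K * r \<longrightarrow> norm (F y - F x) \<le> H * norm (F z - F x))" for r
  have "P r" if "0 < r" for r
  proof (rule scale_induct[where c = \<mu> and R = R])
    fix r assume r: "\<mu> * R \<le> r"
    show "P r"
      unfolding P_def
    proof (intro allI impI)
      fix x y z :: complex assume a: "r < R" "norm (y - x) \<le> K * r" "r \<le> norm (z - x)" "norm (z - x) \<le> K * r"
      have "norm (F y - F x) \<le> K * R + 32"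
        using norm_cmap_diff[of y x] a mult_left_mono[of r R K] K by linarith
      also have "\<dots> = (K * R + 32) / \<delta> * \<delta>"
        using \<delta> by simp
      also have "\<dots> \<le> H * norm (F z - F x)"
        using H \<delta>(2)[of z x] \<delta>(1) a r by (intro mult_mono) auto
      finally show "norm (F y - F x) \<le> H * norm (F z - F x)" .
    qed
  next
    fix r assume r: "0 < r" "r < \<mu> * R" and IH: "P (r / \<mu>)"
    show "P r"
      unfolding P_def
    proof (intro allI impI)
      fix x y z :: complex assume a: "r < R" "norm (y - x) \<le> K * r" "r \<le> norm (z - x)" "norm (z - x) \<le> K * r"
      have sep: "maxn (u - v) \<le> \<mu> * (1/2 - \<sigma>)" if "u \<in> {x, y, z}" "v \<in> {x, y, z}" for u v
      proof -
        have "norm (u - x) \<le> K * r" "norm (v - x) \<le> K * r"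
          using that a r K by auto
        then have "norm (u - v) \<le> 2 * K * r"
          using norm_triangle_ineq4[of "u - x" "v - x"] by simp
        also have "\<dots> \<le> 2 * K * (\<mu> * R)"
          using r K by (intro mult_left_mono) auto
        also have "\<dots> = \<mu> * (1/2 - \<sigma>)"
          unfolding R(2)[symmetric] by simp
        finally show ?thesis using maxn_le_norm order_trans by blast
      qed
      show "norm (F y - F x) \<le> H * norm (F z - F x)"
      proof (cases "\<exists>p\<in>corners. \<exists>u\<in>{x,y,z}. maxn (u - p) \<le> \<mu> * (1/2 + \<sigma>)")
        case True
        then obtain p u where p: "p \<in> corners" "u \<in> {x,y,z}" "maxn (u - p) \<le> \<mu> * (1/2 + \<sigma>)"
          by blast
        have near: "maxn (v - p) \<le> \<mu>" if "v \<in> {x,y,z}" for v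
        proof -
          have "maxn (v - p) \<le> \<mu> * (1/2 - \<sigma>) + \<mu> * (1/2 + \<sigma>)"
            using maxn_triangle[of "v - u" "u - p"] sep[OF that p(2)] p(3) by simp
          then show ?thesis by (simp add: algebra_simps)
        qed
        obtain x' where x': "x = p + \<mu> *\<^sub>R x'" "maxn x' = maxn (x - p) / \<mu>"
          by (rule rescale_corner)
        obtain y' where y': "y = p + \<mu> *\<^sub>R y'" "maxn y' = maxn (y - p) / \<mu>"
          by (rule rescale_corner)
        obtain z' where z': "z = p + \<mu> *\<^sub>R z'" "maxn z' = maxn (z - p) / \<mu>"
          by (rule rescale_corner)
        have le1: "maxn x' \<le> 1" "maxn y' \<le> 1" "maxn z' \<le> 1"
          using near x'(2) y'(2) z'(2) mu_pos by auto
        have sc: "norm (y - x) = \<mu> * norm (y' - x')" "norm (z - x) = \<mu> * norm (z' - x')"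
          using x'(1) y'(1) z'(1) mu_pos norm_scaleR[of \<mu> "y' - x'"] norm_scaleR[of \<mu> "z' - x'"]
          by (simp_all add: scaleR_diff_right)
        have "norm (F y' - F x') \<le> H * norm (F z' - F x')"
          using IH[unfolded P_def, rule_format, of y' x' z'] a r sc mu_pos by (simp add: field_simps)
        then have "\<nu> * norm (F y' - F x') \<le> \<nu> * (H * norm (F z' - F x'))"
          using lam_pos by simp
        moreover have "norm (F y - F x) = \<nu> * norm (F y' - F x')"
            "norm (F z - F x) = \<nu> * norm (F z' - F x')"
          unfolding x'(1) y'(1) z'(1) using cmap_near[OF p(1)] le1 lam_pos
            norm_scaleR[of \<nu> "F y' - F x'"] norm_scaleR[of \<nu> "F z' - F x'"]
          by (simp_all add: scaleR_diff_right)
        ultimately show ?thesis by (simp add: algebra_simps)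
      next
        case False
        then have m: "F u = model \<sigma> \<mu> \<nu> u" if "u \<in> {x,y,z}" for u
          using that by (intro cmap_far) force
        have "norm (z - x) \<le> 2 * s.K1 * norm (F z - F x)"
          using s.norm_model_diff[of "F z" "F x"] m by (simp add: model_swap)
        then have 1: "r \<le> 2 * s.K1 * norm (F z - F x)"
          using a by simp
        have "norm (F y - F x) \<le> 2 * K1 * norm (y - x)"
          using norm_model_diff[of y x] m by simp
        also have "\<dots> \<le> 2 * K1 * (K * (2 * s.K1 * norm (F z - F x)))"
          using a(2) 1 K K1_pos by (intro mult_left_mono) (auto intro: order_trans[OF _ mult_left_mono])
        also have "\<dots> = (4 * K * K1 * s.K1) * norm (F z - F x)"
          by simp
        also have "\<dots> \<le> H * norm (F z - F x)"
          using H by (intro mult_right_mono) auto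
        finally show ?thesis .
      qed
    qed
  qed (use that params R in auto)
  then show ?thesis
    using that[OF H(1) R(1)] unfolding P_def by blast
qed

text \<open>A circle of radius r goes under g into an annulus of radii r / M and M r. With r / M as
  base scale the ratio is \<open>M\<^sup>2\<close>, the K for which quasisymmetry is invoked; the
  resulting bound holds on all small circles, not only in the limit.\<close>

lemma quasiconformal_cmap_comp:
  assumes hom: "homeomorphism UNIV UNIV g g'" and M: "1 \<le> M"
    and lower: "\<And>x y. norm (x - y) \<le> M * norm (g x - g y)"
    and upper: "\<And>x y. norm (g x - g y) \<le> M * norm (x - y)"
  shows "quasiconformal (F \<circ> g)"
proof -
  have hom': "homeomorphism UNIV UNIV (F \<circ> g) (g' \<circ> cmap \<sigma> \<nu> \<mu>)"
    using homeomorphism_compose[OF hom homeomorphism_cmap] .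
  have inj: "F (g x) = F (g y) \<longleftrightarrow> x = y" for x y
    using hom' unfolding homeomorphism_def by (metis UNIV_I comp_def)
  have "1 \<le> M\<^sup>2" using M by simp
  then obtain H R where H: "1 \<le> H" and R: "0 < R" and qs:
    "\<And>r x y z. 0 < r \<Longrightarrow> r < R \<Longrightarrow> norm (y - x) \<le> M\<^sup>2 * r \<Longrightarrow> r \<le> norm (z - x) \<Longrightarrow>
      norm (z - x) \<le> M\<^sup>2 * r \<Longrightarrow> norm (F y - F x) \<le> H * norm (F z - F x)"
    using cmap_quasisymmetric by blast
  have dil: "linear_dilatation (F \<circ> g) x \<le> ereal H" for x
  proof -
    let ?f = "F \<circ> g"
    let ?S = "\<lambda>r. SUP y\<in>sphere x r. ereal (dist (?f x) (?f y))"
    let ?I = "\<lambda>r. INF y\<in>sphere x r. ereal (dist (?f x) (?f y))"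
    have bound: "?S r / ?I r \<le> ereal H" if r: "0 < r" "r < M * R" for r
    proof -
      have main: "dist (?f x) (?f y) \<le> H * dist (?f x) (?f z)" if "y \<in> sphere x r" "z \<in> sphere x r" for y z
      proof -
        have n: "norm (y - x) = r" "norm (z - x) = r"
          using that by (auto simp: dist_norm norm_minus_commute)
        have "norm (F (g y) - F (g x)) \<le> H * norm (F (g z) - F (g x))"
        proof (rule qs[of "r / M"])
          show "norm (g y - g x) \<le> M\<^sup>2 * (r / M)" "norm (g z - g x) \<le> M\<^sup>2 * (r / M)"
            using upper[of y x] upper[of z x] n M by (auto simp: power2_eq_square)
          show "r / M \<le> norm (g z - g x)"
            using lower[of z x] n M by (simp add: field_simps)
        qed (use r M in \<open>auto simp: field_simps\<close>)
        then show ?thesis by (simp add: dist_norm norm_minus_commute)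
      qed
      \<comment> \<open>One point of the circle shows that the infimum is positive, by injectivity
        and the distortion bound, and finite; the quotient of extended reals needs both.\<close>
      define y0 where "y0 = x + of_real r"
      have y0: "y0 \<in> sphere x r"
        using r by (simp add: y0_def dist_norm)
      define d0 where "d0 = dist (?f x) (?f y0)"
      have d0: "0 < d0"
        using inj[of x y0] r by (auto simp: d0_def y0_def)
      have I_ge: "ereal (d / H) \<le> ?I r" if "y \<in> sphere x r" "d = dist (?f x) (?f y)" for y d
        using main[OF that(1)] that(2) H by (intro INF_greatest) (simp add: field_simps)
      have "ereal (d0 / H) \<le> ?I r"
        using I_ge[OF y0] d0_def by blast
      then have I_pos: "0 < ?I r"
        using d0 H by (simp add: less_le_trans[of 0 "ereal (d0 / H)"])
      have "?I r \<le> ereal d0"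
        using y0 by (intro INF_lower2[of y0]) (auto simp: d0_def)
      then have I_fin: "?I r \<noteq> \<infinity>" by auto
      have "?S r \<le> ?I r * ereal H"
      proof (rule SUP_least)
        fix y assume y: "y \<in> sphere x r"
        have "ereal (dist (?f x) (?f y)) = ereal (dist (?f x) (?f y) / H) * ereal H"
          using H by simp
        also have "\<dots> \<le> ?I r * ereal H"
          using I_ge[OF y] H by (intro ereal_mult_right_mono) auto
        finally show "ereal (dist (?f x) (?f y)) \<le> ?I r * ereal H" .
      qed
      then show ?thesis
        using ereal_divide_le_pos[OF I_pos I_fin] by blast
    qed
    have "0 < M * R" using M R by simp
    then have "eventually (\<lambda>r. ?S r / ?I r \<le> ereal H) (at_right 0)"
      unfolding eventually_at_right_field using bound by blast
    then show ?thesis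
      unfolding linear_dilatation_def by (rule Limsup_bounded)
  qed
  show ?thesis
    unfolding quasiconformal_def using hom' dil by blast
qed

end

section \<open>Covering numbers of the image of a curve\<close>

text \<open>A real upper bound in place of \<open>covering_number\<close>: such bounds add, scale
  and weaken without passing through extended naturals.\<close>

definition covered :: "real \<Rightarrow> complex set \<Rightarrow> real \<Rightarrow> bool" where
  "covered r A k \<longleftrightarrow> (\<exists>S. finite S \<and> A \<subseteq> (\<Union>c\<in>S. ball c r) \<and> real (card S) \<le> k)"

lemma covered_mono: "covered r A k \<Longrightarrow> B \<subseteq> A \<Longrightarrow> k \<le> l \<Longrightarrow> covered r B l"
  unfolding covered_def by (meson order_trans)

lemma covered_radius_mono: "covered r A k \<Longrightarrow> r \<le> s \<Longrightarrow> covered s A k"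
  unfolding covered_def by (meson UN_mono dual_order.trans order_refl subset_ball)

lemma covered_Un:
  assumes "covered r A j" "covered r B k"
  shows "covered r (A \<union> B) (j + k)"
proof -
  obtain S T where S: "finite S" "A \<subseteq> (\<Union>c\<in>S. ball c r)" "real (card S) \<le> j"
    and T: "finite T" "B \<subseteq> (\<Union>c\<in>T. ball c r)" "real (card T) \<le> k"
    using assms unfolding covered_def by metis
  have "real (card (S \<union> T)) \<le> real (card S) + real (card T)"
    using card_Un_le[of S T] by linarith
  then show ?thesis
    unfolding covered_def using S T by (intro exI[of _ "S \<union> T"]) auto
qed

lemma covered_UN:
  assumes "finite I" "\<And>i. i \<in> I \<Longrightarrow> covered r (A i) k"
  shows "covered r (\<Union>i\<in>I. A i) (real (card I) * k)"
  using assms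
proof (induction I rule: finite_induct)
  case empty
  then show ?case by (auto simp: covered_def intro!: exI[of _ "{}"])
next
  case (insert i I)
  then show ?case
    using covered_Un[of r "A i" k "\<Union>i\<in>I. A i" "real (card I) * k"] by (simp add: distrib_right)
qed

lemma covered_lipschitz_image:
  assumes L: "0 < L" "\<And>x y. norm (f x - f y) \<le> L * norm (x - y)" and c: "covered r A k"
  shows "covered (L * r) (f ` A) k"
proof -
  obtain S where S: "finite S" "A \<subseteq> (\<Union>c\<in>S. ball c r)" "real (card S) \<le> k"
    using c unfolding covered_def by blast
  have "f ` A \<subseteq> (\<Union>c\<in>f ` S. ball c (L * r))"
  proof safe
    fix x assume "x \<in> A"
    then obtain c where c: "c \<in> S" "norm (c - x) < r"
      using S(2) by (auto simp: dist_norm)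
    then have "norm (f c - f x) < L * r"
      using L(2)[of c x] mult_strict_left_mono[OF c(2) L(1)] by linarith
    then show "f x \<in> (\<Union>c\<in>f ` S. ball c (L * r))"
      using c by (auto simp: dist_norm)
  qed
  moreover have "real (card (f ` S)) \<le> k"
    using card_image_le[OF S(1), of f] S(3) by linarith
  ultimately show ?thesis
    unfolding covered_def using S(1) by blast
qed

lemma covered_scaleR_image:
  assumes "0 < c" "covered r A k"
  shows "covered (c * r) ((\<lambda>z. p + c *\<^sub>R z) ` A) k"
  using assms by (intro covered_lipschitz_image) (auto simp flip: scaleR_diff_right)

lemma covered_bounded:
  assumes "bounded A" "0 < r"
  obtains k where "covered r A k"
proof -
  have "compact (closure A)" using assms by simp
  then obtain S where "finite S" "closure A \<subseteq> (\<Union>c\<in>S. ball c r)"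
    using assms(2) compact_eq_totally_bounded[of "closure A"] by metis
  then show ?thesis
    using that closure_subset unfolding covered_def by blast
qed

text \<open>The constant is the same for all similar copies of a set, which is what the inductions on scales need.\<close>

definition linelike :: "real \<Rightarrow> complex set \<Rightarrow> bool" where
  "linelike C J \<longleftrightarrow> (\<forall>x R r. 0 < r \<longrightarrow> r \<le> R \<longrightarrow> covered r (J \<inter> ball x R) (C * (R / r)))"

lemma linelike_scaleR_vimage:
  assumes "linelike C J" "0 < c"
  shows "linelike C {z. p + c *\<^sub>R z \<in> J}"
  unfolding linelike_def
proof (intro allI impI)
  fix y :: complex and R r :: real assume r: "0 < r" "r \<le> R"
  then have "0 < c * r" "c * r \<le> c * R"
    using assms(2) by auto
  then have "covered (c * r) (J \<inter> ball (p + c *\<^sub>R y) (c * R)) (C * (c * R / (c * r)))"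
    using assms(1) unfolding linelike_def by blast
  from covered_scaleR_image[OF _ this, of "1 / c" "- (1 / c) *\<^sub>R p"] assms(2)
  have "covered r ((\<lambda>z. - (1 / c) *\<^sub>R p + (1 / c) *\<^sub>R z) ` (J \<inter> ball (p + c *\<^sub>R y) (c * R))) (C * (R / r))"
    by simp
  then show "covered r ({z. p + c *\<^sub>R z \<in> J} \<inter> ball y R) (C * (R / r))"
  proof (rule covered_mono)
    show "{z. p + c *\<^sub>R z \<in> J} \<inter> ball y R
        \<subseteq> (\<lambda>z. - (1 / c) *\<^sub>R p + (1 / c) *\<^sub>R z) ` (J \<inter> ball (p + c *\<^sub>R y) (c * R))"
    proof
      fix z assume z: "z \<in> {z. p + c *\<^sub>R z \<in> J} \<inter> ball y R"
      have "norm (p + c *\<^sub>R y - (p + c *\<^sub>R z)) = c * norm (y - z)"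
        using assms(2) norm_scaleR[of c "y - z"] by (simp add: scaleR_diff_right)
      also have "\<dots> < c * R"
        using z assms(2) by (simp add: dist_norm)
      finally have "p + c *\<^sub>R z \<in> J \<inter> ball (p + c *\<^sub>R y) (c * R)"
        using z by (simp add: dist_norm)
      moreover have "z = - (1 / c) *\<^sub>R p + (1 / c) *\<^sub>R (p + c *\<^sub>R z)"
        using assms(2) by (simp add: scaleR_add_right)
      ultimately show "z \<in> (\<lambda>z. - (1 / c) *\<^sub>R p + (1 / c) *\<^sub>R z) ` (J \<inter> ball (p + c *\<^sub>R y) (c * R))"
        by blast
    qed
  qed simp
qed

lemma linelike_nonneg:
  assumes "linelike C J"
  shows "0 \<le> C"
proof -
  have "covered 1 (J \<inter> ball 0 1) (C * (1 / 1))"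
    using assms unfolding linelike_def by (metis order_refl zero_less_one)
  then show ?thesis
    unfolding covered_def by (auto intro: order_trans[OF of_nat_0_le_iff])
qed

section \<open>Covering the image of a linelike set\<close>

context cantor_rescaling begin

abbreviation "Q \<equiv> {z. maxn z \<le> 1}"

lemma bounded_Q: "bounded Q"
  unfolding bounded_iff using norm_le_maxn by (intro exI[of _ 2]) (smt (verit) mem_Collect_eq)

lemma K1_ge: "1 \<le> K1"
  using K0_pos by (simp add: K1_def)

lemma covered_model_image:
  assumes J: "linelike C J" and r: "0 < r" "r \<le> R"
  shows "covered r (model \<sigma> \<mu> \<nu> ` (J \<inter> ball x R)) (2 * K1 * C * (R / r))"
proof -
  have "r * 1 \<le> R * (2 * K1)"
    using r K1_ge by (intro mult_mono) auto
  then have "0 < r / (2 * K1)" "r / (2 * K1) \<le> R"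
    using r K1_pos by (auto simp: field_simps)
  then have "covered (r / (2 * K1)) (J \<inter> ball x R) (C * (R / (r / (2 * K1))))"
    using J unfolding linelike_def by blast
  from covered_lipschitz_image[OF _ norm_model_diff this]
  show ?thesis using K1_pos by (simp add: mult_ac)
qed

text \<open>D is fixed before J, because the induction on r replaces J by its preimages under the
  four contractions, which are linelike with the same C.\<close>

lemma covered_square:
  assumes "1 < d" "\<nu> powr d = 1/4"
  obtains D where "0 \<le> D" "\<And>J r. linelike C J \<Longrightarrow> 0 < r \<Longrightarrow> r \<le> 1 \<Longrightarrow>
    covered r (F ` J \<inter> Q) (D * r powr - d)"
proof (cases "0 \<le> C")
  case False
  then have "\<And>J. \<not> linelike C J" using linelike_nonneg by blast
  then show ?thesis using that[of 0] by simp
next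
  case C: True
  interpret s: cantor_rescaling \<sigma> \<nu> \<mu> by (rule swap)
  \<comment> \<open>Here 1 < d enters: it makes \<nu> larger than \<nu>^d = 1/4.\<close>
  have "\<nu> powr d < \<nu> powr 1"
    using assms(1) params by (intro powr_less_mono') auto
  then have nu4: "1 < 4 * \<nu>"
    using assms(2) lam_pos by simp
  \<comment> \<open>Points of the square have Euclidean norm at most 2, so the part of J moved by
    the model lies in \<open>ball 0 3\<close>; this is the factor 3.\<close>
  define C2 where "C2 = 2 * K1 * C * 3"
  define C' where "C' = C2 / (4 * \<nu> - 1)"
  have C2: "0 \<le> C2" using C K1_pos by (simp add: C2_def)
  have C': "0 \<le> C'" "4 * \<nu> * C' - C2 = C'"
    using C2 nu4 by (auto simp: C'_def field_simps)
  obtain C3 where C3: "covered \<nu> Q C3"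
    using covered_bounded[OF bounded_Q lam_pos] by blast
  then have C3_pos: "0 \<le> C3"
    unfolding covered_def by (auto intro: order_trans[OF of_nat_0_le_iff])
  define D where "D = C3 + C'"
  \<comment> \<open>The rectifiable part costs C2 / r in each step. The correction C' / r absorbs it: in the sum over
      the four corners it is multiplied by 4 \<nu> > 1.\<close>
  define P where "P r \<longleftrightarrow> (\<forall>J. linelike C J \<longrightarrow> r \<le> 1 \<longrightarrow>
      covered r (F ` J \<inter> Q) (D * r powr - d - C' / r))" for r
  have main: "P r" if "0 < r" for r
  proof (rule scale_induct[where c = \<nu> and R = 1])
    fix r assume "\<nu> * 1 \<le> r"
    then have r: "\<nu> \<le> r" "0 < r" using lam_pos by auto
    show "P r"
      unfolding P_def
    proof (intro allI impI)
      fix J assume "linelike C J" "r \<le> 1"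
      have a: "1 / r \<le> r powr - d"
        using powr_mono'[of "- d" "- 1" r] assms(1) r \<open>r \<le> 1\<close> by (simp add: powr_minus_divide)
      have "1 \<le> 1 / r" using r \<open>r \<le> 1\<close> by simp
      then have "C3 * 1 \<le> C3 * r powr - d"
        using a C3_pos by (intro mult_left_mono) auto
      moreover have "C' * (1 / r) \<le> C' * r powr - d"
        using a C' by (intro mult_left_mono) auto
      ultimately have "C3 \<le> D * r powr - d - C' / r"
        by (simp add: D_def distrib_right)
      then show "covered r (F ` J \<inter> Q) (D * r powr - d - C' / r)"
        using covered_radius_mono[OF C3 r(1)] by (rule_tac covered_mono) auto
    qed
  next
    fix r assume r: "0 < r" "r < \<nu> * 1"
      and IH: "P (r / \<nu>)"
    show "P r"
      unfolding P_def
    proof (intro allI impI)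
      fix J assume J: "linelike C J" and "r \<le> 1"
      define k where "k = D * (r / \<nu>) powr - d - C' / (r / \<nu>)"
      define J' where "J' p = {w. p + \<mu> *\<^sub>R w \<in> J}" for p
      have sub: "F ` J \<inter> Q \<subseteq> (\<Union>p\<in>corners. (\<lambda>w. p + \<nu> *\<^sub>R w) ` (F ` J' p \<inter> Q))
          \<union> model \<sigma> \<mu> \<nu> ` (J \<inter> ball 0 3)"
      proof safe
        fix z assume z: "z \<in> J" "maxn (F z) \<le> 1"
          and nin: "F z \<notin> model \<sigma> \<mu> \<nu> ` (J \<inter> ball 0 3)"
        have z1: "maxn z \<le> 1"
          using s.cmap_bounded[OF z(2)] by (simp add: cmap_swap)
        show "F z \<in> (\<Union>p\<in>corners. (\<lambda>w. p + \<nu> *\<^sub>R w) ` (F ` J' p \<inter> Q))"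
        proof (rule rescaled_or_far[of 1 z])
          fix p w assume h: "p \<in> corners" "maxn w \<le> 1" "z = p + \<mu> *\<^sub>R w"
          then have "F z = p + \<nu> *\<^sub>R F w" "w \<in> J' p" "maxn (F w) \<le> 1"
            using cmap_near cmap_bounded z(1) by (auto simp: J'_def)
          then show ?thesis using h(1) by blast
        next
          assume "\<And>p. p \<in> corners \<Longrightarrow> \<mu> * 1 < maxn (z - p)"
          then have "F z = model \<sigma> \<mu> \<nu> z" by (intro cmap_avoids_corner) simp
          moreover have "z \<in> J \<inter> ball 0 3"
            using z(1) z1 norm_le_maxn[of z] by (simp add: dist_norm)
          ultimately show ?thesis using nin by blast
        qed simp
      qed
      have "covered r (\<Union>p\<in>corners. (\<lambda>w. p + \<nu> *\<^sub>R w) ` (F ` J' p \<inter> Q)) (real (card corners) * k)"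
      proof (rule covered_UN)
        fix p
        have "covered (r / \<nu>) (F ` J' p \<inter> Q) k"
          unfolding k_def using IH linelike_scaleR_vimage[OF J mu_pos, of p] r by (simp add: P_def J'_def)
        from covered_scaleR_image[OF lam_pos this, of p]
        show "covered r ((\<lambda>w. p + \<nu> *\<^sub>R w) ` (F ` J' p \<inter> Q)) k"
          using lam_pos by simp
      qed simp
      from covered_Un[OF this covered_model_image[OF J, of r 3 0]]
      have "covered r (F ` J \<inter> Q) (4 * k + C2 / r)"
        using r \<open>r \<le> 1\<close> by (rule_tac covered_mono[OF _ sub]) (auto simp: card_corners C2_def)
      moreover have "4 * k + C2 / r = D * r powr - d - (4 * \<nu> * C' - C2) / r"
      proof -
        \<comment> \<open>The four corner copies at scale r / \<nu> together cost exactly D r^-d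
          again, so the leading term does not grow along the induction.\<close>
        have "(r / \<nu>) powr - d = r powr - d / 4"
          using r lam_pos by (simp add: powr_divide powr_minus_divide assms(2))
        then show ?thesis
          using r by (simp add: k_def field_simps)
      qed
      ultimately show "covered r (F ` J \<inter> Q) (D * r powr - d - C' / r)"
        unfolding C'(2) by simp
    qed
  qed (use that params in auto)
  show ?thesis
  proof (rule that[of D])
    show "0 \<le> D" using C3_pos C' by (simp add: D_def)
    fix J and r :: real assume h: "linelike C J" "0 < r" "r \<le> 1"
    then have "covered r (F ` J \<inter> Q) (D * r powr - d - C' / r)"
      using main unfolding P_def by blast
    then show "covered r (F ` J \<inter> Q) (D * r powr - d)"
      by (rule covered_mono) (use C' h in auto)
  qed
qed

text \<open>The previous estimate covers the whole square; this one localises it to balls by an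
  induction on R. A small ball either lies in one image square and is enlarged by 1 / \<nu>, or
  meets only points where the inverse of F is the inverse model, and there the image is still
  linelike.\<close>

lemma covered_cmap_image:
  assumes d: "1 < d" "\<nu> powr d = 1/4" and J0: "linelike C J"
  obtains D where "0 \<le> D" "\<And>x r R. 0 < r \<Longrightarrow> r \<le> R \<Longrightarrow>
    covered r (F ` J \<inter> ball x R) (D * (R / r) powr d)"
proof -
  interpret s: cantor_rescaling \<sigma> \<nu> \<mu> by (rule swap)
  note C = linelike_nonneg[OF J0]
  obtain D where D: "0 \<le> D" "\<And>J r. linelike C J \<Longrightarrow> 0 < r \<Longrightarrow> r \<le> 1 \<Longrightarrow>
      covered r (F ` J \<inter> Q) (D * r powr - d)"
    using covered_square[OF d] by blast
  \<comment> \<open>A ball of radius below \<nu> R1 has diameter at most \<nu> (1/2 - \<sigma>), the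
    width of the collar in the image, so it either lies within \<nu> of one corner or stays farther
    than \<nu> (1/2 + \<sigma>) from all of them.\<close>
  define R1 where "R1 = (1/2 - \<sigma>) / 2"
  define \<rho> where "\<rho> = \<nu> * R1"
  have R1: "0 < R1" using sigma_less by (simp add: R1_def)
  have \<rho>: "0 < \<rho>" using R1 lam_pos by (simp add: \<rho>_def)
  \<comment> \<open>Three sources: for R \<ge> \<rho> the part in the square, with \<rho>^-d for r
    \<le> 1 and the extra 1 for r > 1; the part of J outside the square; small balls on which only
    the model acts.\<close>
  define D1 where "D1 = D * (\<rho> powr - d + 1) + C + 4 * K1 * s.K1 * C"
  have "0 \<le> 4 * K1 * s.K1 * C" "0 \<le> D * (\<rho> powr - d + 1)"
    using C K1_pos s.K1_pos D(1) by auto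
  then have D1: "D * (\<rho> powr - d + 1) + C \<le> D1" "4 * K1 * s.K1 * C \<le> D1" "0 \<le> D1"
    using C by (auto simp: D1_def)
  define P where "P R \<longleftrightarrow> (\<forall>J x r. linelike C J \<longrightarrow> 0 < r \<longrightarrow> r \<le> R \<longrightarrow>
      covered r (F ` J \<inter> ball x R) (D1 * (R / r) powr d))" for R
  have ratio: "1 \<le> (R / r) powr d" "R / r \<le> (R / r) powr d" if "0 < r" "r \<le> R" for r R
  proof -
    have "1 \<le> R / r" using that by simp
    then show "1 \<le> (R / r) powr d" "R / r \<le> (R / r) powr d"
      using powr_mono[of 0 d "R / r"] powr_mono[of 1 d "R / r"] d(1) that by auto
  qed
  have "P R" if "0 < R" for R
  proof (rule scale_induct[where c = \<nu> and R = R1])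
    fix R assume "\<nu> * R1 \<le> R"
    then have R: "\<rho> \<le> R" by (simp add: \<rho>_def)
    show "P R"
      unfolding P_def
    proof (intro allI impI)
      fix J x r assume J: "linelike C J" and r: "0 < r" "r \<le> R"
      have "covered r (F ` J \<inter> Q) (D * (\<rho> powr - d + 1) * (R / r) powr d)"
      proof (cases "r \<le> 1")
        case True
        have "r powr - d = R powr - d * (R / r) powr d"
          using r by (simp add: powr_divide powr_minus_divide)
        also have "\<dots> \<le> (\<rho> powr - d + 1) * (R / r) powr d"
          using powr_mono2'[of "- d" \<rho> R] R \<rho> d(1) by (intro mult_right_mono) auto
        finally have "D * r powr - d \<le> D * ((\<rho> powr - d + 1) * (R / r) powr d)"
          using D(1) by (intro mult_left_mono)
        then show ?thesis
          using D(2)[OF J r(1) True] by (rule_tac covered_mono) (auto simp: mult.assoc)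
      next
        case False
        have "covered 1 (F ` J \<inter> Q) (D * 1 powr - d)"
          using J by (intro D(2)) auto
        then have "covered r (F ` J \<inter> Q) (D * 1 powr - d)"
          using False by (rule_tac covered_radius_mono) auto
        moreover have "D * 1 * 1 \<le> D * (\<rho> powr - d + 1) * (R / r) powr d"
          using ratio[OF r] D(1) by (intro mult_mono) auto
        ultimately show ?thesis by (rule_tac covered_mono) auto
      qed
      moreover have "covered r (J \<inter> ball x R) (C * (R / r))"
        using J r unfolding linelike_def by blast
      ultimately have "covered r ((F ` J \<inter> Q) \<union> (J \<inter> ball x R))
          (D * (\<rho> powr - d + 1) * (R / r) powr d + C * (R / r))"
        by (rule covered_Un)
      then show "covered r (F ` J \<inter> ball x R) (D1 * (R / r) powr d)"
      proof (rule covered_mono)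
        \<comment> \<open>Outside the square F is the identity, so there the image is covered by the
          linelike bound for J itself.\<close>
        have "F z \<in> Q \<or> F z = z" for z
        proof (cases "maxn z \<le> 1")
          case False
          then show ?thesis using cmap_outside[of z] sigma_less by simp
        qed (use cmap_bounded in auto)
        then show "F ` J \<inter> ball x R \<subseteq> (F ` J \<inter> Q) \<union> (J \<inter> ball x R)" by force
        have "C * (R / r) \<le> C * (R / r) powr d"
          using ratio[OF r] C by (intro mult_left_mono) auto
        then have "D * (\<rho> powr - d + 1) * (R / r) powr d + C * (R / r)
            \<le> (D * (\<rho> powr - d + 1) + C) * (R / r) powr d"
          by (simp add: distrib_right)
        also have "\<dots> \<le> D1 * (R / r) powr d"
          using D1 by (intro mult_right_mono) auto
        finally show "D * (\<rho> powr - d + 1) * (R / r) powr d + C * (R / r) \<le> D1 * (R / r) powr d" .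
      qed
    qed
  next
    fix R assume R: "0 < R" "R < \<nu> * R1" and IH: "P (R / \<nu>)"
    show "P R"
      unfolding P_def
    proof (intro allI impI)
      fix J x r assume J: "linelike C J" and r: "0 < r" "r \<le> R"
      have sep: "maxn (u - v) \<le> \<nu> * (1/2 - \<sigma>)" if "u \<in> ball x R" "v \<in> ball x R" for u v
      proof -
        have "norm (x - u) < R" "norm (x - v) < R"
          using that by (auto simp: dist_norm)
        then have "norm (u - v) \<le> 2 * R"
          using norm_triangle_ineq4[of "x - v" "x - u"] by simp
        also have "\<dots> \<le> \<nu> * (1/2 - \<sigma>)"
          using R by (simp add: R1_def)
        finally show ?thesis using maxn_le_norm order_trans by blast
      qed
      show "covered r (F ` J \<inter> ball x R) (D1 * (R / r) powr d)"
      proof (cases "\<exists>p\<in>corners. \<exists>u\<in>ball x R. maxn (u - p) \<le> \<nu> * (1/2 + \<sigma>)")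
        case True
        then obtain p u where p: "p \<in> corners" "u \<in> ball x R" "maxn (u - p) \<le> \<nu> * (1/2 + \<sigma>)"
          by blast
        have near: "maxn (v - p) \<le> \<nu>" if "v \<in> ball x R" for v
        proof -
          have "maxn (v - p) \<le> \<nu> * (1/2 - \<sigma>) + \<nu> * (1/2 + \<sigma>)"
            using maxn_triangle[of "v - u" "u - p"] sep[OF that p(2)] p(3) by simp
          then show ?thesis by (simp add: algebra_simps)
        qed
        obtain x' where x': "x = p + \<nu> *\<^sub>R x'"
          by (rule s.rescale_corner)
        define J' where "J' = {w. p + \<mu> *\<^sub>R w \<in> J}"
        have "0 < r / \<nu>" "r / \<nu> \<le> R / \<nu>"
          using r lam_pos by (auto simp: divide_right_mono)
        then have "covered (r / \<nu>) (F ` J' \<inter> ball x' (R / \<nu>)) (D1 * ((R / \<nu>) / (r / \<nu>)) powr d)"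
          using IH linelike_scaleR_vimage[OF J mu_pos, of p] unfolding P_def J'_def by blast
        from covered_scaleR_image[OF lam_pos this, of p]
        have "covered r ((\<lambda>w. p + \<nu> *\<^sub>R w) ` (F ` J' \<inter> ball x' (R / \<nu>))) (D1 * (R / r) powr d)"
          using lam_pos by simp
        then show ?thesis
        proof (rule covered_mono)
          show "F ` J \<inter> ball x R \<subseteq> (\<lambda>w. p + \<nu> *\<^sub>R w) ` (F ` J' \<inter> ball x' (R / \<nu>))"
          proof safe
            fix z assume z: "z \<in> J" "F z \<in> ball x R"
            obtain w where w: "F z = p + \<nu> *\<^sub>R w" "maxn w = maxn (F z - p) / \<nu>"
              by (rule s.rescale_corner)
            then have w1: "maxn w \<le> 1"
              using near[OF z(2)] lam_pos by simp
            have "z = cmap \<sigma> \<nu> \<mu> (p + \<nu> *\<^sub>R w)"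
              by (simp flip: w(1) add: cmap_swap)
            also have "\<dots> = p + \<mu> *\<^sub>R cmap \<sigma> \<nu> \<mu> w"
              by (rule s.cmap_near[OF p(1) w1])
            finally have "w \<in> F ` J'"
              using z(1) by (auto simp: J'_def cmap_swap' intro!: image_eqI[of _ _ "cmap \<sigma> \<nu> \<mu> w"])
            moreover have "norm (x' - w) < R / \<nu>"
            proof -
              have "\<nu> * norm (x' - w) = norm (x - F z)"
                unfolding x' w(1) using lam_pos norm_scaleR[of \<nu> "x' - w"] by (simp add: scaleR_diff_right)
              then show ?thesis using z(2) lam_pos by (simp add: dist_norm field_simps)
            qed
            ultimately show "F z \<in> (\<lambda>w. p + \<nu> *\<^sub>R w) ` (F ` J' \<inter> ball x' (R / \<nu>))"
              using w(1) by (auto simp: dist_norm)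
          qed
        qed simp
      next
        case False
        let ?y = "model \<sigma> \<nu> \<mu> x"
        have "1 * R \<le> 2 * s.K1 * R"
          using r s.K1_ge by (intro mult_right_mono) auto
        then have "r \<le> 2 * s.K1 * R"
          using r by linarith
        then have "covered r (model \<sigma> \<mu> \<nu> ` (J \<inter> ball ?y (2 * s.K1 * R))) (2 * K1 * C * (2 * s.K1 * R / r))"
          using r by (intro covered_model_image[OF J]) auto
        then show ?thesis
        proof (rule covered_mono)
          show "F ` J \<inter> ball x R \<subseteq> model \<sigma> \<mu> \<nu> ` (J \<inter> ball ?y (2 * s.K1 * R))"
          proof safe
            fix z assume z: "z \<in> J" "F z \<in> ball x R"
            have "z = cmap \<sigma> \<nu> \<mu> (F z)" by (simp add: cmap_swap)
            also have "\<dots> = model \<sigma> \<nu> \<mu> (F z)"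
              using False z(2) by (intro s.cmap_far) force
            finally have eq: "z = model \<sigma> \<nu> \<mu> (F z)" .
            have "norm (?y - z) \<le> 2 * s.K1 * norm (x - F z)"
              using s.norm_model_diff[of x "F z"] eq by simp
            also have "\<dots> < 2 * s.K1 * R"
              using z(2) s.K1_pos by (simp add: dist_norm)
            finally have "z \<in> J \<inter> ball ?y (2 * s.K1 * R)"
              using z(1) by (simp add: dist_norm)
            moreover have "F z = model \<sigma> \<mu> \<nu> z"
              using s.model_swap[of "F z"] eq by simp
            ultimately show "F z \<in> model \<sigma> \<mu> \<nu> ` (J \<inter> ball ?y (2 * s.K1 * R))" by blast
          qed
          have "2 * K1 * C * (2 * s.K1 * R / r) = (4 * K1 * s.K1 * C) * (R / r)" by simp
          also have "\<dots> \<le> D1 * (R / r) powr d"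
            using D1 ratio[OF r] r by (intro mult_mono) auto
          finally show "2 * K1 * C * (2 * s.K1 * R / r) \<le> D1 * (R / r) powr d" .
        qed
      qed
    qed
  qed (use that params R1 in auto)
  then show ?thesis
    using that[OF D1(3)] J0 unfolding P_def by (meson less_le_trans)
qed

end

section \<open>Comparison of dimensions\<close>

lemma ereal_of_enat_covering_number_le_iff:
  "ereal_of_enat (covering_number r A) \<le> ereal k \<longleftrightarrow> covered r A k"
proof -
  let ?X = "{enat (card S) |S. finite S \<and> A \<subseteq> (\<Union>c\<in>S. ball c r)}"
  show ?thesis
  proof
    assume le: "ereal_of_enat (covering_number r A) \<le> ereal k"
    have "?X \<noteq> {}"
    proof
      assume "?X = {}"
      then have "covering_number r A = \<infinity>"
        unfolding covering_number_def by (simp only: Inf_enat_def refl if_True)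
      then show False using le by simp
    qed
    then have "Inf ?X \<in> ?X"
      unfolding Inf_enat_def by (auto intro: LeastI)
    then obtain S where "finite S" "A \<subseteq> (\<Union>c\<in>S. ball c r)" "covering_number r A = enat (card S)"
      unfolding covering_number_def by blast
    then show "covered r A k"
      using le unfolding covered_def by auto
  next
    assume "covered r A k"
    then obtain S where S: "finite S" "A \<subseteq> (\<Union>c\<in>S. ball c r)" "real (card S) \<le> k"
      unfolding covered_def by blast
    then have "covering_number r A \<le> enat (card S)"
      unfolding covering_number_def by (intro Inf_lower) blast
    then have "ereal_of_enat (covering_number r A) \<le> ereal (real (card S))"
      by (metis ereal_of_enat_le_iff ereal_of_enat_simps(1))
    then show "ereal_of_enat (covering_number r A) \<le> ereal k"
      using S(3) by (meson dual_order.trans ereal_less_eq(3))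
  qed
qed

lemma assouad_dim_le:
  assumes "0 \<le> s" "0 \<le> C"
    and cov: "\<And>x r R. 0 < r \<Longrightarrow> r \<le> R \<Longrightarrow> covered r (E \<inter> ball x R) (C * (R / r) powr s)"
  shows "assouad_dim E \<le> ereal s"
proof -
  \<comment> \<open>C + 1 because the definition of the Assouad dimension asks for a strictly
    positive constant.\<close>
  have "covered r (E \<inter> ball x R) ((C + 1) * (R / r) powr s)" if "0 < r" "r < R" for x r R
    using cov[of r R x] that by (rule_tac covered_mono) (auto simp: distrib_right)
  then show ?thesis
    unfolding assouad_dim_def ereal_of_enat_covering_number_le_iff using assms(1,2)
    by (intro INF_lower) (auto intro!: exI[of _ "C + 1"])
qed

abbreviation "disc_area \<equiv> unit_ball_vol 2"

lemma disc_area_pos: "0 < disc_area"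
  by (rule unit_ball_vol_pos) simp

lemma emeasure_disc: "0 \<le> r \<Longrightarrow> emeasure lborel (ball (c :: complex) r) = ennreal (disc_area * r\<^sup>2)"
  by (simp add: emeasure_ball)

lemma open_infdist_less: "open {z :: complex. infdist z E < t}"
  by (intro open_Collect_less continuous_intros)

text \<open>A single ball of fixed radius R contains E, so a multiple of (R/t)^s balls of radius t
  cover it; with doubled radii they cover the t-neighbourhood, whose area is thus of order
  t^(2-s).\<close>

lemma upper_minkowski_dim_le_assouad_dim:
  assumes "bounded E" "E \<noteq> {}"
  shows "upper_minkowski_dim E \<le> assouad_dim E"
  unfolding assouad_dim_def
proof (rule INF_greatest)
  fix s assume "s \<in> {s. 0 \<le> s \<and> (\<exists>C>0. \<forall>x\<in>E. \<forall>r R. 0 < r \<and> r < R \<longrightarrow>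
           ereal_of_enat (covering_number r (E \<inter> ball x R)) \<le> ereal (C * (R / r) powr s))}"
  then obtain C where s: "0 \<le> s" "0 < C"
    and cov: "\<And>x r R. x \<in> E \<Longrightarrow> 0 < r \<Longrightarrow> r < R \<Longrightarrow> covered r (E \<inter> ball x R) (C * (R / r) powr s)"
    unfolding ereal_of_enat_covering_number_le_iff by blast
  obtain x where x: "x \<in> E" using assms(2) by blast
  obtain R where R: "0 < R" "E \<subseteq> ball x R"
    using bounded_subset_ballD[OF assms(1)] by blast
  let ?B = "4 * C * R powr s * disc_area"
  have "emeasure lborel {z. infdist z E < t} / ennreal (t powr (2 - s)) \<le> ennreal ?B"
    if t: "0 < t" "t < R" for t
  proof -
    have "covered t E (C * (R / t) powr s)"
      using cov[OF x t] R(2) by (simp add: Int_absorb2)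
    then obtain S where S: "finite S" "E \<subseteq> (\<Union>c\<in>S. ball c t)" "real (card S) \<le> C * (R / t) powr s"
      unfolding covered_def by blast
    have "{z. infdist z E < t} \<subseteq> (\<Union>c\<in>S. ball c (2 * t))"
    proof
      fix z assume "z \<in> {z. infdist z E < t}"
      then obtain y where y: "y \<in> E" "dist z y < t"
        using assms(2) by (metis infdist_attains_inf infdist_notempty cINF_less_iff bdd_below_image_dist mem_Collect_eq)
      then obtain c where "c \<in> S" "dist c y < t" using S(2) by auto
      then show "z \<in> (\<Union>c\<in>S. ball c (2 * t))"
        using y(2) dist_triangle[of c z y] by (force simp: dist_commute)
    qed
    then have "emeasure lborel {z. infdist z E < t} \<le> emeasure lborel (\<Union>c\<in>S. ball c (2 * t))"
      by (intro emeasure_mono) (simp_all add: borel_open open_UN)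
    also have "\<dots> \<le> (\<Sum>c\<in>S. emeasure lborel (ball c (2 * t)))"
      using S(1) by (intro emeasure_subadditive_finite) auto
    also have "\<dots> = ennreal (real (card S) * (disc_area * (2 * t)\<^sup>2))"
      using t disc_area_pos by (simp add: emeasure_disc ennreal_of_nat_eq_real_of_nat ennreal_mult)
    also have "\<dots> \<le> ennreal ((C * (R / t) powr s) * (disc_area * (2 * t)\<^sup>2))"
      using S(3) disc_area_pos by (intro ennreal_leI mult_right_mono) auto
    also have "(C * (R / t) powr s) * (disc_area * (2 * t)\<^sup>2) = ?B * t powr (2 - s)"
      using t R by (simp add: powr_divide powr_diff power2_eq_square powr_numeral)
    finally have "emeasure lborel {z. infdist z E < t} \<le> ennreal ?B * ennreal (t powr (2 - s))"
      using s disc_area_pos by (simp add: ennreal_mult)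
    then show ?thesis
      using t by (intro divide_le_posI_ennreal) (auto simp: mult.commute)
  qed
  then have "eventually (\<lambda>t. emeasure lborel {z. infdist z E < t} / ennreal (t powr (2 - s)) \<le> ennreal ?B)
      (at_right 0)"
    unfolding eventually_at_right_field using R(1) by blast
  then have "Limsup (at_right 0) (\<lambda>t. emeasure lborel {z. infdist z E < t} / ennreal (t powr (2 - s))) \<le> ennreal ?B"
    by (rule Limsup_bounded)
  also have "\<dots> < \<infinity>" by simp
  finally show "upper_minkowski_dim E \<le> ereal s"
    unfolding upper_minkowski_dim_def using s by (intro INF_lower) auto
qed

text \<open>Take a largest t-separated subset of E. Balls of radius t/2 about its points are
  disjoint and lie in the neighbourhood, which bounds its size; balls of radius t cover E by
  maximality.\<close>

lemma covered_if_neighbourhood_measure_le: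
  assumes t: "0 < t" and b: "0 \<le> b" and le: "emeasure lborel {z. infdist z E < t} \<le> ennreal b"
  shows "covered t E (b / (disc_area * (t / 2)\<^sup>2))"
proof -
  let ?sep = "\<lambda>S. finite S \<and> S \<subseteq> E \<and> pairwise (\<lambda>x y. t \<le> dist x y) S"
  let ?k = "b / (disc_area * (t / 2)\<^sup>2)"
  have bound: "real (card S) \<le> ?k" if "?sep S" for S
  proof -
    have "disjoint_family_on (\<lambda>c. ball c (t / 2)) S"
      unfolding disjoint_family_on_def
    proof (intro ballI impI)
      fix x y assume "x \<in> S" "y \<in> S" "x \<noteq> y"
      then have "t \<le> dist x y" using that by (auto simp: pairwise_def)
      then show "ball x (t / 2) \<inter> ball y (t / 2) = {}"
        by (intro disjoint_ballI) simp
    qed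
    then have "(\<Sum>c\<in>S. emeasure lborel (ball c (t / 2))) = emeasure lborel (\<Union>c\<in>S. ball c (t / 2))"
      using that by (intro sum_emeasure) auto
    also have "\<dots> \<le> emeasure lborel {z. infdist z E < t}"
    proof (rule emeasure_mono)
      show "(\<Union>c\<in>S. ball c (t / 2)) \<subseteq> {z. infdist z E < t}"
      proof safe
        fix c z assume "c \<in> S" "z \<in> ball c (t / 2)"
        then show "infdist z E < t"
          using infdist_le[of c E z] that t by (auto simp: dist_commute)
      qed
    qed (use open_infdist_less in auto)
    also note le
    finally have "ennreal (real (card S) * (disc_area * (t / 2)\<^sup>2)) \<le> ennreal b"
      using t disc_area_pos by (simp add: emeasure_disc ennreal_of_nat_eq_real_of_nat ennreal_mult)
    then have "real (card S) * (disc_area * (t / 2)\<^sup>2) \<le> b"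
      using b by simp
    moreover have "0 < disc_area * (t / 2)\<^sup>2"
      using t disc_area_pos by simp
    ultimately show ?thesis by (simp only: pos_le_divide_eq)
  qed
  have "?sep {}" by simp
  moreover have "\<forall>S. ?sep S \<longrightarrow> card S < Suc (nat \<lceil>?k\<rceil>)"
  proof (intro allI impI)
    fix S assume "?sep S"
    from order_trans[OF bound[OF this] real_nat_ceiling_ge] show "card S < Suc (nat \<lceil>?k\<rceil>)"
      by (simp only: of_nat_le_iff less_Suc_eq_le)
  qed
  ultimately have "\<exists>S. ?sep S \<and> (\<forall>T. ?sep T \<longrightarrow> card T \<le> card S)"
    by (rule Lattices_Big.ex_has_greatest_nat[of ?sep "{}" card])
  then obtain S where S: "?sep S" "\<And>T. ?sep T \<Longrightarrow> card T \<le> card S"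
    by (elim exE conjE) simp
  have "E \<subseteq> (\<Union>c\<in>S. ball c t)"
  proof (rule ccontr)
    assume "\<not> ?thesis"
    then obtain x where x: "x \<in> E" "x \<notin> (\<Union>c\<in>S. ball c t)"
      by blast
    then have far: "t \<le> dist c x" if "c \<in> S" for c
      using that by (meson UN_I mem_ball not_le)
    have "x \<notin> S" using t x by auto
    moreover have "?sep (insert x S)"
      using S(1) x(1) far by (auto simp: pairwise_insert dist_commute)
    ultimately show False
      using S(2)[of "insert x S"] S(1) by simp
  qed
  then show ?thesis
    unfolding covered_def using S(1) bound by blast
qed

lemma hausdorff_premeasure_le_covered:
  assumes s: "0 < s" and t: "0 < t" "2 * t \<le> \<epsilon>" and cov: "covered t E k"
  shows "hausdorff_premeasure s \<epsilon> E \<le> ennreal (k * (2 * t) powr s)"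
proof -
  obtain S where S: "finite S" "E \<subseteq> (\<Union>c\<in>S. ball c t)" "real (card S) \<le> k"
    using cov unfolding covered_def by blast
  obtain xs where xs: "set xs = S" "distinct xs"
    using finite_distinct_list[OF S(1)] by blast
  \<comment> \<open>The finite cover is padded to a sequence by empty sets, whose
    \<open>diam_power\<close> is 0 for every exponent.\<close>
  define U where "U i = (if i < length xs then ball (xs ! i) t else {})" for i
  have "(\<Sum>i. diam_power s (U i)) = (\<Sum>i<length xs. diam_power s (U i))"
    by (rule suminf_finite) (auto simp: U_def diam_power_def)
  also have "\<dots> \<le> (\<Sum>i<length xs. ennreal ((2 * t) powr s))"
    using s t by (intro sum_mono) (auto simp: U_def diam_power_def)
  also have "\<dots> = ennreal (real (length xs) * (2 * t) powr s)"
    by (simp add: ennreal_of_nat_eq_real_of_nat ennreal_mult)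
  also have "\<dots> \<le> ennreal (k * (2 * t) powr s)"
    using S(3) xs distinct_card[OF xs(2)] by (intro ennreal_leI mult_right_mono) auto
  finally have sum: "(\<Sum>i. diam_power s (U i)) \<le> ennreal (k * (2 * t) powr s)" .
  have "E \<subseteq> (\<Union>i. U i)"
  proof
    fix x assume "x \<in> E"
    then obtain c where "c \<in> set xs" "x \<in> ball c t" using S(2) xs(1) by blast
    then obtain i where "i < length xs" "x \<in> ball (xs ! i) t" by (metis in_set_conv_nth)
    then show "x \<in> (\<Union>i. U i)" by (auto simp: U_def)
  qed
  moreover have "bounded (U i) \<and> diameter (U i) \<le> \<epsilon>" for i
    using t by (auto simp: U_def)
  ultimately have "hausdorff_premeasure s \<epsilon> E \<le> (\<Sum>i. diam_power s (U i))"
    unfolding hausdorff_premeasure_def by (intro Inf_lower) auto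
  then show ?thesis using sum by (rule order_trans)
qed

text \<open>A finite limsup at exponent s only bounds the premeasures at s. Measure zero, which the
  Hausdorff dimension asks for, is reached at s + e: covers by order t^-s balls of radius t then
  cost a multiple of t^e.\<close>

lemma hausdorff_dim_le_upper_minkowski_dim: "hausdorff_dim E \<le> upper_minkowski_dim E"
  unfolding upper_minkowski_dim_def
proof (rule INF_greatest)
  fix s assume "s \<in> {s. 0 \<le> s \<and> Limsup (at_right 0)
      (\<lambda>t. emeasure lborel {z. infdist z E < t} / ennreal (t powr (2 - s))) < \<infinity>}"
  then have s: "0 \<le> s" and lim: "Limsup (at_right 0)
      (\<lambda>t. emeasure lborel {z. infdist z E < t} / ennreal (t powr (2 - s))) < \<infinity>"
    by auto
  obtain n :: nat where "Limsup (at_right 0)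
      (\<lambda>t. emeasure lborel {z. infdist z E < t} / ennreal (t powr (2 - s))) < of_nat n"
    using ennreal_Ex_less_of_nat[of "Limsup _ _"] lim by (auto simp: top.not_eq_extremum)
  from Limsup_lessD[OF this] obtain t0 where t0: "0 < t0"
    "\<And>t. 0 < t \<Longrightarrow> t < t0 \<Longrightarrow> emeasure lborel {z. infdist z E < t} / ennreal (t powr (2 - s)) < of_nat n"
    unfolding eventually_at_right_field by blast
  define B where "B = 4 * real n / disc_area"
  have B: "0 \<le> B" using disc_area_pos by (simp add: B_def)
  have cov: "covered t E (B * t powr - s)" if t: "0 < t" "t < t0" for t
  proof -
    have "emeasure lborel {z. infdist z E < t} \<le> of_nat n * ennreal (t powr (2 - s))"
      using t0(2)[OF t] t by (subst (asm) divide_less_ennreal) auto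
    also have "\<dots> = ennreal (real n * t powr (2 - s))"
      by (simp add: ennreal_of_nat_eq_real_of_nat ennreal_mult)
    finally have "covered t E (real n * t powr (2 - s) / (disc_area * (t / 2)\<^sup>2))"
      using t by (intro covered_if_neighbourhood_measure_le) auto
    moreover have "real n * t powr (2 - s) / (disc_area * (t / 2)\<^sup>2) = B * t powr - s"
      using t by (simp add: B_def powr_diff powr_minus_divide power2_eq_square powr_numeral mult.commute)
    ultimately show ?thesis by simp
  qed
  show "hausdorff_dim E \<le> ereal s"
  proof (rule ereal_le_epsilon2)
    fix e :: real assume e: "0 < e"
    have "hausdorff_premeasure (s + e) \<epsilon> E = 0" if \<epsilon>: "0 < \<epsilon>" for \<epsilon>
    proof -
      have "hausdorff_premeasure (s + e) \<epsilon> E \<le> ennreal (B * 2 powr (s + e) * t powr e)"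
        if t: "0 < t" "t < min t0 (\<epsilon> / 2)" for t
      proof -
        have "hausdorff_premeasure (s + e) \<epsilon> E \<le> ennreal ((B * t powr - s) * (2 * t) powr (s + e))"
          using cov t s e by (intro hausdorff_premeasure_le_covered) auto
        also have "(B * t powr - s) * (2 * t) powr (s + e) = B * 2 powr (s + e) * t powr e"
          using t by (simp add: powr_mult powr_add powr_minus_divide)
        finally show ?thesis .
      qed
      then have "eventually (\<lambda>t. hausdorff_premeasure (s + e) \<epsilon> E \<le> ennreal (B * 2 powr (s + e) * t powr e)) (at_right 0)"
        unfolding eventually_at_right_field using t0(1) \<epsilon> by (intro exI[of _ "min t0 (\<epsilon> / 2)"]) auto
      moreover have "((\<lambda>t. ennreal (B * 2 powr (s + e) * t powr e)) \<longlongrightarrow> ennreal (B * 2 powr (s + e) * 0 powr e)) (at_right 0)"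
        using e by (intro tendsto_intros tendsto_ennrealI tendsto_powr2) (auto simp: eventually_at_right_less less_imp_le intro!: eventually_mono[OF eventually_at_right_less])
      ultimately have "hausdorff_premeasure (s + e) \<epsilon> E \<le> ennreal (B * 2 powr (s + e) * 0 powr e)"
        by (intro tendsto_lowerbound[where F = "at_right (0::real)"]) auto
      then show ?thesis using e by simp
    qed
    then have "hausdorff_measure (s + e) E = 0"
      unfolding hausdorff_measure_def by (simp add: SUP_constant)
    then show "hausdorff_dim E \<le> ereal s + ereal e"
      unfolding hausdorff_dim_def using s e by (intro INF_lower2[of "s + e"]) auto
  qed
qed

text \<open>A mass distribution argument. The inequality makes the inverse of \<gamma> Hoelder, so a
  covering set U pulls back to parameters of total length at most 2 C diam(U)^d, and these lengths
  add up to at least 1. For diameters at most 1 the exponent d may be lowered to s < d.\<close>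

lemma hausdorff_dim_ge:
  assumes d: "0 < d" and C: "0 < C"
    and sub: "\<And>t. 0 \<le> t \<Longrightarrow> t < 1 \<Longrightarrow> \<gamma> t \<in> E"
    and holder: "\<And>s t. 0 \<le> s \<Longrightarrow> s < 1 \<Longrightarrow> 0 \<le> t \<Longrightarrow> t < 1 \<Longrightarrow> \<bar>s - t\<bar> \<le> C * dist (\<gamma> s) (\<gamma> t) powr d"
  shows "ereal d \<le> hausdorff_dim E"
  unfolding hausdorff_dim_def
proof (rule INF_greatest)
  fix s assume s: "s \<in> {s. 0 \<le> s \<and> hausdorff_measure s E = 0}"
  show "ereal d \<le> ereal s"
  proof (rule ccontr)
    assume "\<not> ?thesis"
    then have sd: "s < d" by simp
    have "1 \<le> ennreal (2 * C) * (\<Sum>i. diam_power s (U i))"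
      if U: "E \<subseteq> (\<Union>i. U i)" "\<And>i. bounded (U i) \<and> diameter (U i) \<le> 1" for U :: "nat \<Rightarrow> complex set"
    proof -
      define V where "V i = {t \<in> {0..<1}. \<gamma> t \<in> U i}" for i
      \<comment> \<open>The parameter sets \<open>V i\<close> may fail to be measurable; each is
        enclosed in a closed interval about one of its own points.\<close>
      define I where "I i = (if V i = {} then {} else
        cball (SOME t. t \<in> V i) (C * diameter (U i) powr d))" for i
      have VI: "V i \<subseteq> I i" for i
      proof
        fix t assume t: "t \<in> V i"
        then have ne: "V i \<noteq> {}" by blast
        define s where "s = (SOME t. t \<in> V i)"
        have sV: "s \<in> V i" using t by (auto simp: s_def intro: someI)
        have "\<bar>s - t\<bar> \<le> C * dist (\<gamma> s) (\<gamma> t) powr d"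
          using sV t by (intro holder) (auto simp: V_def)
        also have "\<dots> \<le> C * diameter (U i) powr d"
          using sV t C d U(2)[of i]
          by (intro mult_left_mono powr_mono2 diameter_bounded_bound) (auto simp: V_def)
        finally show "t \<in> I i"
          using ne by (simp add: I_def dist_real_def flip: s_def)
      qed
      have measI: "emeasure lborel (I i) \<le> ennreal (2 * C) * diam_power s (U i)" for i
      proof (cases "V i = {}")
        case False
        then have ne: "U i \<noteq> {}" by (auto simp: V_def)
        have diam: "0 \<le> diameter (U i)" "diameter (U i) \<le> 1"
          using U(2)[of i] diameter_ge_0 by auto
        have "emeasure lborel (I i) = ennreal (2 * C) * ennreal (diameter (U i) powr d)"
          using False C by (simp add: I_def cball_eq_atLeastAtMost flip: ennreal_mult)
        also have "\<dots> \<le> ennreal (2 * C) * diam_power s (U i)"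
        proof (rule mult_left_mono)
          show "ennreal (diameter (U i) powr d) \<le> diam_power s (U i)"
            using ne diam sd d powr_mono'[of s d "diameter (U i)"] powr_le1[of d "diameter (U i)"]
            by (auto simp: diam_power_def intro!: ennreal_leI)
        qed simp
        finally show ?thesis .
      qed (simp add: I_def)
      have "{0..<1} \<subseteq> (\<Union>i. I i)"
      proof
        fix t :: real assume "t \<in> {0..<1}"
        then obtain i where "\<gamma> t \<in> U i" using sub[of t] U(1) by auto
        then have "t \<in> V i" using \<open>t \<in> {0..<1}\<close> by (simp add: V_def)
        then show "t \<in> (\<Union>i. I i)" using VI by blast
      qed
      then have "emeasure lborel {0..<1::real} \<le> emeasure lborel (\<Union>i. I i)"
        by (intro emeasure_mono) (auto simp: I_def)
      also have "\<dots> \<le> (\<Sum>i. emeasure lborel (I i))"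
        by (intro emeasure_subadditive_countably) (auto simp: I_def)
      also have "\<dots> \<le> (\<Sum>i. ennreal (2 * C) * diam_power s (U i))"
        using measI by (intro suminf_le) auto
      finally show ?thesis by simp
    qed
    then have "ennreal (1 / (2 * C)) \<le> hausdorff_premeasure s 1 E"
      unfolding hausdorff_premeasure_def
    proof (intro Inf_greatest, safe)
      fix U :: "nat \<Rightarrow> complex set"
      assume *: "\<And>U :: nat \<Rightarrow> complex set. E \<subseteq> (\<Union>i. U i) \<Longrightarrow> (\<And>i. bounded (U i) \<and> diameter (U i) \<le> 1) \<Longrightarrow>
          1 \<le> ennreal (2 * C) * (\<Sum>i. diam_power s (U i))"
        and U: "E \<subseteq> (\<Union>i. U i)" "\<forall>i. bounded (U i) \<and> diameter (U i) \<le> 1"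
      have "ennreal (1 / (2 * C)) * 1 \<le> ennreal (1 / (2 * C)) * (ennreal (2 * C) * (\<Sum>i. diam_power s (U i)))"
        using *[OF U(1)] U(2) by (intro mult_left_mono) auto
      also have "\<dots> = ennreal (1 / (2 * C) * (2 * C)) * (\<Sum>i. diam_power s (U i))"
        using C by (simp add: mult.assoc[symmetric] flip: ennreal_mult)
      also have "\<dots> = (\<Sum>i. diam_power s (U i))"
        using C by simp
      finally show "ennreal (1 / (2 * C)) \<le> (\<Sum>i. diam_power s (U i))" by simp
    qed
    also have "\<dots> \<le> hausdorff_measure s E"
      unfolding hausdorff_measure_def by (intro SUP_upper) auto
    finally show False using s C by simp
  qed
qed

section \<open>Points of the Cantor sets\<close>

text \<open>The coding map of the self-similar Cantor set: the point with address c under the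
  contractions w -> p + \<rho> w, p a corner.\<close>

definition cod :: "real \<Rightarrow> (nat \<Rightarrow> complex) \<Rightarrow> complex" where
  "cod \<rho> c = (\<Sum>n. \<rho> ^ n *\<^sub>R c n)"

definition codes :: "(nat \<Rightarrow> complex) set" where
  "codes = {c. \<forall>n. c n \<in> corners}"

lemma codes_Suc: "c \<in> codes \<Longrightarrow> (\<lambda>n. c (Suc n)) \<in> codes"
  by (simp add: codes_def)

lemma codes_corner: "c \<in> codes \<Longrightarrow> c n \<in> corners"
  by (simp add: codes_def)

lemma norm_corner_le: "p \<in> corners \<Longrightarrow> norm p \<le> 1"
  using norm_le_maxn[of p] by (simp add: maxn_corner)

lemma cod_term_le:
  assumes "0 < \<rho>" "c \<in> codes"
  shows "norm (\<rho> ^ n *\<^sub>R c n) \<le> \<rho> ^ n"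
  using norm_corner_le[OF codes_corner[OF assms(2)], of n] assms(1)
  by (simp add: mult_left_le)

lemma summable_cod:
  assumes "0 < \<rho>" "\<rho> < 1" "c \<in> codes"
  shows "summable (\<lambda>n. \<rho> ^ n *\<^sub>R c n)"
  by (rule summable_comparison_test'[OF summable_geometric cod_term_le]) (use assms in auto)

lemma cod_unfold:
  assumes "0 < \<rho>" "\<rho> < 1" "c \<in> codes"
  shows "cod \<rho> c = c 0 + \<rho> *\<^sub>R cod \<rho> (\<lambda>n. c (Suc n))"
proof -
  have "cod \<rho> c = c 0 + (\<Sum>n. \<rho> *\<^sub>R (\<rho> ^ n *\<^sub>R c (Suc n)))"
    using suminf_split_head[OF summable_cod[OF assms]] by (simp add: cod_def)
  also have "(\<Sum>n. \<rho> *\<^sub>R (\<rho> ^ n *\<^sub>R c (Suc n))) = \<rho> *\<^sub>R cod \<rho> (\<lambda>n. c (Suc n))"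
    unfolding cod_def
    by (rule suminf_scaleR_right[symmetric, OF summable_cod[OF assms(1,2) codes_Suc[OF assms(3)]]])
  finally show ?thesis .
qed

lemma maxn_cod_le_1:
  assumes \<rho>: "0 < \<rho>" "\<rho> < 1/2" and c: "c \<in> codes"
  shows "maxn (cod \<rho> c) \<le> 1"
proof -
  have approx: "maxn (cod \<rho> c) \<le> 1 + \<rho> ^ n" if "c \<in> codes" for n c
    using that
  proof (induction n arbitrary: c)
    case 0
    have "norm (cod \<rho> c) \<le> (\<Sum>n. \<rho> ^ n)"
      unfolding cod_def using \<rho> by (intro norm_suminf_le cod_term_le[OF _ 0] summable_geometric) auto
    also have "\<dots> \<le> 2"
      using \<rho> by (simp add: suminf_geometric field_simps)
    finally show ?case
      using maxn_le_norm[of "cod \<rho> c"] by simp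
  next
    case (Suc n)
    have "maxn (cod \<rho> c) \<le> 1/2 + \<rho> * maxn (cod \<rho> (\<lambda>n. c (Suc n)))"
      using maxn_triangle[of "c 0" "\<rho> *\<^sub>R cod \<rho> (\<lambda>n. c (Suc n))"] \<rho>
        maxn_corner[OF codes_corner[OF Suc.prems]] cod_unfold[OF _ _ Suc.prems, of \<rho>] by simp
    also have "\<dots> \<le> 1/2 + \<rho> * (1 + \<rho> ^ n)"
      using Suc.IH[OF codes_Suc[OF Suc.prems]] \<rho> by simp
    also have "\<dots> \<le> 1 + \<rho> ^ Suc n"
      using \<rho> by (simp add: algebra_simps)
    finally show ?case .
  qed
  have "(\<lambda>n. 1 + \<rho> ^ n) \<longlonglongrightarrow> 1 + 0"
    using \<rho> by (intro tendsto_intros LIMSEQ_realpow_zero) auto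
  then show ?thesis
    using LIMSEQ_le_const[of "\<lambda>n. 1 + \<rho> ^ n" 1 "maxn (cod \<rho> c)"] approx[OF c] by auto
qed

text \<open>Stripping the common prefix leaves \<rho>^n times a difference of points in distinct
  corner squares. Both the separation of Cantor points and the graph property reduce to this
  first-letter case.\<close>

lemma cod_diff:
  assumes \<rho>: "0 < \<rho>" "\<rho> < 1" and "c \<in> codes" "c' \<in> codes"
    and "\<And>i. i < n \<Longrightarrow> c i = c' i" "c n \<noteq> c' n"
  shows "\<exists>p\<in>corners. \<exists>q\<in>corners. \<exists>b\<in>codes. \<exists>b'\<in>codes. p \<noteq> q \<and>
    cod \<rho> c - cod \<rho> c' = \<rho> ^ n *\<^sub>R ((p - q) + \<rho> *\<^sub>R (cod \<rho> b - cod \<rho> b'))"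
  using assms(3-)
proof (induction n arbitrary: c c')
  case 0
  have "cod \<rho> c - cod \<rho> c' = \<rho> ^ 0 *\<^sub>R ((c 0 - c' 0) +
      \<rho> *\<^sub>R (cod \<rho> (\<lambda>n. c (Suc n)) - cod \<rho> (\<lambda>n. c' (Suc n))))"
    unfolding cod_unfold[OF \<rho> 0(1)] cod_unfold[OF \<rho> 0(2)] by (simp add: algebra_simps)
  then show ?case
    using 0 codes_Suc codes_corner by blast
next
  case (Suc n)
  have "cod \<rho> c - cod \<rho> c' = \<rho> *\<^sub>R (cod \<rho> (\<lambda>n. c (Suc n)) - cod \<rho> (\<lambda>n. c' (Suc n)))"
    unfolding cod_unfold[OF \<rho> Suc.prems(1)] cod_unfold[OF \<rho> Suc.prems(2)]
    using Suc.prems(3)[of 0] by (simp add: algebra_simps)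
  moreover obtain p q b b' where h: "p \<in> corners" "q \<in> corners" "b \<in> codes" "b' \<in> codes" "p \<noteq> q"
    "cod \<rho> (\<lambda>n. c (Suc n)) - cod \<rho> (\<lambda>n. c' (Suc n)) = \<rho> ^ n *\<^sub>R ((p - q) + \<rho> *\<^sub>R (cod \<rho> b - cod \<rho> b'))"
    using Suc.IH[of "\<lambda>n. c (Suc n)" "\<lambda>n. c' (Suc n)"] Suc.prems codes_Suc by (metis Suc_mono)
  ultimately have "cod \<rho> c - cod \<rho> c' = \<rho> ^ Suc n *\<^sub>R ((p - q) + \<rho> *\<^sub>R (cod \<rho> b - cod \<rho> b'))"
    by simp
  then show ?case
    using h(1-5) by blast
qed

text \<open>Here 1 - 2 \<rho> is the gap between corner squares: their centres are 1 apart and their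
  radius is \<rho>.\<close>

lemma cod_separated:
  assumes \<rho>: "0 < \<rho>" "\<rho> < 1/2" and "c \<in> codes" "c' \<in> codes"
    and "\<And>i. i < n \<Longrightarrow> c i = c' i" "c n \<noteq> c' n"
  shows "\<rho> ^ n * (1 - 2 * \<rho>) \<le> dist (cod \<rho> c) (cod \<rho> c')"
proof -
  obtain p q b b' where h: "p \<in> corners" "q \<in> corners" "b \<in> codes" "b' \<in> codes" "p \<noteq> q"
    and eq: "cod \<rho> c - cod \<rho> c' = \<rho> ^ n *\<^sub>R ((p - q) + \<rho> *\<^sub>R (cod \<rho> b - cod \<rho> b'))"
    using cod_diff[OF _ _ assms(3-6)] \<rho> by force
  have "maxn (cod \<rho> b - cod \<rho> b') \<le> 2"
    using maxn_triangle_diff[of "cod \<rho> b" "cod \<rho> b'"] maxn_cod_le_1[OF \<rho> h(3)] maxn_cod_le_1[OF \<rho> h(4)]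
    by linarith
  then have "maxn (\<rho> *\<^sub>R (cod \<rho> b - cod \<rho> b')) \<le> \<rho> * 2"
    unfolding maxn_scaleR using \<rho> by (intro mult_mono) auto
  then have "1 - 2 * \<rho> \<le> maxn ((p - q) + \<rho> *\<^sub>R (cod \<rho> b - cod \<rho> b'))"
    using maxn_diff_ge[of "p - q" "- (\<rho> *\<^sub>R (cod \<rho> b - cod \<rho> b'))"] maxn_corners_diff[OF h(1,2,5)] by simp
  then have "\<rho> ^ n * (1 - 2 * \<rho>) \<le> maxn (cod \<rho> c - cod \<rho> c')"
    unfolding eq maxn_scaleR using \<rho> by (simp add: mult_left_mono)
  then show ?thesis
    unfolding dist_norm using maxn_le_norm order_trans by blast
qed

context cantor_rescaling begin

text \<open>The functional equation removes the first letter of the address on both sides and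
  shrinks the discrepancy by \<nu>, so it is 0.\<close>

lemma cmap_cod:
  assumes "c \<in> codes"
  shows "F (cod \<mu> c) = cod \<nu> c"
proof -
  have \<mu>: "0 < \<mu>" "\<mu> < 1/2" and \<nu>: "0 < \<nu>" "\<nu> < 1/2" using params by auto
  have approx: "maxn (F (cod \<mu> c) - cod \<nu> c) \<le> 2 * \<nu> ^ n" if "c \<in> codes" for n c
    using that
  proof (induction n arbitrary: c)
    case 0
    then show ?case
      using maxn_triangle_diff[of "F (cod \<mu> c)" "cod \<nu> c"] maxn_cod_le_1[OF \<nu> 0]
        cmap_bounded[OF maxn_cod_le_1[OF \<mu> 0]] by simp
  next
    case (Suc n)
    define b where "b = (\<lambda>n. c (Suc n))"
    have b: "b \<in> codes" using codes_Suc[OF Suc.prems] by (simp add: b_def)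
    have "F (cod \<mu> c) - cod \<nu> c = \<nu> *\<^sub>R (F (cod \<mu> b) - cod \<nu> b)"
      using cod_unfold[OF _ _ Suc.prems, of \<mu>] cod_unfold[OF _ _ Suc.prems, of \<nu>] \<mu> \<nu>
        cmap_near[OF codes_corner[OF Suc.prems] maxn_cod_le_1[OF \<mu> b]]
      by (simp add: b_def[symmetric] scaleR_diff_right)
    then show ?case
      using Suc.IH[OF b] \<nu> by simp
  qed
  have "(\<lambda>n. 2 * \<nu> ^ n) \<longlonglongrightarrow> 2 * 0"
    using \<nu> by (intro tendsto_intros LIMSEQ_realpow_zero) auto
  then have "maxn (F (cod \<mu> c) - cod \<nu> c) \<le> 0"
    using LIMSEQ_le_const[of "\<lambda>n. 2 * \<nu> ^ n" 0] approx[OF assms] by auto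
  then show ?thesis
    using maxn_nonneg[of "F (cod \<mu> c) - cod \<nu> c"] maxn_eq_0_iff by (metis antisym eq_iff_diff_eq_0)
qed

end

section \<open>Base-4 digits as addresses\<close>

definition corner_of :: "int \<Rightarrow> complex" where
  "corner_of k = Complex (if k < 2 then -1/2 else 1/2) (if even k then -1/2 else 1/2)"

text \<open>Index 0 is the first digit after the point. Digits as addresses send [0, 1) into the
  Cantor set, and the first n digits fix a parameter interval of length 4^-n.\<close>

definition base4 :: "real \<Rightarrow> nat \<Rightarrow> complex" where
  "base4 t n = corner_of (\<lfloor>4 ^ Suc n * t\<rfloor> mod 4)"

lemma base4_codes: "base4 t \<in> codes"
  by (simp add: codes_def base4_def corner_of_def corners_def)

lemma corner_of_inj: "corner_of (a mod 4) = corner_of (b mod 4) \<Longrightarrow> a mod 4 = b mod 4"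
  unfolding corner_of_def by (auto split: if_splits; presburger)

lemma base4_floor:
  assumes "0 \<le> s" "s < 1" "0 \<le> t" "t < 1" "\<And>i. i < n \<Longrightarrow> base4 s i = base4 t i"
  shows "\<lfloor>4 ^ n * s\<rfloor> = \<lfloor>4 ^ n * t\<rfloor>"
  using assms(5)
proof (induction n)
  case 0
  have "\<lfloor>s\<rfloor> = 0" "\<lfloor>t\<rfloor> = 0" using assms(1-4) by (simp_all add: floor_eq_iff)
  then show ?case by simp
next
  case (Suc n)
  have div4: "\<lfloor>4 ^ Suc n * x\<rfloor> div 4 = \<lfloor>4 ^ n * x\<rfloor>" for x :: real
    using floor_divide_real_eq_div[of 4 "4 ^ Suc n * x"] by simp
  have "\<lfloor>4 ^ Suc n * s\<rfloor> mod 4 = \<lfloor>4 ^ Suc n * t\<rfloor> mod 4"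
    using Suc.prems[of n] unfolding base4_def by (intro corner_of_inj) simp
  moreover have "\<lfloor>4 ^ Suc n * s\<rfloor> div 4 = \<lfloor>4 ^ Suc n * t\<rfloor> div 4"
    unfolding div4 using Suc by simp
  ultimately show ?case
    by (metis div_mult_mod_eq)
qed

lemma base4_dist:
  assumes "0 \<le> s" "s < 1" "0 \<le> t" "t < 1" "\<And>i. i < n \<Longrightarrow> base4 s i = base4 t i"
  shows "\<bar>s - t\<bar> \<le> (1/4) ^ n"
proof -
  have "\<bar>4 ^ n * s - 4 ^ n * t\<bar> \<le> 1"
  proof -
    have "\<lfloor>4 ^ n * s\<rfloor> = \<lfloor>4 ^ n * t\<rfloor>"
      by (rule base4_floor[OF assms])
    then show ?thesis by linarith
  qed
  then have "4 ^ n * \<bar>s - t\<bar> \<le> 1"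
    by (simp add: abs_mult flip: right_diff_distrib)
  then show ?thesis by (simp add: field_simps)
qed

text \<open>If the digits first differ at n, the parameters are within 4^-n = (\<nu>^n)^d, while the
  points are at least \<nu>^n (1 - 2 \<nu>) apart. If no digit differs, the parameters
  coincide.\<close>

lemma cod_base4_holder:
  assumes \<nu>: "0 < \<nu>" "\<nu> < 1/2" "\<nu> powr d = 1/4" and d: "0 < d"
    and st: "0 \<le> s" "s < 1" "0 \<le> t" "t < 1"
  shows "\<bar>s - t\<bar> \<le> (1 / (1 - 2 * \<nu>)) powr d * dist (cod \<nu> (base4 s)) (cod \<nu> (base4 t)) powr d"
proof (cases "base4 s = base4 t")
  case True
  have "(\<lambda>n. (1/4) ^ n :: real) \<longlonglongrightarrow> 0"
    by (intro LIMSEQ_realpow_zero) auto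
  then have "\<bar>s - t\<bar> \<le> 0"
  proof (rule LIMSEQ_le_const)
    show "\<exists>N. \<forall>n\<ge>N. \<bar>s - t\<bar> \<le> (1/4) ^ n"
      using base4_dist[OF st] True by metis
  qed
  then show ?thesis using True by simp
next
  case False
  define n where "n = (LEAST n. base4 s n \<noteq> base4 t n)"
  have "\<exists>n. base4 s n \<noteq> base4 t n"
    using False ext[of "base4 s" "base4 t"] by blast
  then have n: "base4 s n \<noteq> base4 t n"
    unfolding n_def by (rule LeastI_ex)
  have less: "base4 s i = base4 t i" if "i < n" for i
    using not_less_Least[of i "\<lambda>n. base4 s n \<noteq> base4 t n"] that by (simp add: n_def)
  have "\<nu> ^ n * (1 - 2 * \<nu>) \<le> dist (cod \<nu> (base4 s)) (cod \<nu> (base4 t))"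
    by (intro cod_separated[OF \<nu>(1,2) base4_codes base4_codes less n])
  then have le: "\<nu> ^ n \<le> 1 / (1 - 2 * \<nu>) * dist (cod \<nu> (base4 s)) (cod \<nu> (base4 t))"
    using \<nu> by (simp add: field_simps)
  have "\<bar>s - t\<bar> \<le> (\<nu> powr d) ^ n"
    unfolding \<nu>(3) by (rule base4_dist[OF st less])
  also have "\<dots> = (\<nu> ^ n) powr d"
    using \<nu> by (simp add: powr_realpow[symmetric] powr_powr mult.commute)
  also have "\<dots> \<le> (1 / (1 - 2 * \<nu>) * dist (cod \<nu> (base4 s)) (cod \<nu> (base4 t))) powr d"
    using le \<nu> d by (intro powr_mono2) auto
  also have "\<dots> = (1 / (1 - 2 * \<nu>)) powr d * dist (cod \<nu> (base4 s)) (cod \<nu> (base4 t)) powr d"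
    using \<nu> by (intro powr_mult)
  finally show ?thesis .
qed

section \<open>A bilipschitz circle through the sparse Cantor set\<close>

text \<open>The McShane extension. The data are indexed by an arbitrary set so that addresses can
  index them directly.\<close>

lemma lipschitz_interpolation:
  fixes x y :: "'a \<Rightarrow> real"
  assumes ne: "I \<noteq> {}" and L: "0 \<le> L"
    and lip: "\<And>i j. i \<in> I \<Longrightarrow> j \<in> I \<Longrightarrow> \<bar>y i - y j\<bar> \<le> L * \<bar>x i - x j\<bar>"
  obtains k :: "real \<Rightarrow> real" where "\<And>s t. \<bar>k s - k t\<bar> \<le> L * \<bar>s - t\<bar>" "\<And>i. i \<in> I \<Longrightarrow> k (x i) = y i"
proof -
  define k where "k s = (INF i\<in>I. y i + L * \<bar>s - x i\<bar>)" for s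
  obtain i0 where i0: "i0 \<in> I" using ne by blast
  have tri: "L * \<bar>a - b\<bar> \<le> L * \<bar>a - c\<bar> + L * \<bar>c - b\<bar>" for a b c :: real
    using mult_left_mono[OF abs_triangle_ineq[of "a - c" "c - b"] L] by (simp add: distrib_left)
  have bdd: "bdd_below ((\<lambda>i. y i + L * \<bar>s - x i\<bar>) ` I)" for s
  proof (rule bdd_belowI2)
    fix i assume "i \<in> I"
    then show "y i0 - L * \<bar>x i0 - s\<bar> \<le> y i + L * \<bar>s - x i\<bar>"
      using lip[OF i0, of i] tri[of "x i0" "x i" s] by (simp add: abs_le_iff)
  qed
  have le: "k s \<le> k t + L * \<bar>s - t\<bar>" for s t
  proof -
    have "k s - L * \<bar>s - t\<bar> \<le> k t"
      unfolding k_def[of t]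
    proof (rule cINF_greatest[OF ne])
      fix i assume "i \<in> I"
      then have "k s \<le> y i + L * \<bar>s - x i\<bar>"
        unfolding k_def by (intro cINF_lower bdd)
      then show "k s - L * \<bar>s - t\<bar> \<le> y i + L * \<bar>t - x i\<bar>"
        using tri[of s "x i" t] by simp
    qed
    then show ?thesis by simp
  qed
  have "\<bar>k s - k t\<bar> \<le> L * \<bar>s - t\<bar>" for s t
    using le[of s t] le[of t s] by (simp add: abs_minus_commute)
  moreover have "k (x i) = y i" if "i \<in> I" for i
  proof (rule antisym)
    show "k (x i) \<le> y i"
      unfolding k_def using that by (intro cINF_lower2[OF bdd that]) simp
    show "y i \<le> k (x i)"
      unfolding k_def using lip[OF that] by (intro cINF_greatest[OF ne]) (force simp: abs_le_iff)
  qed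
  ultimately show ?thesis using that by blast
qed

text \<open>For comparing arcs with chords. Up to pi/3 the derivative is at least 1/2 because of the
  cosine; beyond that, sin x \<ge> 1/2 and x/4 < 1/2.\<close>

lemma sin_ge_quarter:
  assumes "0 \<le> x" "x \<le> pi / 2"
  shows "x / 4 \<le> sin x"
proof (cases "x \<le> pi / 3")
  case True
  have "sin 0 - 0 / 4 \<le> sin x - x / 4"
  proof (rule DERIV_nonneg_imp_nondecreasing[OF assms(1)])
    fix t assume t: "0 \<le> t" "t \<le> x"
    have "cos (pi / 3) \<le> cos t"
      using t True by (intro cos_monotone_0_pi_le) auto
    then have "0 \<le> cos t - 1 / 4" by (simp add: cos_60)
    then show "\<exists>y. ((\<lambda>x. sin x - x / 4) has_real_derivative y) (at t) \<and> 0 \<le> y"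
      by (intro exI[of _ "cos t - 1 / 4"]) (auto intro!: derivative_eq_intros)
  qed
  then show ?thesis by simp
next
  case False
  have "sin (pi / 6) \<le> sin x"
    using False assms by (intro sin_monotone_2pi_le) auto
  then have "1 / 2 \<le> sin x" by (simp add: sin_30)
  then show ?thesis
    using assms(2) pi_less_4 by simp
qed

lemma norm_cis_minus_1: "norm (cis t - 1) = 2 * \<bar>sin (t / 2)\<bar>"
  using dist_exp_i_1[of t] by (simp add: cis_conv_exp)

text \<open>Points of the circle in the ball are at chord distance at most 2 R from one of them, z0,
  hence at arc distance at most 8 R. Steps of arc length r about z0 suffice, and the count does not
  depend on \<rho>.\<close>

lemma linelike_circle:
  assumes \<rho>: "0 < \<rho>"
  shows "linelike 25 (sphere 0 \<rho>)"
  unfolding linelike_def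
proof (intro allI impI)
  fix x R r assume r: "0 < r" "r \<le> (R::real)"
  show "covered r (sphere 0 \<rho> \<inter> ball x R) (25 * (R / r))"
  proof (cases "sphere 0 \<rho> \<inter> ball x R = {}")
    case True
    then show ?thesis
      using r by (auto simp: covered_def intro!: exI[of _ "{}"])
  next
    case False
    then obtain z0 where "z0 \<in> sphere 0 \<rho>" "z0 \<in> ball x R" by blast
    then have z0: "norm z0 = \<rho>" "dist x z0 < R" by simp_all
    \<comment> \<open>The 2 N + 1 grid points number at most 16 R/r + 3, and r \<le> R absorbs the 3
      into 25 R/r.\<close>
    define N where "N = \<lceil>8 * R / r\<rceil>"
    define S where "S = (\<lambda>j. z0 * cis (of_int j * (r / \<rho>))) ` {-N..N}"
    have "0 \<le> 8 * R / r" using r by simp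
    then have N0: "0 \<le> N" unfolding N_def by linarith
    have "sphere 0 \<rho> \<inter> ball x R \<subseteq> (\<Union>c\<in>S. ball c r)"
    proof
      fix z assume "z \<in> sphere 0 \<rho> \<inter> ball x R"
      then have z: "norm z = \<rho>" "dist x z < R" by auto
      define \<beta> where "\<beta> = Arg (z / z0)"
      have z0_nz: "z0 \<noteq> 0" using z0(1) \<rho> by auto
      have "norm (z / z0) = 1" using z z0 \<rho> by (simp add: norm_divide)
      then have "z / z0 = cis \<beta>"
        using rcis_cmod_Arg[of "z / z0"] by (simp add: \<beta>_def rcis_def)
      then have zeq: "z = z0 * cis \<beta>" using z0_nz by (simp add: field_simps)
      have \<beta>: "\<bar>\<beta>\<bar> \<le> pi"
        using Arg_bounded[of "z / z0"] by (auto simp: \<beta>_def abs_le_iff)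
      have "\<rho> * norm (cis \<beta> - 1) = norm (z - z0)"
        unfolding zeq using z0(1) norm_mult[of z0 "cis \<beta> - 1"] by (simp add: right_diff_distrib)
      also have "\<dots> \<le> 2 * R"
        using z(2) z0(2) dist_triangle2[of z z0 x] by (simp add: dist_norm norm_minus_commute)
      finally have a: "\<rho> * (2 * \<bar>sin (\<beta> / 2)\<bar>) \<le> 2 * R"
        by (simp add: norm_cis_minus_1)
      have "\<bar>\<beta>\<bar> / 2 / 4 \<le> sin (\<bar>\<beta>\<bar> / 2)"
        using \<beta> by (intro sin_ge_quarter) auto
      also have "\<dots> \<le> \<bar>sin (\<beta> / 2)\<bar>"
        by (cases "0 \<le> \<beta>") auto
      finally have "\<rho> * (\<bar>\<beta>\<bar> / 4) \<le> \<rho> * (2 * \<bar>sin (\<beta> / 2)\<bar>)"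
        using \<rho> by (intro mult_left_mono) auto
      then have b: "\<bar>\<beta>\<bar> * \<rho> \<le> 8 * R" using a by (simp add: mult.commute[of "\<bar>\<beta>\<bar>" \<rho>])
      define j where "j = \<lfloor>\<beta> * \<rho> / r\<rfloor>"
      have "\<bar>\<beta> * \<rho> / r\<bar> \<le> 8 * R / r"
        using b r \<rho> by (simp add: abs_mult divide_right_mono)
      then have "\<bar>\<beta> * \<rho> / r\<bar> \<le> of_int N"
        unfolding N_def using le_of_int_ceiling[of "8 * R / r"] by linarith
      then have "j \<in> {-N..N}"
        unfolding j_def atLeastAtMost_iff by linarith
      moreover have "dist (z0 * cis (of_int j * (r / \<rho>))) z < r"
      proof -
        define \<delta> where "\<delta> = \<beta> - of_int j * (r / \<rho>)"
        have "0 \<le> \<beta> * \<rho> / r - of_int j" "\<beta> * \<rho> / r - of_int j < 1"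
          unfolding j_def by linarith+
        moreover have "\<beta> * \<rho> / r - of_int j = \<delta> * (\<rho> / r)"
          using r \<rho> by (simp add: \<delta>_def field_simps)
        ultimately have \<delta>: "0 \<le> \<delta>" "\<delta> * \<rho> < r"
          using r \<rho> by (auto simp: zero_le_mult_iff zero_le_divide_iff field_simps)
        have eq: "z - z0 * cis (of_int j * (r / \<rho>)) = z0 * cis (of_int j * (r / \<rho>)) * (cis \<delta> - 1)"
          by (simp add: zeq \<delta>_def right_diff_distrib cis_mult mult.assoc)
        have "dist z (z0 * cis (of_int j * (r / \<rho>))) = \<rho> * (2 * \<bar>sin (\<delta> / 2)\<bar>)"
          unfolding dist_norm eq by (simp add: norm_mult z0(1) norm_cis_minus_1)
        also have "\<dots> \<le> \<rho> * \<delta>"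
          using abs_sin_x_le_abs_x[of "\<delta> / 2"] \<delta>(1) \<rho> by (intro mult_left_mono) auto
        finally show ?thesis using \<delta>(2) by (simp add: mult.commute dist_commute)
      qed
      ultimately show "z \<in> (\<Union>c\<in>S. ball c r)"
        unfolding S_def by auto
    qed
    moreover have "finite S" by (simp add: S_def)
    moreover have "real (card S) \<le> 25 * (R / r)"
    proof -
      have "card S \<le> card {-N..N}"
        unfolding S_def by (rule card_image_le) simp
      then have "real (card S) \<le> 2 * of_int N + 1"
        using N0 by (simp add: nat_le_iff)
      also have "of_int N \<le> 8 * R / r + 1"
        unfolding N_def by linarith
      finally have "real (card S) \<le> 2 * (8 * R / r + 1) + 1" by simp
      moreover have "1 \<le> R / r" using r by simp
      ultimately show ?thesis by simp
    qed
    ultimately show ?thesis unfolding covered_def by blast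
  qed
qed

lemma linelike_bilipschitz_image:
  assumes J: "linelike C J" and M: "1 \<le> M"
    and inv: "\<And>x. g' (g x) = x" "\<And>y. g (g' y) = y"
    and lower: "\<And>x y. norm (x - y) \<le> M * norm (g x - g y)"
    and upper: "\<And>x y. norm (g x - g y) \<le> M * norm (x - y)"
  shows "linelike (M\<^sup>2 * C) (g ` J)"
  unfolding linelike_def
proof (intro allI impI)
  fix x :: complex and R r :: real assume r: "0 < r" "r \<le> R"
  have "1 * r \<le> (M * M) * R"
    using M r by (intro mult_mono mult_ge1_I) (auto intro: order_trans[OF _ mult_mono])
  then have "0 < r / M" "r / M \<le> M * R"
    using r M by (auto simp: field_simps)
  then have "covered (r / M) (J \<inter> ball (g' x) (M * R)) (C * (M * R / (r / M)))"
    using J unfolding linelike_def by blast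
  from covered_lipschitz_image[OF _ upper this]
  have "covered r (g ` (J \<inter> ball (g' x) (M * R))) (M\<^sup>2 * C * (R / r))"
    using M by (simp add: power2_eq_square mult_ac)
  then show "covered r (g ` J \<inter> ball x R) (M\<^sup>2 * C * (R / r))"
  proof (rule covered_mono)
    show "g ` J \<inter> ball x R \<subseteq> g ` (J \<inter> ball (g' x) (M * R))"
    proof safe
      fix z assume z: "z \<in> J" "g z \<in> ball x R"
      have "norm (g' x - z) \<le> M * norm (x - g z)"
        using lower[of "g' x" z] inv by simp
      also have "\<dots> < M * R" using z(2) M by (simp add: dist_norm)
      finally show "g z \<in> g ` (J \<inter> ball (g' x) (M * R))"
        using z(1) by (simp add: dist_norm)
    qed
  qed simp
qed

text \<open>
  The real and imaginary parts of (2 - \<i>) z. In this rotated frame distinct corners have distinct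
  abscissae.
\<close>

definition xc :: "complex \<Rightarrow> real" where "xc z = 2 * Re z + Im z"

definition yc :: "complex \<Rightarrow> real" where "yc z = 2 * Im z - Re z"

lemma abs_xc_le: "\<bar>xc z\<bar> \<le> 3 * maxn z" and abs_yc_le: "\<bar>yc z\<bar> \<le> 3 * maxn z"
  by (auto simp: xc_def yc_def maxn_def)

lemma xc_add: "xc (z + w) = xc z + xc w" and yc_add: "yc (z + w) = yc z + yc w"
  and xc_diff: "xc (z - w) = xc z - xc w" and yc_diff: "yc (z - w) = yc z - yc w"
  and xc_scaleR: "xc (a *\<^sub>R z) = a * xc z" and yc_scaleR: "yc (a *\<^sub>R z) = a * yc z"
  by (simp_all add: xc_def yc_def algebra_simps)

lemma continuous_on_xc [continuous_intros]: "continuous_on S f \<Longrightarrow> continuous_on S (\<lambda>z. xc (f z))"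
  and continuous_on_yc [continuous_intros]: "continuous_on S f \<Longrightarrow> continuous_on S (\<lambda>z. yc (f z))"
  unfolding xc_def yc_def by (auto intro!: continuous_intros)

lemma xc_corners_diff: "p \<in> corners \<Longrightarrow> q \<in> corners \<Longrightarrow> p \<noteq> q \<Longrightarrow> 1 \<le> \<bar>xc (p - q)\<bar>"
  by (auto simp: corners_def xc_def)

text \<open>The reason for 1/12. In the first-letter case the corners differ by at least 1 in
  \<open>xc\<close>, and the tails contribute at most 6/12, leaving 1/2; the difference in
  \<open>yc\<close> is at most 6. The slope is therefore at most 12.\<close>

lemma cod_graph:
  assumes c: "c \<in> codes" "c' \<in> codes"
  shows "\<bar>yc (cod (1/12) c) - yc (cod (1/12) c')\<bar> \<le> 12 * \<bar>xc (cod (1/12) c) - xc (cod (1/12) c')\<bar>"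
proof (cases "c = c'")
  case False
  define n where "n = (LEAST n. c n \<noteq> c' n)"
  have "\<exists>n. c n \<noteq> c' n"
    using False ext[of c c'] by blast
  then have n: "c n \<noteq> c' n"
    unfolding n_def by (rule LeastI_ex)
  have less: "c i = c' i" if "i < n" for i
    using not_less_Least[of i "\<lambda>n. c n \<noteq> c' n"] that by (simp add: n_def)
  obtain p q b b' where h: "p \<in> corners" "q \<in> corners" "b \<in> codes" "b' \<in> codes" "p \<noteq> q"
    and eq: "cod (1/12) c - cod (1/12) c' = (1/12) ^ n *\<^sub>R ((p - q) + (1/12) *\<^sub>R (cod (1/12) b - cod (1/12) b'))"
    using cod_diff[OF _ _ c less n, of "1/12"] by force
  define t where "t = cod (1/12) b - cod (1/12) b'"
  define D where "D = (p - q) + (1/12) *\<^sub>R t"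
  have "maxn t \<le> 2"
    using maxn_triangle_diff[of "cod (1/12) b" "cod (1/12) b'"] maxn_cod_le_1[OF _ _ h(3), of "1/12"]
      maxn_cod_le_1[OF _ _ h(4), of "1/12"] by (simp add: t_def)
  then have t: "\<bar>xc t\<bar> \<le> 6" and "maxn D \<le> 2"
    using abs_xc_le[of t] maxn_triangle[of "p - q" "(1/12) *\<^sub>R t"] maxn_corners_diff[OF h(1,2,5)]
    by (auto simp: D_def)
  then have "\<bar>yc D\<bar> \<le> 6"
    using abs_yc_le[of D] by simp
  moreover have "1/2 \<le> \<bar>xc D\<bar>"
    using xc_corners_diff[OF h(1,2,5)] t unfolding D_def xc_add xc_scaleR by linarith
  ultimately have "\<bar>yc D\<bar> \<le> 12 * \<bar>xc D\<bar>" by simp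
  then have "(1/12) ^ n * \<bar>yc D\<bar> \<le> (1/12) ^ n * (12 * \<bar>xc D\<bar>)"
    by (intro mult_left_mono) auto
  then show ?thesis
    using eq unfolding xc_diff[symmetric] yc_diff[symmetric]
    by (simp add: xc_scaleR yc_scaleR abs_mult flip: t_def D_def)
qed simp

definition shear :: "(real \<Rightarrow> real) \<Rightarrow> complex \<Rightarrow> complex" where
  "shear k z = z + \<i> * of_real (k (Re z))"

lemma shear_inverse: "shear (\<lambda>x. - k x) (shear k z) = z" "shear k (shear (\<lambda>x. - k x) z) = z"
  by (simp_all add: shear_def)

lemma norm_shear_diff:
  assumes "\<And>s t. \<bar>k s - k t\<bar> \<le> L * \<bar>s - t\<bar>" "0 \<le> L"
  shows "norm (shear k z - shear k w) \<le> (1 + L) * norm (z - w)"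
proof -
  have "shear k z - shear k w = (z - w) + \<i> * of_real (k (Re z) - k (Re w))"
    by (simp add: shear_def algebra_simps)
  then have "norm (shear k z - shear k w) \<le> norm (z - w) + \<bar>k (Re z) - k (Re w)\<bar>"
    using norm_triangle_ineq[of "z - w" "\<i> * of_real (k (Re z) - k (Re w))"]
    by (simp only: norm_mult norm_ii norm_of_real mult_1)
  also have "\<bar>k (Re z) - k (Re w)\<bar> \<le> L * \<bar>Re (z - w)\<bar>"
    using assms(1) by simp
  also have "\<dots> \<le> L * norm (z - w)"
    using assms(2) abs_Re_le_cmod[of "z - w"] by (intro mult_left_mono)
  finally show ?thesis by (simp add: distrib_right)
qed

text \<open>Height of the upper half of the circle of radius 1000. The radius is so large that over
  the abscissae of the square, at most 3 in absolute value, the arc is nearly flat and far above the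
  lower half.\<close>

definition circ :: "real \<Rightarrow> real" where
  "circ x = sqrt (1000000 - x\<^sup>2)"

lemma circ_ge:
  assumes "\<bar>x\<bar> \<le> 3"
  shows "900 \<le> circ x" and "(circ x)\<^sup>2 = 1000000 - x\<^sup>2"
proof -
  have "x\<^sup>2 \<le> 9"
    using assms abs_le_square_iff[of x 3] by simp
  then show "900 \<le> circ x" "(circ x)\<^sup>2 = 1000000 - x\<^sup>2"
    unfolding circ_def by (auto intro!: real_le_rsqrt)
qed

text \<open>Difference of squares: the two heights sum to at least 1800, whereas x + y is at most 6
  in absolute value.\<close>

lemma circ_lipschitz:
  assumes "\<bar>x\<bar> \<le> 3" "\<bar>y\<bar> \<le> 3"
  shows "\<bar>circ x - circ y\<bar> \<le> \<bar>x - y\<bar>"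
proof -
  have "(circ x - circ y) * (circ x + circ y) = (y - x) * (y + x)"
    using circ_ge(2)[OF assms(1)] circ_ge(2)[OF assms(2)] by (simp add: power2_eq_square algebra_simps)
  then have "\<bar>circ x - circ y\<bar> * \<bar>circ x + circ y\<bar> = \<bar>x - y\<bar> * \<bar>x + y\<bar>"
    by (metis abs_minus_commute abs_mult add.commute)
  moreover have "\<bar>x - y\<bar> * \<bar>x + y\<bar> \<le> \<bar>x - y\<bar> * \<bar>circ x + circ y\<bar>"
    using assms circ_ge(1)[OF assms(1)] circ_ge(1)[OF assms(2)] by (intro mult_left_mono) auto
  moreover have "0 < \<bar>circ x + circ y\<bar>"
    using circ_ge(1)[OF assms(1)] circ_ge(1)[OF assms(2)] by simp
  ultimately show ?thesis
    by (metis mult_le_cancel_right_pos)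
qed

lemma abs_xc_Q: "maxn z \<le> 1 \<Longrightarrow> \<bar>xc z\<bar> \<le> 3" and abs_yc_Q: "maxn z \<le> 1 \<Longrightarrow> \<bar>yc z\<bar> \<le> 3"
  using abs_xc_le[of z] abs_yc_le[of z] by linarith+

text \<open>In the frame of \<open>xc\<close> and \<open>yc\<close> the Cantor set is a Lipschitz
  graph. Its height minus that of the arc interpolates to k, so the shear by k moves the arc onto
  the Cantor points, and division by 2 - \<i> returns to the original frame. The last clause
  identifies the inner side of the curve.\<close>

lemma curve_through_cantor_set:
  obtains g g' :: "complex \<Rightarrow> complex" and M where "1 \<le> M"
    "\<And>z. g' (g z) = z" "\<And>z. g (g' z) = z"
    "\<And>x y. norm (x - y) \<le> M * norm (g x - g y)" "\<And>x y. norm (g x - g y) \<le> M * norm (x - y)"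
    "\<And>c. c \<in> codes \<Longrightarrow> cod (1/12) c \<in> g ` sphere 0 1000"
    "\<And>c u. c \<in> codes \<Longrightarrow> maxn u \<le> 1 \<Longrightarrow>
      yc u + 15 * \<bar>xc u - xc (cod (1/12) c)\<bar> < yc (cod (1/12) c) \<Longrightarrow> u \<in> g ` ball 0 1000"
proof -
  let ?e = "\<lambda>c. cod (1/12) c"
  have eQ: "maxn (?e c) \<le> 1" if "c \<in> codes" for c
    by (rule maxn_cod_le_1[OF _ _ that]) auto
  have "base4 0 \<in> codes" by (rule base4_codes)
  then have ne: "codes \<noteq> {}" by blast
  \<comment> \<open>13 = 12 + 1: the slope of the Cantor graph plus the Lipschitz constant of the
    arc.\<close>
  have lip: "\<bar>(yc (?e c) - circ (xc (?e c))) - (yc (?e c') - circ (xc (?e c')))\<bar>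
      \<le> 13 * \<bar>xc (?e c) - xc (?e c')\<bar>" if "c \<in> codes" "c' \<in> codes" for c c'
    using cod_graph[OF that] circ_lipschitz[OF abs_xc_Q[OF eQ[OF that(1)]] abs_xc_Q[OF eQ[OF that(2)]]]
      abs_triangle_ineq4[of "yc (?e c) - yc (?e c')" "circ (xc (?e c)) - circ (xc (?e c'))"]
    by (simp add: algebra_simps)
  obtain k where k: "\<And>s t. \<bar>k s - k t\<bar> \<le> 13 * \<bar>s - t\<bar>"
    and k_eq: "\<And>c. c \<in> codes \<Longrightarrow> k (xc (?e c)) = yc (?e c) - circ (xc (?e c))"
    using lipschitz_interpolation[where I = codes and L = 13 and x = "\<lambda>c. xc (?e c)"
        and y = "\<lambda>c. yc (?e c) - circ (xc (?e c))", OF ne _ lip] by auto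
  define g where "g z = shear k z / (2 - \<i>)" for z
  define g' where "g' u = shear (\<lambda>x. - k x) ((2 - \<i>) * u)" for u
  have nz: "(2 - \<i>) \<noteq> 0" by (simp add: complex_eq_iff)
  have norm_ge: "1 \<le> norm (2 - \<i>)" and norm_le: "norm (2 - \<i>) \<le> 3"
    using norm_triangle_ineq4[of 2 \<i>] norm_triangle_ineq2[of 2 \<i>] by simp_all
  have inv: "g' (g z) = z" "g (g' z) = z" for z
    using nz by (simp_all add: g_def g'_def shear_inverse)
  have sh: "norm (shear k x - shear k y) \<le> 14 * norm (x - y)" for x y
    using norm_shear_diff[of k 13 x y] k by simp
  have sh': "norm (shear (\<lambda>x. - k x) x - shear (\<lambda>x. - k x) y) \<le> 14 * norm (x - y)" for x y
    using norm_shear_diff[of "\<lambda>x. - k x" 13 x y] k by (simp add: abs_minus_commute)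
  have g_diff: "norm (2 - \<i>) * norm (g x - g y) = norm (shear k x - shear k y)" for x y
    unfolding g_def diff_divide_distrib[symmetric] using nz by (simp add: norm_divide)
  have upper: "norm (g x - g y) \<le> 42 * norm (x - y)" for x y
  proof -
    have "1 * norm (g x - g y) \<le> norm (2 - \<i>) * norm (g x - g y)"
      using norm_ge by (intro mult_right_mono) auto
    then show ?thesis
      using sh[of x y] g_diff[of x y] norm_ge_zero[of "x - y"] by linarith
  qed
  have lower: "norm (x - y) \<le> 42 * norm (g x - g y)" for x y
  proof -
    have "norm (x - y) \<le> 14 * norm (shear k x - shear k y)"
      using sh'[of "shear k x" "shear k y"] by (simp add: shear_inverse)
    also have "\<dots> \<le> 14 * (3 * norm (g x - g y))"
      unfolding g_diff[symmetric] using norm_le by (intro mult_left_mono mult_right_mono) auto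
    finally show ?thesis by simp
  qed
  \<comment> \<open>\<open>xc u\<close> and \<open>yc u\<close> are the coordinates of (2 - \<i>) u,
    and the inverse shear subtracts k from the second.\<close>
  have norm_g': "(norm (g' u))\<^sup>2 = (xc u)\<^sup>2 + (yc u - k (xc u))\<^sup>2" for u
    unfolding g'_def shear_def cmod_power2 by (simp add: xc_def yc_def)
  have circle: "?e c \<in> g ` sphere 0 1000" if c: "c \<in> codes" for c
  proof -
    have "(norm (g' (?e c)))\<^sup>2 = 1000\<^sup>2"
      unfolding norm_g' using circ_ge(2)[OF abs_xc_Q[OF eQ[OF c]]] by (simp add: k_eq[OF c])
    then have "norm (g' (?e c)) = 1000"
      by (simp only: power2_eq_iff_nonneg norm_ge_zero zero_le_numeral)
    then show ?thesis
      using inv(2)[of "?e c"] by (intro image_eqI[of _ _ "g' (?e c)"]) auto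
  qed
  have disc: "u \<in> g ` ball 0 1000" if c: "c \<in> codes" and u: "maxn u \<le> 1"
    and cone: "yc u + 15 * \<bar>xc u - xc (?e c)\<bar> < yc (?e c)" for c u
  proof -
    define q where "q = yc u - k (xc u)"
    have xu: "\<bar>xc u\<bar> \<le> 3" "\<bar>yc u\<bar> \<le> 3" and xe: "\<bar>xc (?e c)\<bar> \<le> 3" "\<bar>yc (?e c)\<bar> \<le> 3"
      using abs_xc_Q abs_yc_Q u eQ[OF c] by blast+
    define \<Delta> where "\<Delta> = \<bar>xc u - xc (?e c)\<bar>"
    have \<Delta>: "0 \<le> \<Delta>" "\<Delta> \<le> 6"
      using xu(1) xe(1) by (auto simp: \<Delta>_def)
    have kk: "\<bar>k (xc u) - (yc (?e c) - circ (xc (?e c)))\<bar> \<le> 13 * \<Delta>"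
      using k[of "xc u" "xc (?e c)"] by (simp add: k_eq[OF c] \<Delta>_def)
    have "\<bar>circ (xc u) - circ (xc (?e c))\<bar> \<le> \<Delta>"
      using circ_lipschitz[OF xu(1) xe(1)] by (simp add: \<Delta>_def)
    \<comment> \<open>The curve k + circ has slope at most 13 + 1 here, less than the 15 of the
      cone, so u lies below it.\<close>
    then have "q < circ (xc u)"
      using cone kk \<Delta> unfolding q_def \<Delta>_def[symmetric] by linarith
    \<comment> \<open>The lower half of the circle is far away: q is at least 900 - 3 - 3 - 13 *
      6.\<close>
    moreover have "0 \<le> q"
      using kk xu(2) xe(2) \<Delta> circ_ge(1)[OF xe(1)] unfolding q_def by linarith
    ultimately have "q\<^sup>2 < (circ (xc u))\<^sup>2"
      by (intro power_strict_mono) auto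
    then have "(norm (g' u))\<^sup>2 < 1000\<^sup>2"
      unfolding norm_g' q_def[symmetric] circ_ge(2)[OF xu(1)] by simp
    then have "norm (g' u) < 1000"
      by (rule power2_less_imp_less) simp
    then show ?thesis
      using inv(2)[of u] by (intro image_eqI[of _ _ "g' u"]) auto
  qed
  show ?thesis
    by (rule that[of 42 g' g]) (use inv lower upper circle disc in auto)
qed

section \<open>Divergence of the integral\<close>

primrec pieces :: "real \<Rightarrow> complex set \<Rightarrow> nat \<Rightarrow> complex set" where
  "pieces \<rho> U 0 = U"
| "pieces \<rho> U (Suc n) = (\<Union>p\<in>corners. (\<lambda>w. p + \<rho> *\<^sub>R w) ` pieces \<rho> U n)"

lemma open_pieces: "open U \<Longrightarrow> \<rho> \<noteq> 0 \<Longrightarrow> open (pieces \<rho> U n)"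
  by (induction n) (auto intro!: open_UN open_affinity)

lemma pieces_in_square:
  assumes "0 < \<rho>" "\<rho> \<le> 1/2" "\<And>u. u \<in> U \<Longrightarrow> maxn u \<le> 1" "z \<in> pieces \<rho> U n"
  shows "maxn z \<le> 1"
  using assms(4)
proof (induction n arbitrary: z)
  case (Suc n)
  then obtain p w where pw: "p \<in> corners" "w \<in> pieces \<rho> U n" "z = p + \<rho> *\<^sub>R w" by auto
  have "\<rho> * maxn w \<le> 1/2 * 1"
    using Suc.IH[OF pw(2)] assms(1,2) by (intro mult_mono) auto
  then show ?case
    using maxn_triangle[of p "\<rho> *\<^sub>R w"] pw assms(1) by (simp add: maxn_corner)
qed (use assms(3) in simp)

lemma corner_squares_disjoint:
  assumes "0 < \<rho>" "\<rho> < 1/2" "p \<in> corners" "q \<in> corners" "p + \<rho> *\<^sub>R w = q + \<rho> *\<^sub>R v"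
    and "maxn w \<le> 1" "maxn v \<le> 1"
  shows "p = q" "w = v"
proof -
  show "p = q"
  proof (rule ccontr)
    assume "p \<noteq> q"
    have "p - q = \<rho> *\<^sub>R (v - w)"
      using assms(5) by (simp add: scaleR_diff_right algebra_simps)
    then have "1 = \<rho> * maxn (v - w)"
      using maxn_corners_diff[OF assms(3,4) \<open>p \<noteq> q\<close>] assms(1) by simp
    also have "\<dots> \<le> \<rho> * 2"
      using maxn_triangle_diff[of v w] assms by (intro mult_left_mono) auto
    finally show False using assms(2) by simp
  qed
  then show "w = v" using assms(1,5) by simp
qed

lemma emeasure_pieces:
  assumes \<rho>: "0 < \<rho>" "\<rho> < 1/2" and U: "open U" "\<And>u. u \<in> U \<Longrightarrow> maxn u \<le> 1"
  shows "emeasure lborel (pieces \<rho> U n) = ennreal ((4 * \<rho>\<^sup>2) ^ n) * emeasure lborel U"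
proof (induction n)
  case (Suc n)
  let ?A = "\<lambda>p. (\<lambda>w. p + \<rho> *\<^sub>R w) ` pieces \<rho> U n"
  have op: "open (pieces \<rho> U n)" "\<And>p. open (?A p)"
    using open_pieces[OF U(1), of \<rho> n] \<rho> by (auto intro: open_affinity)
  have scale: "emeasure lborel (?A p) = ennreal (\<rho>\<^sup>2) * emeasure lborel (pieces \<rho> U n)" for p
  proof -
    have "emeasure lebesgue (?A p) = ennreal (\<rho>\<^sup>2) * emeasure lebesgue (pieces \<rho> U n)"
      using emeasure_lebesgue_affine[of \<rho> p "pieces \<rho> U n"] \<rho> by (simp add: add.commute)
    then show ?thesis
      using op by simp
  qed
  have Q: "maxn z \<le> 1" if "z \<in> pieces \<rho> U n" for z
    using pieces_in_square[of \<rho> U z n] \<rho> U that by auto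
  have "disjoint_family_on ?A corners"
    unfolding disjoint_family_on_def using corner_squares_disjoint(1)[OF \<rho> _ _ _ Q Q] by blast
  then have "emeasure lborel (pieces \<rho> U (Suc n)) = (\<Sum>p\<in>corners. emeasure lborel (?A p))"
    using op by (simp add: sum_emeasure image_subset_iff)
  also have "\<dots> = ennreal 4 * (ennreal (\<rho>\<^sup>2) * emeasure lborel (pieces \<rho> U n))"
    by (simp add: scale card_corners)
  also have "\<dots> = ennreal ((4 * \<rho>\<^sup>2) ^ Suc n) * emeasure lborel U"
    unfolding Suc power_Suc using \<rho> by (simp add: ennreal_mult mult.assoc)
  finally show ?case .
qed simp

text \<open>U avoids the corner squares, which contain all later generations. Two deeper generations
  share their outer letter at a common point, and stripping it reduces to this case.\<close>

lemma pieces_disjoint: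
  assumes \<rho>: "0 < \<rho>" "\<rho> < 1/2" and U: "\<And>u. u \<in> U \<Longrightarrow> maxn u \<le> 1"
    and avoid: "\<And>u p. u \<in> U \<Longrightarrow> p \<in> corners \<Longrightarrow> \<rho> < maxn (u - p)"
  shows "disjoint_family (pieces \<rho> U)"
proof -
  have Q: "maxn z \<le> 1" if "z \<in> pieces \<rho> U n" for z n
    using pieces_in_square[of \<rho> U z n] \<rho> U that by auto
  have "False" if "z \<in> pieces \<rho> U m" "z \<in> pieces \<rho> U n" "m < n" for z m n
    using that
  proof (induction m arbitrary: z n)
    case 0
    then obtain n' where "n = Suc n'" by (cases n) auto
    then obtain p w where pw: "p \<in> corners" "w \<in> pieces \<rho> U n'" "z = p + \<rho> *\<^sub>R w"
      using 0 by auto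
    have "\<rho> * maxn w \<le> \<rho> * 1"
      using Q[OF pw(2)] \<rho> by (intro mult_left_mono) auto
    then show False
      using avoid[of z p] 0 pw \<rho> by simp
  next
    case (Suc m)
    then obtain n' where n': "n = Suc n'" by (cases n) auto
    obtain p w where pw: "p \<in> corners" "w \<in> pieces \<rho> U m" "z = p + \<rho> *\<^sub>R w"
      using Suc.prems by auto
    obtain q v where qv: "q \<in> corners" "v \<in> pieces \<rho> U n'" "z = q + \<rho> *\<^sub>R v"
      using Suc.prems n' by auto
    have "w = v"
      using corner_squares_disjoint(2)[OF \<rho> pw(1) qv(1)] pw qv Q by metis
    then show False
      using Suc.IH[OF pw(2), of n'] qv n' Suc.prems by simp
  qed
  then show ?thesis
    unfolding disjoint_family_on_def by (metis disjoint_iff linorder_neqE_nat)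
qed

text \<open>On generation n the weight is at least (4 \<rho>^n)^(p-2) and the area is (4 \<rho>^2)^n
  times that of U; the product is \<kappa> (4 \<rho>^p)^n \<ge> \<kappa>, and the generations are
  disjoint.\<close>

lemma weighted_integral_infinite:
  assumes \<rho>: "0 < \<rho>" "\<rho> < 1/2" and U: "open U" "U \<noteq> {}" "\<And>u. u \<in> U \<Longrightarrow> maxn u \<le> 1"
    and avoid: "\<And>u p. u \<in> U \<Longrightarrow> p \<in> corners \<Longrightarrow> \<rho> < maxn (u - p)"
    and sub: "\<And>n. pieces \<rho> U n \<subseteq> \<Omega>"
    and near: "\<And>n z. z \<in> pieces \<rho> U n \<Longrightarrow> 0 < bdist \<Omega> z \<and> bdist \<Omega> z \<le> 4 * \<rho> ^ n"
    and p: "p < 2" "1 \<le> 4 * \<rho> powr p"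
  shows "(\<integral>\<^sup>+z\<in>\<Omega>. ennreal (bdist \<Omega> z powr (p - 2)) \<partial>lborel) = \<infinity>"
proof -
  define w where "w n = (4 * \<rho> ^ n) powr (p - 2)" for n
  have bounded: "bounded U"
    unfolding bounded_iff using norm_le_maxn U(3) by (intro exI[of _ 2]) (smt (verit))
  obtain e where e: "emeasure lborel U = ennreal e" "0 < e"
  proof -
    have "emeasure lborel U \<noteq> \<infinity>"
      using emeasure_bounded_finite[OF bounded] by simp
    moreover have "emeasure lborel U \<noteq> 0"
    proof -
      obtain x s where s: "0 < s" "ball x s \<subseteq> U"
        using U(1,2) openE by blast
      then have "ennreal (disc_area * s\<^sup>2) \<le> emeasure lborel U"
        using U(1) emeasure_mono[of "ball x s" U lborel] by (simp add: emeasure_disc)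
      moreover have "0 < ennreal (disc_area * s\<^sup>2)"
        using disc_area_pos s by simp
      ultimately show ?thesis by auto
    qed
    ultimately show ?thesis
      using that by (cases "emeasure lborel U") (auto simp: less_le)
  qed
  define \<kappa> where "\<kappa> = 4 powr (p - 2) * e"
  have \<kappa>: "0 < \<kappa>" using e by (simp add: \<kappa>_def)
  have piece_integral: "ennreal \<kappa> \<le> (\<integral>\<^sup>+z. ennreal (w n) * indicator (pieces \<rho> U n) z \<partial>lborel)" for n
  proof -
    have "1 \<le> (4 * \<rho> powr p) ^ n" using p(2) by (rule one_le_power)
    then have "\<kappa> * 1 \<le> \<kappa> * (4 * \<rho> powr p) ^ n"
      using \<kappa> by (intro mult_left_mono) auto
    also have "\<kappa> * (4 * \<rho> powr p) ^ n = w n * ((4 * \<rho>\<^sup>2) ^ n * e)"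
    proof -
      have "\<rho> powr p = \<rho> powr (p - 2) * \<rho>\<^sup>2"
        using \<rho> by (simp add: powr_diff powr_numeral)
      moreover have "w n = 4 powr (p - 2) * (\<rho> powr (p - 2)) ^ n"
        using \<rho> by (simp add: w_def powr_mult powr_realpow[symmetric] powr_powr mult.commute)
      ultimately show ?thesis
        by (simp add: \<kappa>_def power_mult_distrib)
    qed
    finally have "ennreal \<kappa> \<le> ennreal (w n * ((4 * \<rho>\<^sup>2) ^ n * e))"
      by (intro ennreal_leI) simp
    also have "\<dots> = ennreal (w n) * emeasure lborel (pieces \<rho> U n)"
    proof -
      have "emeasure lborel (pieces \<rho> U n) = ennreal ((4 * \<rho>\<^sup>2) ^ n) * ennreal e"
        using emeasure_pieces[of \<rho> U n] \<rho> U e(1) by auto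
      then show ?thesis
        using e(2) by (simp add: w_def ennreal_mult)
    qed
    also have "\<dots> = (\<integral>\<^sup>+z. ennreal (w n) * indicator (pieces \<rho> U n) z \<partial>lborel)"
      using open_pieces[OF U(1), of \<rho> n] \<rho> by (intro nn_integral_cmult_indicator[symmetric]) auto
    finally show ?thesis .
  qed
  let ?I = "\<integral>\<^sup>+z\<in>\<Omega>. ennreal (bdist \<Omega> z powr (p - 2)) \<partial>lborel"
  have dis: "disjoint_family (pieces \<rho> U)"
    by (rule pieces_disjoint[OF \<rho> U(3) avoid])
  have "(\<Sum>n. \<integral>\<^sup>+z. ennreal (w n) * indicator (pieces \<rho> U n) z \<partial>lborel)
      = (\<integral>\<^sup>+z. (\<Sum>n. ennreal (w n) * indicator (pieces \<rho> U n) z) \<partial>lborel)"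
    using open_pieces[OF U(1)] \<rho> by (intro nn_integral_suminf[symmetric]) auto
  also have "\<dots> \<le> ?I"
  proof (rule nn_integral_mono)
    fix z
    show "(\<Sum>n. ennreal (w n) * indicator (pieces \<rho> U n) z)
        \<le> ennreal (bdist \<Omega> z powr (p - 2)) * indicator \<Omega> z"
    proof (cases "\<exists>n. z \<in> pieces \<rho> U n")
      case True
      then obtain n where n: "z \<in> pieces \<rho> U n" by blast
      have "(\<Sum>n. ennreal (w n) * indicator (pieces \<rho> U n) z) = ennreal (w n)"
        by (rule suminf_cmult_indicator[OF dis n])
      \<comment> \<open>The negative exponent reverses the inequality only for a positive distance,
        since \<open>0 powr (p - 2)\<close> is 0.\<close>
      also have "\<dots> \<le> ennreal (bdist \<Omega> z powr (p - 2))"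
        unfolding w_def using near[OF n] p(1) by (intro ennreal_leI powr_mono2') auto
      finally show ?thesis using sub n by (auto simp: indicator_def)
    next
      case False
      then show ?thesis by simp
    qed
  qed
  finally have sum: "(\<Sum>n. \<integral>\<^sup>+z. ennreal (w n) * indicator (pieces \<rho> U n) z \<partial>lborel) \<le> ?I" .
  have "ennreal (real n * \<kappa>) \<le> ?I" for n
  proof -
    have "ennreal (real n * \<kappa>) = (\<Sum>i<n. ennreal \<kappa>)"
      using \<kappa> by (simp add: ennreal_mult ennreal_of_nat_eq_real_of_nat)
    also have "\<dots> \<le> (\<Sum>i<n. \<integral>\<^sup>+z. ennreal (w i) * indicator (pieces \<rho> U i) z \<partial>lborel)"
      by (intro sum_mono piece_integral)
    also have "\<dots> \<le> (\<Sum>i. \<integral>\<^sup>+z. ennreal (w i) * indicator (pieces \<rho> U i) z \<partial>lborel)"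
      by (intro sum_le_suminf) auto
    also note sum
    finally show ?thesis .
  qed
  show ?thesis
  proof (rule ccontr)
    assume "?I \<noteq> \<infinity>"
    then obtain b where b: "?I = ennreal b" "0 \<le> b"
      by (cases ?I) auto
    obtain n where "b < real n * \<kappa>"
      using reals_Archimedean3[OF \<kappa>] by blast
    then show False
      using \<open>\<And>n. ennreal (real n * \<kappa>) \<le> ?I\<close>[of n] b by simp
  qed
qed

section \<open>The domain\<close>

lemma frontier_homeomorphic_image:
  assumes "homeomorphism UNIV UNIV f f'"
  shows "frontier (f ` S) = f ` frontier S"
proof -
  have inv: "\<And>x. f' (f x) = x" "\<And>y. f (f' y) = y" and cont: "continuous_on UNIV f" "continuous_on UNIV f'"
    using assms by (auto simp: homeomorphism_def)
  have inj: "inj f" by (metis inv(1) injI)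
  have bij: "bij f" by (metis inv bijI')
  have cl: "closure (f ` T) = f ` closure T" for T
  proof
    have "f ` closure T = f' -` closure T"
      using inv by (auto intro!: image_eqI[of _ _ "f' _"])
    then have "closed (f ` closure T)"
      using closed_vimage[OF closed_closure cont(2)] by simp
    then show "closure (f ` T) \<subseteq> f ` closure T"
      by (intro closure_minimal) (auto intro: closure_subset[THEN subsetD])
    show "f ` closure T \<subseteq> closure (f ` T)"
      by (intro image_closure_subset continuous_on_subset[OF cont(1)]) (auto intro: closure_subset[THEN subsetD])
  qed
  show ?thesis
    unfolding frontier_closures image_Int[OF inj] cl[symmetric] bij_image_Compl_eq[OF bij] ..
qed

lemma quasidisk_of_dimension:
  assumes p: "1 < p" "p < 2" "p \<le> d" and d: "d < 2"
  obtains \<Omega> :: "complex set" where "quasidisk \<Omega>" "bounded \<Omega>"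
    "hausdorff_dim (frontier \<Omega>) = ereal d" "upper_minkowski_dim (frontier \<Omega>) = ereal d"
    "assouad_dim (frontier \<Omega>) = ereal d"
    "(\<integral>\<^sup>+z\<in>\<Omega>. ennreal (bdist \<Omega> z powr (p - 2)) \<partial>lborel) = \<infinity>"
proof -
  define \<nu> :: real where "\<nu> = 4 powr (- 1 / d)"
  \<comment> \<open>Any common outer radius between \<nu> and 1/2 would serve; it also exceeds 1/12,
    because \<nu> > 1/4.\<close>
  define \<sigma> where "\<sigma> = (\<nu> + 1/2) / 2"
  have d1: "1 < d" using p by simp
  have \<nu>_d: "\<nu> powr d = 1/4"
    unfolding \<nu>_def powr_powr using d1 by (simp add: powr_minus_divide)
  have "(4 :: real) powr (- 1 / d) < 4 powr (- 1 / 2)"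
    using d d1 by (intro powr_less_mono) (auto simp: field_simps)
  also have "(4 :: real) powr (- 1 / 2) = 1/2"
    using powr_half_sqrt[of 4] by (simp add: powr_minus_divide)
  finally have \<nu>: "0 < \<nu>" "\<nu> < 1/2" by (auto simp: \<nu>_def)
  have "(4 :: real) powr - 1 < 4 powr (- 1 / d)"
    using d1 by (intro powr_less_mono) (auto simp: field_simps)
  then have "1/12 < \<nu>" by (simp add: \<nu>_def powr_minus_divide)
  then interpret cantor_rescaling \<sigma> "1/12" \<nu>
    using \<nu> by unfold_locales (auto simp: \<sigma>_def)
  let ?e = "\<lambda>c. cod (1/12) c"
  obtain g g' :: "complex \<Rightarrow> complex" and M where M: "1 \<le> M" and inv: "\<And>z. g' (g z) = z" "\<And>z. g (g' z) = z"
    and lower: "\<And>x y. norm (x - y) \<le> M * norm (g x - g y)"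
    and upper: "\<And>x y. norm (g x - g y) \<le> M * norm (x - y)"
    and circle: "\<And>c. c \<in> codes \<Longrightarrow> ?e c \<in> g ` sphere 0 1000"
    and cone: "\<And>c u. c \<in> codes \<Longrightarrow> maxn u \<le> 1 \<Longrightarrow>
      yc u + 15 * \<bar>xc u - xc (?e c)\<bar> < yc (?e c) \<Longrightarrow> u \<in> g ` ball 0 1000"
    by (rule curve_through_cantor_set) blast
  have "M-lipschitz_on UNIV g"
    using upper M by (auto simp: lipschitz_on_def dist_norm)
  moreover have "M-lipschitz_on UNIV g'"
    using lower[of "g' _" "g' _"] inv M by (auto simp: lipschitz_on_def dist_norm)
  ultimately have hom_g: "homeomorphism UNIV UNIV g g'"
    using inv by (intro homeomorphismI lipschitz_on_continuous_on) auto
  have hom: "homeomorphism UNIV UNIV (F \<circ> g) (g' \<circ> cmap \<sigma> \<nu> (1/12))"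
    by (rule homeomorphism_compose[OF hom_g homeomorphism_cmap])
  define \<Omega> where "\<Omega> = (F \<circ> g) ` ball 0 1000"
  have fr: "frontier \<Omega> = F ` (g ` sphere 0 1000)"
    using frontier_homeomorphic_image[OF hom, of "ball 0 1000"] by (simp add: \<Omega>_def image_comp)
  have quasidisk: "quasidisk \<Omega>"
    unfolding quasidisk_def \<Omega>_def
    using quasiconformal_cmap_comp[OF hom_g M lower upper] by (metis zero_less_numeral)
  have cont: "continuous_on UNIV (F \<circ> g)"
    using hom by (simp add: homeomorphism_def)
  have bd: "bounded ((F \<circ> g) ` cball 0 1000)"
    by (intro compact_imp_bounded compact_continuous_image continuous_on_subset[OF cont]) auto
  then have bounded: "bounded \<Omega>"
    by (rule bounded_subset) (auto simp: \<Omega>_def)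
  have bounded_fr: "bounded (frontier \<Omega>)"
    using bd by (rule bounded_subset) (auto simp: fr)
  have "open \<Omega>"
  proof -
    have "\<Omega> = (g' \<circ> cmap \<sigma> \<nu> (1/12)) -` ball 0 1000"
      unfolding \<Omega>_def using inv by (auto simp: cmap_swap cmap_swap' intro!: image_eqI[of _ _ "g' (cmap \<sigma> \<nu> (1/12) _)"])
    moreover have "continuous_on UNIV (g' \<circ> cmap \<sigma> \<nu> (1/12))"
      using hom by (simp only: homeomorphism_def)
    ultimately show ?thesis
      by (simp only: open_vimage open_ball)
  qed
  have code_frontier: "cod \<nu> c \<in> frontier \<Omega>" if "c \<in> codes" for c
    unfolding fr using circle[OF that] cmap_cod[OF that] by (metis image_eqI)
  \<comment> \<open>The upper left corner repeated: it has the largest \<open>yc\<close> among the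
    corners, so this is the highest Cantor point in the rotated frame, and the cone below it has
    room outside the corner squares.\<close>
  define c0 where "c0 n = Complex (-1/2) (1/2)" for n :: nat
  have c0: "c0 \<in> codes" by (simp add: c0_def codes_def corners_def)
  have hd: "ereal d \<le> hausdorff_dim (frontier \<Omega>)"
    using cod_base4_holder[OF \<nu> \<nu>_d] d1 \<nu> code_frontier[OF base4_codes]
    by (intro hausdorff_dim_ge[where \<gamma> = "\<lambda>t. cod \<nu> (base4 t)" and C = "(1 / (1 - 2 * \<nu>)) powr d"]) auto
  have "linelike (M\<^sup>2 * 25) (g ` sphere 0 1000)"
    by (intro linelike_bilipschitz_image[OF linelike_circle M inv lower upper]) simp
  from covered_cmap_image[OF d1 \<nu>_d this] obtain D where D: "0 \<le> D"
    "\<And>x r R. 0 < r \<Longrightarrow> r \<le> R \<Longrightarrow> covered r (F ` (g ` sphere 0 1000) \<inter> ball x R) (D * (R / r) powr d)"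
    by blast
  have ad: "assouad_dim (frontier \<Omega>) \<le> ereal d"
    unfolding fr using D d1 by (intro assouad_dim_le) auto
  have ne: "frontier \<Omega> \<noteq> {}" using code_frontier[OF c0] by blast
  note chain = hausdorff_dim_le_upper_minkowski_dim[of "frontier \<Omega>"]
    upper_minkowski_dim_le_assouad_dim[OF bounded_fr ne]
  \<comment> \<open>Points of K lie in a cone below some point of the Cantor set, hence on the inner side of the curve.\<close>
  define K where "K = {u. maxn u \<le> 1 \<and> (\<exists>c\<in>codes. yc u + 15 * \<bar>xc u - xc (?e c)\<bar> < yc (?e c))}"
  have KF: "F ` K \<subseteq> \<Omega>"
    using cone by (auto simp: K_def \<Omega>_def image_comp[symmetric])
  \<comment> \<open>The contraction to p carries the cone below the point with address c into the
    cone below the point whose address is p followed by c. For this invariance K uses the cones of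
    all addresses.\<close>
  have K_step: "p + (1/12) *\<^sub>R u \<in> K" if pu: "p \<in> corners" "u \<in> K" for p u
  proof -
    obtain c where c: "c \<in> codes" "yc u + 15 * \<bar>xc u - xc (?e c)\<bar> < yc (?e c)" and u: "maxn u \<le> 1"
      using pu(2) by (auto simp: K_def)
    define b where "b = case_nat p c"
    have b: "b \<in> codes"
      using c(1) pu(1) by (auto simp: b_def codes_def split: nat.split)
    have "?e b = p + (1/12) *\<^sub>R ?e c"
      using cod_unfold[OF _ _ b, of "1/12"] by (simp add: b_def)
    moreover have "yc (p + (1/12) *\<^sub>R u) + 15 * \<bar>xc (p + (1/12) *\<^sub>R u) - xc (p + (1/12) *\<^sub>R ?e c)\<bar>
        < yc (p + (1/12) *\<^sub>R ?e c)"
      using c(2) unfolding xc_add yc_add xc_scaleR yc_scaleR by (simp add: abs_if split: if_splits)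
    moreover have "maxn (p + (1/12) *\<^sub>R u) \<le> 1"
      using maxn_triangle[of p "(1/12) *\<^sub>R u"] u pu(1) by (simp add: maxn_corner)
    ultimately show ?thesis unfolding K_def using b by (intro CollectI conjI bexI[of _ b]) simp_all
  qed
  \<comment> \<open>The generating piece: a part of a single cone off the closed corner squares, so
    that its image avoids the image squares. Strict inequalities make it open.\<close>
  define W where "W = {u. maxn u < 1 \<and> yc u + 15 * \<bar>xc u - xc (?e c0)\<bar> < yc (?e c0)}
      \<inter> (\<Inter>p\<in>corners. {u. 1/12 < maxn (u - p)})"
  have W_open: "open W"
    unfolding W_def
    by (intro open_Int open_INT ballI finite_corners open_Collect_conj open_Collect_less continuous_intros)
  have WK: "W \<subseteq> K"
    using c0 by (auto simp: W_def K_def)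
  have e0: "?e c0 = Complex (-6/11) (6/11)"
  proof -
    have shift: "(\<lambda>n. c0 (Suc n)) = c0" and head: "c0 0 = Complex (-1/2) (1/2)"
      by (simp_all add: c0_def fun_eq_iff)
    have "?e c0 = Complex (-1/2) (1/2) + (1/12) *\<^sub>R ?e c0"
      using cod_unfold[OF _ _ c0, of "1/12"] unfolding shift head by simp
    then show ?thesis
      by (simp add: complex_eq_iff)
  qed
  \<comment> \<open>This is the point \<open>?e c0\<close> plus (1/5, -2/5): on the axis of the
    cone, with the same \<open>xc\<close> and with \<open>yc\<close> smaller by 1.\<close>
  have "Complex (-19/55) (8/55) \<in> W"
    unfolding W_def e0 by (simp add: corners_def maxn_def xc_def yc_def)
  define U where "U = F ` W"
  have "U = cmap \<sigma> \<nu> (1/12) -` W"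
    unfolding U_def by (auto simp: cmap_swap cmap_swap' intro!: image_eqI[of _ _ "cmap \<sigma> \<nu> (1/12) _"])
  then have U_open: "open U"
    using open_vimage[OF W_open cantor_rescaling.continuous_cmap[OF swap]] by simp
  have U_ne: "U \<noteq> {}"
    using \<open>Complex (-19/55) (8/55) \<in> W\<close> by (auto simp: U_def)
  have U_Q: "maxn u \<le> 1" if "u \<in> U" for u
    using that cmap_bounded by (auto simp: U_def W_def)
  have U_avoid: "\<nu> < maxn (u - p)" if "u \<in> U" "p \<in> corners" for u p
    using that cmap_avoids_corner(2) by (auto simp: U_def W_def)
  \<comment> \<open>The functional equation turns contraction by \<nu> in the image into contraction
    by 1/12 in the source, where K is invariant.\<close>
  have sub: "pieces \<nu> U n \<subseteq> F ` K" for n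
  proof (induction n)
    case 0
    then show ?case using WK by (auto simp: U_def)
  next
    case (Suc n)
    show ?case
    proof
      fix z assume "z \<in> pieces \<nu> U (Suc n)"
      then obtain p w where pw: "p \<in> corners" "w \<in> pieces \<nu> U n" "z = p + \<nu> *\<^sub>R w" by auto
      obtain u where u: "u \<in> K" "w = F u" using Suc pw(2) by blast
      then have "z = F (p + (1/12) *\<^sub>R u)"
        using pw by (simp add: cmap_near K_def)
      then show "z \<in> F ` K" using K_step[OF pw(1) u(1)] by blast
    qed
  qed
  \<comment> \<open>The nearby Cantor point has as address the word that produced the piece,
    continued by \<open>c0\<close>; the 2 bounds the distance of two points of the square.\<close>
  have near: "\<exists>c\<in>codes. maxn (z - cod \<nu> c) \<le> 2 * \<nu> ^ n" if "z \<in> pieces \<nu> U n" for z n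
    using that
  proof (induction n arbitrary: z)
    case 0
    then show ?case
      using U_Q[of z] maxn_triangle_diff[of z "cod \<nu> c0"] maxn_cod_le_1[OF \<nu> c0] c0
      by (intro bexI[of _ c0]) auto
  next
    case (Suc n)
    then obtain p w where pw: "p \<in> corners" "w \<in> pieces \<nu> U n" "z = p + \<nu> *\<^sub>R w" by auto
    obtain c where c: "c \<in> codes" "maxn (w - cod \<nu> c) \<le> 2 * \<nu> ^ n" using Suc.IH[OF pw(2)] by blast
    define b where "b = case_nat p c"
    have b: "b \<in> codes"
      using c(1) pw(1) by (auto simp: b_def codes_def split: nat.split)
    have "cod \<nu> b = p + \<nu> *\<^sub>R cod \<nu> c"
      using cod_unfold[OF _ _ b, of \<nu>] \<nu> by (simp add: b_def)
    then have "z - cod \<nu> b = \<nu> *\<^sub>R (w - cod \<nu> c)"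
      by (simp add: pw(3) scaleR_diff_right)
    then have "maxn (z - cod \<nu> b) \<le> 2 * \<nu> ^ Suc n"
      using c(2) \<nu> by simp
    then show ?case using b by blast
  qed
  have "(\<integral>\<^sup>+z\<in>\<Omega>. ennreal (bdist \<Omega> z powr (p - 2)) \<partial>lborel) = \<infinity>"
  proof (rule weighted_integral_infinite[OF \<nu> U_open U_ne U_Q U_avoid])
    show "pieces \<nu> U n \<subseteq> \<Omega>" for n
      using sub KF by blast
    show "p < 2" by (rule p(2))
    \<comment> \<open>The only use of p \<le> d in the divergence: it keeps every term (4 \<nu>^p)^n
      at least 1.\<close>
    have "\<nu> powr d \<le> \<nu> powr p"
      using p(3) \<nu> by (intro powr_mono') auto
    then show "1 \<le> 4 * \<nu> powr p" using \<nu>_d by simp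
    fix n z assume z: "z \<in> pieces \<nu> U n"
    obtain c where c: "c \<in> codes" "maxn (z - cod \<nu> c) \<le> 2 * \<nu> ^ n" using near[OF z] by blast
    have "bdist \<Omega> z \<le> dist z (cod \<nu> c)"
      unfolding bdist_def by (rule infdist_le[OF code_frontier[OF c(1)]])
    also have "\<dots> \<le> 4 * \<nu> ^ n"
      unfolding dist_norm using norm_le_maxn[of "z - cod \<nu> c"] c(2) by linarith
    finally have "bdist \<Omega> z \<le> 4 * \<nu> ^ n" .
    moreover have "z \<in> \<Omega>" using z sub KF by blast
    then have "z \<notin> frontier \<Omega>"
      using \<open>open \<Omega>\<close> by (simp add: frontier_def interior_open)
    then have "0 < bdist \<Omega> z"
      unfolding bdist_def using infdist_pos_not_in_closed[OF frontier_closed ne] by blast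
    ultimately show "0 < bdist \<Omega> z \<and> bdist \<Omega> z \<le> 4 * \<nu> ^ n" by blast
  qed auto
  moreover have "hausdorff_dim (frontier \<Omega>) = ereal d" "upper_minkowski_dim (frontier \<Omega>) = ereal d"
      "assouad_dim (frontier \<Omega>) = ereal d"
    using hd chain ad by (meson antisym order_trans)+
  ultimately show ?thesis
    using that quasidisk bounded by blast
qed

text \<open>The derivative term vanishes for a constant function, so the right-hand side is finite
  for every real C; a negative C is truncated to 0 by \<open>ennreal\<close>.\<close>

lemma not_weighted_estimate_const:
  assumes "(\<integral>\<^sup>+z\<in>\<Omega>. ennreal (bdist \<Omega> z powr (p - 2)) \<partial>lborel) = \<infinity>"
  shows "\<not> weighted_estimate p \<Omega> z0 C (\<lambda>_. 1)"
proof -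
  have "ennreal C * (ennreal (bdist \<Omega> z0 powr p) + 0) \<noteq> \<infinity>"
    by (simp add: ennreal_mult_eq_top_iff)
  then show ?thesis
    using assms unfolding weighted_estimate_def by (simp add: top_unique)
qed

theorem corollary5p3:
  fixes p d :: real
  assumes "1 < p" and "p < 2" and "p \<le> d" and "d < 2"
  shows "\<exists>\<Omega>::complex set.
    quasidisk \<Omega> \<and> bounded \<Omega> \<and>
    hausdorff_dim (frontier \<Omega>) = ereal d \<and>
    upper_minkowski_dim (frontier \<Omega>) = ereal d \<and>
    assouad_dim (frontier \<Omega>) = ereal d \<and>
    (\<integral>\<^sup>+z\<in>\<Omega>. ennreal (bdist \<Omega> z powr (p - 2)) \<partial>lborel) = \<infinity> \<and>
    (\<forall>z0\<in>\<Omega>. \<not> (\<exists>C::real. weighted_estimate p \<Omega> z0 C (\<lambda>_. 1)))"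
  by (rule quasidisk_of_dimension[OF assms]) (use not_weighted_estimate_const in blast)

end
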